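(* Let $(X,\mu)$ be an atomless standard Borel probability space. The topological group $G=\mathrm{Aut}(\mu)$ of measure preserving automorphisms of $(X,\mu)$, equipped with the weak topology, is totally minimal.
   Context: Elements of $\mathrm{Aut}(\mu)$ are invertible measure preserving transformations of $(X,\mu)$, identified when they agree $\mu$-a.e. The weak topology on $\mathrm{Aut}(\mu)$ is the one for which the Koopman map $T\mapsto U_T$, $U_Tf(x)=f(T^{-1}x)$, is a topological embedding into the unitary group of $L_2(\mu)$ with the strong operator topology; it makes $\mathrm{Aut}(\mu)$ a Polish group. A (Hausdorff) topological group is called minimal if it does not admit a strictly coarser Hausdorff group topology. It is called totally minimal if all its Hausdorff quotient groups (quotients by closed normal subgroups, with the quotient topology) are minimal. *)

theory Defs
  imports "HOL-Probability.Probability" "HOL-Algebra.Coset"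
begin

definition topological_group :: "('g, 'm) monoid_scheme \<Rightarrow> 'g topology \<Rightarrow> bool" where
  "topological_group G T \<longleftrightarrow>
     group G \<and> topspace T = carrier G \<and>
     continuous_map (prod_topology T T) T (\<lambda>(x, y). x \<otimes>\<^bsub>G\<^esub> y) \<and>
     continuous_map T T (\<lambda>x. inv\<^bsub>G\<^esub> x)"

definition hausdorff_group :: "('g, 'm) monoid_scheme \<Rightarrow> 'g topology \<Rightarrow> bool" where
  "hausdorff_group G T \<longleftrightarrow> topological_group G T \<and> Hausdorff_space T"

definition strictly_coarser :: "'g topology \<Rightarrow> 'g topology \<Rightarrow> bool" where
  "strictly_coarser S T \<longleftrightarrow>
     topspace S = topspace T \<and> (\<forall>U. openin S U \<longrightarrow> openin T U) \<and> S \<noteq> T"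

definition minimal_group :: "('g, 'm) monoid_scheme \<Rightarrow> 'g topology \<Rightarrow> bool" where
  "minimal_group G T \<longleftrightarrow>
     hausdorff_group G T \<and> \<not> (\<exists>S. strictly_coarser S T \<and> hausdorff_group G S)"

definition quotient_group_topology ::
    "('g, 'm) monoid_scheme \<Rightarrow> 'g topology \<Rightarrow> 'g set \<Rightarrow> 'g set topology" where
  "quotient_group_topology G T N = topology (\<lambda>V.
     V \<subseteq> carrier (G Mod N) \<and> openin T {x \<in> topspace T. N #>\<^bsub>G\<^esub> x \<in> V})"

lemma openin_quotient_group_topology:
  "openin (quotient_group_topology G T N) V \<longleftrightarrow>
     V \<subseteq> carrier (G Mod N) \<and> openin T {x \<in> topspace T. N #>\<^bsub>G\<^esub> x \<in> V}"
proof -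
  have "istopology (\<lambda>V. V \<subseteq> carrier (G Mod N) \<and>
          openin T {x \<in> topspace T. N #>\<^bsub>G\<^esub> x \<in> V})"
    unfolding istopology_def
  proof (intro conjI allI impI, goal_cases)
    case (1 S V)
    then show ?case by auto
  next
    case (2 S V)
    have "{x \<in> topspace T. N #>\<^bsub>G\<^esub> x \<in> S \<inter> V} =
        {x \<in> topspace T. N #>\<^bsub>G\<^esub> x \<in> S} \<inter> {x \<in> topspace T. N #>\<^bsub>G\<^esub> x \<in> V}" by auto
    with 2 show ?case by auto
  next
    case (3 K)
    then show ?case by auto
  next
    case (4 K)
    have "{x \<in> topspace T. N #>\<^bsub>G\<^esub> x \<in> \<Union>K} =
        (\<Union>V\<in>K. {x \<in> topspace T. N #>\<^bsub>G\<^esub> x \<in> V})" by auto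
    with 4 show ?case by auto
  qed
  then show ?thesis
    by (simp add: quotient_group_topology_def topology_inverse')
qed

lemma quotient_map_quotient_group_topology:
  assumes "topspace T = carrier G"
  shows "quotient_map T (quotient_group_topology G T N) (\<lambda>x. N #>\<^bsub>G\<^esub> x)"
proof -
  have "openin (quotient_group_topology G T N) (carrier (G Mod N))"
  proof -
    have "{x \<in> topspace T. N #>\<^bsub>G\<^esub> x \<in> carrier (G Mod N)} = topspace T"
      using assms by (auto simp: carrier_FactGroup)
    then show ?thesis by (simp add: openin_quotient_group_topology)
  qed
  then have "topspace (quotient_group_topology G T N) = carrier (G Mod N)"
    by (auto simp: topspace_def openin_quotient_group_topology)
  then show ?thesis
    using assms by (auto simp: quotient_map_def openin_quotient_group_topology carrier_FactGroup)
qed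

definition totally_minimal_group :: "('g, 'm) monoid_scheme \<Rightarrow> 'g topology \<Rightarrow> bool" where
  "totally_minimal_group G T \<longleftrightarrow>
     hausdorff_group G T \<and>
     (\<forall>N. N \<lhd> G \<and> closedin T N \<longrightarrow> minimal_group (G Mod N) (quotient_group_topology G T N))"

definition standard_borel :: "'a measure \<Rightarrow> bool" where
  "standard_borel M \<longleftrightarrow>
     (\<exists>T. topspace T = space M \<and> completely_metrizable_space T \<and> second_countable T \<and>
          sets M = sigma_sets (space M) {U. openin T U})"

definition atomless :: "'a measure \<Rightarrow> bool" where
  "atomless M \<longleftrightarrow>
     (\<forall>A\<in>sets M. 0 < emeasure M A \<longrightarrow>
        (\<exists>B\<in>sets M. B \<subseteq> A \<and> 0 < emeasure M B \<and> emeasure M B < emeasure M A))"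

definition ae_rel :: "'a measure \<Rightarrow> ('a \<Rightarrow> 'b) set \<Rightarrow> (('a \<Rightarrow> 'b) \<times> ('a \<Rightarrow> 'b)) set" where
  "ae_rel M D = {(f, g). f \<in> D \<and> g \<in> D \<and> (AE x in M. f x = g x)}"

text \<open>Operations on classes are computed on chosen representatives. All of them respect equality
  almost everywhere, so the choice does not matter.\<close>

definition rep :: "'c set \<Rightarrow> 'c" where
  "rep A = (SOME f. f \<in> A)"

text \<open>Values outside \<^term>\<open>space M\<close> are unconstrained; they are ignored by the identification
  almost everywhere.\<close>

definition mp_transformations :: "'a measure \<Rightarrow> ('a \<Rightarrow> 'a) set" where
  "mp_transformations M =
     {T. bij_betw T (space M) (space M) \<and>
         T \<in> measurable M M \<and> inv_into (space M) T \<in> measurable M M \<and>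
         distr M M T = M}"

definition aut_class :: "'a measure \<Rightarrow> ('a \<Rightarrow> 'a) \<Rightarrow> ('a \<Rightarrow> 'a) set" where
  "aut_class M T = ae_rel M (mp_transformations M) `` {T}"

definition Aut :: "'a measure \<Rightarrow> ('a \<Rightarrow> 'a) set monoid" where
  "Aut M =
     \<lparr>carrier = mp_transformations M // ae_rel M (mp_transformations M),
      mult = (\<lambda>A B. aut_class M (rep A \<circ> rep B)),
      one = aut_class M (\<lambda>x. x)\<rparr>"

definition sq_integrable :: "'a measure \<Rightarrow> ('a \<Rightarrow> complex) set" where
  "sq_integrable M = {f \<in> borel_measurable M. integrable M (\<lambda>x. (cmod (f x))\<^sup>2)}"

definition L2 :: "'a measure \<Rightarrow> ('a \<Rightarrow> complex) set set" where
  "L2 M = sq_integrable M // ae_rel M (sq_integrable M)"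

definition L2_class :: "'a measure \<Rightarrow> ('a \<Rightarrow> complex) \<Rightarrow> ('a \<Rightarrow> complex) set" where
  "L2_class M f = ae_rel M (sq_integrable M) `` {f}"

definition L2_add ::
    "'a measure \<Rightarrow> ('a \<Rightarrow> complex) set \<Rightarrow> ('a \<Rightarrow> complex) set \<Rightarrow> ('a \<Rightarrow> complex) set" where
  "L2_add M F H = L2_class M (\<lambda>x. rep F x + rep H x)"

definition L2_scale ::
    "'a measure \<Rightarrow> complex \<Rightarrow> ('a \<Rightarrow> complex) set \<Rightarrow> ('a \<Rightarrow> complex) set" where
  "L2_scale M c F = L2_class M (\<lambda>x. c * rep F x)"

definition L2_inner ::
    "'a measure \<Rightarrow> ('a \<Rightarrow> complex) set \<Rightarrow> ('a \<Rightarrow> complex) set \<Rightarrow> complex" where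
  "L2_inner M F H = (LINT x|M. rep F x * cnj (rep H x))"

definition L2_dist ::
    "'a measure \<Rightarrow> ('a \<Rightarrow> complex) set \<Rightarrow> ('a \<Rightarrow> complex) set \<Rightarrow> real" where
  "L2_dist M F H = sqrt (LINT x|M. (cmod (rep F x - rep H x))\<^sup>2)"

definition L2_topology :: "'a measure \<Rightarrow> ('a \<Rightarrow> complex) set topology" where
  "L2_topology M = Metric_space.mtopology (L2 M) (L2_dist M)"

text \<open>Operators are extensional functions, i.e. equal to \<^term>\<open>undefined\<close> outside \<^term>\<open>L2 M\<close>,
  so that they are points of the product space \<^term>\<open>\<Pi>\<^sub>E F\<in>L2 M. L2 M\<close>.\<close>

definition unitary_operators ::
    "'a measure \<Rightarrow> (('a \<Rightarrow> complex) set \<Rightarrow> ('a \<Rightarrow> complex) set) set" where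
  "unitary_operators M =
     {U. U \<in> extensional (L2 M) \<and> bij_betw U (L2 M) (L2 M) \<and>
         (\<forall>F\<in>L2 M. \<forall>H\<in>L2 M. U (L2_add M F H) = L2_add M (U F) (U H)) \<and>
         (\<forall>c. \<forall>F\<in>L2 M. U (L2_scale M c F) = L2_scale M c (U F)) \<and>
         (\<forall>F\<in>L2 M. \<forall>H\<in>L2 M. L2_inner M (U F) (U H) = L2_inner M F H)}"

text \<open>The strong operator topology is the topology of pointwise norm convergence.\<close>

definition strong_operator_topology ::
    "'a measure \<Rightarrow> (('a \<Rightarrow> complex) set \<Rightarrow> ('a \<Rightarrow> complex) set) topology" where
  "strong_operator_topology M =
     subtopology (product_topology (\<lambda>_. L2_topology M) (L2 M)) (unitary_operators M)"

definition koopman ::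
    "'a measure \<Rightarrow> ('a \<Rightarrow> 'a) set \<Rightarrow> ('a \<Rightarrow> complex) set \<Rightarrow> ('a \<Rightarrow> complex) set" where
  "koopman M A =
     (\<lambda>F\<in>L2 M. L2_class M (\<lambda>x. rep F (inv_into (space M) (rep A) x)))"

text \<open>The initial topology of the Koopman map, which is the only topology that can make this
  map an embedding.\<close>

definition weak_topology :: "'a measure \<Rightarrow> ('a \<Rightarrow> 'a) set topology" where
  "weak_topology M =
     pullback_topology (carrier (Aut M)) (koopman M) (strong_operator_topology M)"

end

theory Submission
  imports Defs
begin

text \<open>
Let \<open>S\<close> be a group topology on \<open>Aut(\<mu>)\<close> that is strictly coarser than the weak topology. The point is
that \<open>S\<close> is then indiscrete; total minimality follows by pulling back topologies from the quotients,
and no simplicity of \<open>Aut(\<mu>)\<close> is needed.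

Every \<open>S\<close>-neighbourhood \<open>W\<close> of the identity contains the stabilizer of a partition \<open>Q\<close> into cells of
equal measure. Multiplying \<open>g \<in> W\<close> by a generic element of this stabilizer makes a set \<open>g A\<close> behave
like the conditional expectation of its indicator along \<open>Q\<close>. Since \<open>S\<close> is strictly coarser, there are
a partition \<open>P\<close> and arbitrarily \<open>S\<close>-small elements that move some cell of \<open>P\<close> by a fixed amount;
conjugating them with automorphisms that mix \<open>Q\<close> inside a cell of \<open>P\<close> and inside its complement,
one finds \<open>S\<close>-small elements sending a cell of \<open>P\<close> to a set that is far from \<open>Q\<close>-measurable, by an
amount that depends neither on \<open>W\<close> nor on \<open>Q\<close>. Consider the energy of \<open>g\<close>, the sum of the squared
norms of the conditional expectations along \<open>Q\<close> of the indicators of \<open>g P\<^sub>i\<close>. As long as it exceeds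
its minimum by \<open>\<kappa>\<close>, a further factor, conjugated by a suitable permutation of the cells of \<open>Q\<close>,
lowers it by a definite amount. Hence there are \<open>S\<close>-small elements \<open>g\<close> for which all \<open>g P\<^sub>i\<close> are
almost independent of all \<open>P\<^sub>j\<close>. For arbitrary \<open>h\<close> the element \<open>h p g\<close>, with \<open>p\<close> generic in the
stabilizer of \<open>P\<close>, has the same property, and two such elements differ only by \<open>S\<close>-small factors on
both sides. So \<open>h\<close> is a product of boundedly many \<open>S\<close>-small elements.
\<close>

section \<open>Standard Borel spaces as Borel subsets of the line\<close>

text \<open>The obstacle is an element that merely permutes the cells of a partition: images of
  cells remain unions of cells, and multiplication by such an element never lowers the energy. Hence
  the search for sets that are quantitatively far from \<open>Q\<close>-measurable. Such a set shows
  only that a factor loses energy on one particular step function, the indicator of a block of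
  cells, whereas the loss is wanted on the densities of the sets \<open>act g (P i)\<close>.
  Permutations of cells bridge this: summing a density over all rearrangements that put its largest
  values on the block gives a two-valued function, whose loss is a multiple of that of the
  indicator. The constants must not depend on \<open>W\<close> and \<open>Q\<close>, because every
  step of the iteration shrinks \<open>W\<close> and changes \<open>Q\<close>, while the energy is
  bounded by 1 throughout. The dichotomy for \<open>S\<close> has to cover topologies that are not
  Hausdorff, since a topology pulled back from the quotient by a nontrivial normal subgroup never
  is.\<close>

definition ternary :: "(nat \<Rightarrow> bool) \<Rightarrow> real" where
  "ternary c = (\<Sum>k. of_bool (c k) * (1/3) ^ k)"

definition ternary_shift :: "real \<Rightarrow> real" where
  "ternary_shift s = 3 * (s - of_bool (1 \<le> s))"

definition ternary_digit :: "real \<Rightarrow> nat \<Rightarrow> bool" where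
  "ternary_digit s k \<longleftrightarrow> 1 \<le> (ternary_shift ^^ k) s"

lemma summable_ternary: "summable (\<lambda>k. of_bool (c k) * (1/3 :: real) ^ k)"
  by (rule summable_comparison_test'[of "\<lambda>k. (1/3) ^ k" 0]) (auto simp: summable_geometric)

lemma ternary_unfold: "ternary c = of_bool (c 0) + ternary (\<lambda>k. c (Suc k)) / 3"
proof -
  have "ternary c = (\<Sum>k. of_bool (c (Suc k)) * (1/3) ^ Suc k) + of_bool (c 0)"
    unfolding ternary_def using suminf_split_head[OF summable_ternary[of c]] by simp
  also have "(\<Sum>k. of_bool (c (Suc k)) * (1/3 :: real) ^ Suc k) = ternary (\<lambda>k. c (Suc k)) * (1/3)"
    unfolding ternary_def using suminf_mult2[OF summable_ternary[of "\<lambda>k. c (Suc k)"], of "1/3"]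
    by (simp add: mult_ac)
  finally show ?thesis by simp
qed

lemma ternary_nonneg: "0 \<le> ternary c"
  unfolding ternary_def by (rule suminf_nonneg[OF summable_ternary]) auto

lemma ternary_le: "ternary c \<le> 3/2"
proof -
  have "ternary c \<le> (\<Sum>k. (1/3) ^ k)"
    unfolding ternary_def by (rule suminf_le[OF _ summable_ternary]) (auto simp: summable_geometric)
  then show ?thesis by (simp add: suminf_geometric)
qed

text \<open>The tail after the leading digit is at most 1/2, so the value alone determines that
  digit. Base 3 with the digits 0 and 1 avoids the double expansions of base 2.\<close>

lemma ternary_ge_1_iff: "1 \<le> ternary c \<longleftrightarrow> c 0"
proof -
  have "of_bool (c 0) \<le> ternary c" "ternary c \<le> of_bool (c 0) + 1/2"
    using ternary_unfold[of c] ternary_nonneg[of "\<lambda>k. c (Suc k)"] ternary_le[of "\<lambda>k. c (Suc k)"]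
    by linarith+
  then show ?thesis by (cases "c 0") auto
qed

lemma ternary_shift_ternary: "ternary_shift (ternary c) = ternary (\<lambda>k. c (Suc k))"
  using ternary_unfold[of c] ternary_ge_1_iff[of c] by (cases "c 0") (auto simp: ternary_shift_def)

lemma ternary_digit_ternary: "ternary_digit (ternary c) = c"
proof
  fix k
  have "(ternary_shift ^^ k) (ternary c) = ternary (\<lambda>i. c (i + k))"
  proof (induction k)
    case (Suc k)
    then show ?case by (simp add: ternary_shift_ternary)
  qed simp
  then show "ternary_digit (ternary c) k = c k"
    by (simp add: ternary_digit_def ternary_ge_1_iff)
qed

lemma measurable_ternary_shift [measurable]: "ternary_shift \<in> borel_measurable borel"
  unfolding ternary_shift_def by measurable

lemma measurable_ternary_digit [measurable]: "Measurable.pred borel (\<lambda>s. ternary_digit s k)"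
proof -
  have "ternary_shift ^^ k \<in> borel_measurable borel"
    by (induction k) (auto simp: measurable_ternary_shift intro: measurable_comp)
  then show ?thesis unfolding ternary_digit_def by measurable
qed

lemma measurable_ternary_comp:
  assumes "\<And>k. Measurable.pred M (\<lambda>x. c x k)"
  shows "(\<lambda>x. ternary (c x)) \<in> borel_measurable M"
  unfolding ternary_def using assms by measurable

section \<open>Codes of points by the balls that contain them\<close>

definition ball_code :: "('a \<Rightarrow> 'a \<Rightarrow> real) \<Rightarrow> (nat \<Rightarrow> 'a) \<Rightarrow> 'a \<Rightarrow> nat \<Rightarrow> bool" where
  "ball_code d a p k \<longleftrightarrow> d p (a (fst (prod_decode k))) < 1 / Suc (snd (prod_decode k))"

lemma ball_code_encode [simp]: "ball_code d a p (prod_encode (n, j)) \<longleftrightarrow> d p (a n) < 1 / Suc j"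
  by (simp add: ball_code_def)

text \<open>For a dense sequence \<open>a\<close> in a complete space these countably many conditions single out
  the codes of points.\<close>

definition is_code :: "('a \<Rightarrow> 'a \<Rightarrow> real) \<Rightarrow> (nat \<Rightarrow> 'a) \<Rightarrow> (nat \<Rightarrow> bool) \<Rightarrow> bool" where
  "is_code d a c \<longleftrightarrow>
     (\<forall>j. \<exists>n. c (prod_encode (n, j))) \<and>
     (\<forall>n j m i. c (prod_encode (n, j)) \<and> c (prod_encode (m, i)) \<longrightarrow>
        d (a n) (a m) < 1 / Suc j + 1 / Suc i) \<and>
     (\<forall>n j. c (prod_encode (n, j)) \<longrightarrow>
        (\<exists>i. \<forall>m. c (prod_encode (m, i)) \<longrightarrow> d (a n) (a m) + 1 / Suc i < 1 / Suc j)) \<and>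
     (\<forall>n j. \<not> c (prod_encode (n, j)) \<longrightarrow>
        (\<forall>m i. c (prod_encode (m, i)) \<longrightarrow> d (a n) (a m) + 1 / Suc i \<ge> 1 / Suc j))"

lemma ex_inverse_Suc_less: "0 < (e::real) \<Longrightarrow> \<exists>i. 1 / real (Suc i) < e"
  using nat_approx_posE by metis

text \<open>From right to left the conditions are triangle inequalities. From left to right, one
  ball of each radius is picked from \<open>c\<close>; by the second condition their centers form a
  Cauchy sequence, and completeness supplies \<open>p\<close>. At this stage \<open>p\<close> lies
  only in the closed ball of each listed pair. The third condition upgrades this to the open ball,
  and the fourth forbids omitting a ball that contains \<open>p\<close>.\<close>

lemma (in Metric_space) is_code_iff:
  assumes comp: "mcomplete" and a: "range a \<subseteq> M"
    and dense: "\<And>p e. p \<in> M \<Longrightarrow> 0 < e \<Longrightarrow> \<exists>n. d p (a n) < e"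
  shows "is_code d a c \<longleftrightarrow> (\<exists>p\<in>M. c = ball_code d a p)"
proof
  assume "\<exists>p\<in>M. c = ball_code d a p"
  then obtain p where p: "p \<in> M" "c = ball_code d a p" by blast
  have aM: "a n \<in> M" for n using a by auto
  have tri: "d (a n) (a m) \<le> d p (a n) + d p (a m)" for n m
    using triangle'[OF aM p(1) aM] commute by metis
  have tri2: "d p (a n) \<le> d p (a m) + d (a n) (a m)" for n m
    using triangle[of p "a m" "a n", OF p(1) aM aM] commute[of "a m" "a n"] by simp
  have "\<exists>n. d p (a n) < 1 / Suc j" for j using dense[OF p(1)] by simp
  moreover have "d (a n) (a m) < 1 / Suc j + 1 / Suc i"
    if "d p (a n) < 1 / Suc j" "d p (a m) < 1 / Suc i" for n j m i
    using tri[of n m] that by linarith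
  moreover have "\<exists>i. \<forall>m. d p (a m) < 1 / Suc i \<longrightarrow> d (a n) (a m) + 1 / Suc i < 1 / Suc j"
    if less: "d p (a n) < 1 / Suc j" for n j
  proof -
    \<comment> \<open>The small radius enters twice, as a bound for \<open>d p (a m)\<close> and as
      the added term, hence half of the slack.\<close>
    obtain i where i: "1 / real (Suc i) < (1 / Suc j - d p (a n)) / 2"
      using ex_inverse_Suc_less[of "(1 / Suc j - d p (a n)) / 2"] less by fastforce
    have "d (a n) (a m) + 1 / Suc i < 1 / Suc j" if "d p (a m) < 1 / Suc i" for m
      using tri[of n m] that less i by argo
    then show ?thesis by blast
  qed
  moreover have "d (a n) (a m) + 1 / Suc i \<ge> 1 / Suc j"
    if "\<not> d p (a n) < 1 / Suc j" "d p (a m) < 1 / Suc i" for n j m i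
    using tri2[of n m] that by linarith
  ultimately show "is_code d a c"
    unfolding is_code_def p(2) by (simp del: of_nat_Suc)
next
  assume "is_code d a c"
  then have c1: "\<And>j. \<exists>n. c (prod_encode (n, j))"
    and c2: "\<And>n j m i. c (prod_encode (n, j)) \<Longrightarrow> c (prod_encode (m, i)) \<Longrightarrow>
        d (a n) (a m) < 1 / Suc j + 1 / Suc i"
    and c3: "\<And>n j. c (prod_encode (n, j)) \<Longrightarrow>
        (\<exists>i. \<forall>m. c (prod_encode (m, i)) \<longrightarrow> d (a n) (a m) + 1 / Suc i < 1 / Suc j)"
    and c4: "\<And>n j m i. \<not> c (prod_encode (n, j)) \<Longrightarrow> c (prod_encode (m, i)) \<Longrightarrow>
        d (a n) (a m) + 1 / Suc i \<ge> 1 / Suc j"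
    unfolding is_code_def by (blast, blast, blast, blast)
  have aM: "a n \<in> M" for n using a by auto
  from c1 obtain n where n: "\<And>j. c (prod_encode (n j, j))" by metis
  have "MCauchy (\<lambda>j. a (n j))"
    unfolding MCauchy_def
  proof (intro conjI allI impI)
    show "range (\<lambda>j. a (n j)) \<subseteq> M" using aM by auto
    fix e :: real assume "0 < e"
    then obtain N where N: "1 / real (Suc N) < e / 2"
      using ex_inverse_Suc_less[of "e / 2"] by auto
    have "d (a (n i)) (a (n j)) < e" if "N \<le> i" "N \<le> j" for i j
    proof -
      have "1 / real (Suc i) \<le> 1 / real (Suc N)" "1 / real (Suc j) \<le> 1 / real (Suc N)"
        using that by (auto intro!: divide_left_mono)
      then show ?thesis using c2[OF n[of i] n[of j]] N by linarith
    qed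
    then show "\<exists>N. \<forall>i j. N \<le> i \<longrightarrow> N \<le> j \<longrightarrow> d (a (n i)) (a (n j)) < e" by blast
  qed
  then obtain p where p: "limitin mtopology (\<lambda>j. a (n j)) p sequentially"
    using comp unfolding mcomplete_def by blast
  then have pM: "p \<in> M" and lim: "\<And>e. 0 < e \<Longrightarrow> \<exists>N. \<forall>j\<ge>N. d (a (n j)) p < e"
    unfolding limit_metric_sequentially by blast+
  have near: "d p (a m) \<le> 1 / Suc i" if "c (prod_encode (m, i))" for m i
  proof (rule field_le_epsilon)
    fix e :: real assume e: "0 < e"
    obtain N where N: "\<forall>j\<ge>N. d (a (n j)) p < e / 2" using lim[of "e / 2"] e by auto
    obtain N' where N': "1 / real (Suc N') < e / 2"
      using ex_inverse_Suc_less[of "e / 2"] e by auto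
    define j where "j = max N N'"
    have "1 / real (Suc j) \<le> 1 / real (Suc N')"
      unfolding j_def by (auto intro!: divide_left_mono)
    moreover have "d p (a m) \<le> d (a (n j)) p + d (a (n j)) (a m)"
      using triangle[of p "a (n j)" "a m", OF pM aM aM] commute[of p "a (n j)"] by simp
    moreover have "d (a (n j)) (a m) < 1 / Suc j + 1 / Suc i" by (rule c2[OF n that])
    moreover have "d (a (n j)) p < e / 2" using N by (simp add: j_def)
    ultimately show "d p (a m) \<le> 1 / real (Suc i) + e" using N' by linarith
  qed
  have "c (prod_encode (m, j)) \<longleftrightarrow> d p (a m) < 1 / Suc j" for m j
  proof
    assume "c (prod_encode (m, j))"
    then obtain i where i: "\<And>k. c (prod_encode (k, i)) \<Longrightarrow> d (a m) (a k) + 1 / Suc i < 1 / Suc j"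
      using c3 by blast
    have "d p (a m) \<le> d p (a (n i)) + d (a m) (a (n i))"
      using triangle[of p "a (n i)" "a m", OF pM aM aM] commute[of "a m" "a (n i)"] by simp
    then show "d p (a m) < 1 / Suc j" using i[OF n[of i]] near[OF n[of i]] by linarith
  next
    assume less: "d p (a m) < 1 / Suc j"
    show "c (prod_encode (m, j))"
    proof (rule ccontr)
      assume neg: "\<not> c (prod_encode (m, j))"
      obtain i where i: "1 / real (Suc i) < (1 / Suc j - d p (a m)) / 2"
        using ex_inverse_Suc_less[of "(1 / Suc j - d p (a m)) / 2"] less by fastforce
      have "d (a m) (a (n i)) \<le> d p (a m) + d p (a (n i))"
        using triangle[of "a m" p "a (n i)", OF aM pM aM] commute[of p "a m"] by simp
      then show False using c4[OF neg n[of i]] near[OF n[of i]] i by argo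
    qed
  qed
  then have "c k = ball_code d a p k" for k
    by (metis prod_decode_inverse surj_pair ball_code_encode)
  then show "\<exists>p\<in>M. c = ball_code d a p" using pM by blast
qed

text \<open>Whether \<open>s\<close> belongs to the image can be read off its digits: they have to
  satisfy the countably many conditions of a code. So the image of the space is Borel, a basic ball
  corresponds to fixing one digit, and injectivity carries complements over to images, which reaches
  the whole generated sigma-algebra.\<close>

lemma standard_borel_real_embedding:
  assumes "standard_borel M" "space M \<noteq> {}"
  shows "\<exists>f::'a \<Rightarrow> real. inj_on f (space M) \<and> f \<in> borel_measurable M \<and>
           (\<forall>E\<in>sets M. f ` E \<in> sets borel)"
proof -
  obtain T where T: "topspace T = space M" "completely_metrizable_space T" "second_countable T"
      "sets M = sigma_sets (space M) {U. openin T U}"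
    using assms(1) unfolding standard_borel_def by blast
  obtain X d where X: "Metric_space X d" "Metric_space.mcomplete X d"
      "T = Metric_space.mtopology X d"
    using T(2) unfolding completely_metrizable_space_def by blast
  interpret Metric_space X d by (rule X(1))
  have XM: "X = space M" using T(1) X(3) by simp
  obtain C where C: "countable C" "C \<subseteq> X" "T closure_of C = X"
    using second_countable_imp_separable_space[OF T(3)] unfolding separable_space_def T(1) XM by blast
  have "C \<noteq> {}" using C(3) assms(2) XM by auto
  define a where "a = from_nat_into C"
  have a: "range a \<subseteq> X" using C(2) \<open>C \<noteq> {}\<close> by (metis a_def order_trans range_from_nat_into_subset)
  have dense: "\<exists>n. d p (a n) < e" if p: "p \<in> X" "0 < e" for p e
  proof -
    have "p \<in> T closure_of C" using p C by simp
    then obtain y where "y \<in> C" "y \<in> mball p e"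
      using p unfolding X(3) metric_closure_of by blast
    then show ?thesis
      using from_nat_into_surj[OF C(1)] unfolding a_def by (metis in_mball)
  qed
  have code_iff: "is_code d a c \<longleftrightarrow> (\<exists>p\<in>X. c = ball_code d a p)" for c
    using is_code_iff[OF X(2) a dense] by blast
  define f where "f p = ternary (ball_code d a p)" for p
  have digit_f: "ternary_digit (f p) = ball_code d a p" for p
    by (simp add: f_def ternary_digit_ternary)
  define U where "U k = {p\<in>X. ball_code d a p k}" for k
  have open_U: "openin T (U k)" for k
  proof -
    have "U k = mball (a (fst (prod_decode k))) (1 / Suc (snd (prod_decode k)))"
      using range_subsetD[OF a] by (auto simp: U_def ball_code_def commute simp del: of_nat_Suc)
    then show ?thesis by (simp add: X(3))
  qed
  have basis: "\<exists>k. p \<in> U k \<and> U k \<subseteq> V" if V: "openin T V" "p \<in> V" for V p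
  proof -
    obtain e where e: "0 < e" "mball p e \<subseteq> V" and pX: "p \<in> X"
      using V unfolding X(3) openin_mtopology by blast
    obtain j where j: "1 / real (Suc j) < e / 2" using ex_inverse_Suc_less[of "e / 2"] e by auto
    obtain n where n: "d p (a n) < 1 / Suc j" using dense[OF pX, of "1 / Suc j"] by auto
    have "q \<in> mball p e" if "q \<in> U (prod_encode (n, j))" for q
    proof -
      have q: "q \<in> X" "d q (a n) < 1 / Suc j" using that by (auto simp: U_def simp del: of_nat_Suc)
      have "d p q \<le> d p (a n) + d q (a n)"
        using triangle[of p "a n" q, OF pX range_subsetD[OF a] q(1)] commute[of q "a n"] by simp
      then show ?thesis using q pX n j by simp
    qed
    then show ?thesis using e n pX
      by (intro exI[of _ "prod_encode (n, j)"]) (auto simp: U_def simp del: of_nat_Suc)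
  qed
  have U_sets: "U k \<in> sets M" for k
    using open_U unfolding T(4) by (auto intro: sigma_sets.Basic)
  have pred_code: "Measurable.pred M (\<lambda>p. ball_code d a p k)" for k
    using U_sets[of k] unfolding U_def XM by (simp add: pred_def)
  have f_meas: "f \<in> borel_measurable M"
    unfolding f_def by (rule measurable_ternary_comp) (rule pred_code)
  have inj: "inj_on f X"
  proof (rule inj_onI, rule ccontr)
    fix p q assume pq: "p \<in> X" "q \<in> X" "f p = f q" "p \<noteq> q"
    then have "openin T (mball p (d p q))" "p \<in> mball p (d p q)" using mdist_pos_less by (auto simp: X(3))
    then obtain k where "p \<in> U k" "U k \<subseteq> mball p (d p q)" using basis by blast
    then have "ball_code d a p k" "\<not> ball_code d a q k" using pq by (auto simp: U_def)
    then show False using pq(3) digit_f by metis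
  qed
  \<comment> \<open>The second conjunct discards the numbers whose extracted digits form a code
    without summing up to the number itself.\<close>
  have image_X: "f ` X = {s. is_code d a (ternary_digit s) \<and> ternary (ternary_digit s) = s}"
    unfolding code_iff f_def by (auto simp: ternary_digit_ternary)
  have borel_X: "f ` X \<in> sets borel"
  proof -
    have "Measurable.pred borel (\<lambda>s. is_code d a (ternary_digit s))"
      unfolding is_code_def by measurable
    moreover have "(\<lambda>s. ternary (ternary_digit s)) \<in> borel_measurable borel"
      by (rule measurable_ternary_comp) (rule measurable_ternary_digit)
    ultimately have "Measurable.pred borel (\<lambda>s. is_code d a (ternary_digit s) \<and> ternary (ternary_digit s) = s)"
      by measurable
    then show ?thesis unfolding image_X pred_def by simp
  qed
  have image_U: "f ` U k = f ` X \<inter> {s. ternary_digit s k}" for k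
    by (auto simp: U_def digit_f)
  have borel_U: "f ` U k \<in> sets borel" for k
  proof -
    have "{s. ternary_digit s k} \<in> sets borel"
      using measurable_ternary_digit[of k] by (simp add: pred_def)
    then show ?thesis unfolding image_U using borel_X by blast
  qed
  have "f ` E \<in> sets borel" if "E \<in> sigma_sets X {U. openin T U}" for E
    using that
  proof induction
    case (Basic V)
    then have "V = (\<Union>k\<in>{k. U k \<subseteq> V}. U k)" using basis by blast
    then have "f ` V = (\<Union>k\<in>{k. U k \<subseteq> V}. f ` U k)" by (metis image_UN)
    then show ?case using borel_U by auto
  next
    case (Compl V)
    have "V \<subseteq> X" using Compl.hyps sigma_sets_into_sp[of "{U. openin T U}" X V] openin_subset[of T] T(1) XM
      by auto
    then have "f ` (X - V) = f ` X - f ` V" using inj by (simp add: inj_on_image_set_diff)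
    then show ?case using Compl borel_X by simp
  next
    case (Union V)
    then show ?case by (auto simp: image_UN)
  qed simp
  then show ?thesis using inj f_meas T(4) XM by auto
qed

section \<open>Uniform coordinates\<close>

context finite_borel_measure
begin

context
  assumes diffuse: "\<And>x. measure M {x} = 0"
begin

lemma cdf_continuous: "continuous_on A (cdf M)"
  using diffuse isCont_cdf by (simp add: continuous_at_imp_continuous_on)

lemma cdf_attains:
  assumes "0 < s" "s < measure M (space M)"
  shows "\<exists>t. cdf M t = s"
proof -
  have "eventually (\<lambda>t. cdf M t < s) at_bot" using cdf_lim_at_bot assms(1) by (rule order_tendstoD)
  then obtain t1 where t1: "cdf M t1 < s" by (auto simp: eventually_at_bot_linorder)
  have "eventually (\<lambda>t. s < cdf M t) at_top" using cdf_lim_at_top assms(2) by (rule order_tendstoD)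
  then obtain t2 where t2: "s < cdf M t2" by (auto simp: eventually_at_top_linorder)
  have "t1 \<le> t2" using t1 t2 cdf_nondecreasing[of t2 t1] by (cases "t1 \<le> t2") auto
  then show ?thesis
    using IVT'[of "cdf M" t1 s t2] t1 t2 cdf_continuous by auto
qed

lemma cdf_measurable: "cdf M \<in> borel_measurable borel"
  using cdf_continuous by (rule borel_measurable_continuous_onI)

text \<open>The sublevel set is empty, which by the limit at minus infinity forces
  \<open>s = 0\<close>, or it is the whole line, or it is a closed half-line, at whose end point
  continuity makes \<open>cdf M\<close> equal to \<open>s\<close>.\<close>

lemma measure_cdf_le:
  assumes "0 \<le> s" "s \<le> measure M (space M)"
  shows "measure M {t. cdf M t \<le> s} = s"
proof -
  consider "{t. cdf M t \<le> s} = {}" | "s = measure M (space M)"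
    | "{t. cdf M t \<le> s} \<noteq> {}" "s < measure M (space M)" using assms by linarith
  then show ?thesis
  proof cases
    case 1
    have "s \<le> 0"
      using 1 by (intro tendsto_lowerbound[OF cdf_lim_at_bot]) (auto simp: not_le less_imp_le)
    then show ?thesis using 1 assms by simp
  next
    case 2
    then have "{t. cdf M t \<le> s} = space M" using cdf_bounded borel_UNIV by auto
    then show ?thesis using 2 by simp
  next
    case 3
    define t1 where "t1 = Sup {t. cdf M t \<le> s}"
    have "eventually (\<lambda>t. s < cdf M t) at_top" using cdf_lim_at_top 3(2) by (rule order_tendstoD)
    then obtain t2 where t2: "s < cdf M t2" by (auto simp: eventually_at_top_linorder)
    have bdd: "bdd_above {t. cdf M t \<le> s}"
    proof (rule bdd_aboveI)
      show "t \<le> t2" if "t \<in> {t. cdf M t \<le> s}" for t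
        using that t2 cdf_nondecreasing[of t2 t] by (cases "t \<le> t2") auto
    qed
    have "closed {t. cdf M t \<le> s}"
      by (rule closed_Collect_le) (auto intro: cdf_continuous)
    then have t1: "cdf M t1 \<le> s"
      using closed_contains_Sup[OF 3(1) bdd] by (simp add: t1_def)
    have eq: "{t. cdf M t \<le> s} = {..t1}"
      using cSup_upper[OF _ bdd] t1 cdf_nondecreasing unfolding t1_def by (force intro: order_trans)
    have "s \<le> cdf M t1"
    proof -
      have "t1 \<le> t2" using t1 t2 cdf_nondecreasing[of t2 t1] by (cases "t1 \<le> t2") auto
      then obtain t where t: "cdf M t = s"
        using IVT'[of "cdf M" t1 s t2] t1 t2 cdf_continuous by auto
      then have "t \<le> t1" using eq by auto
      then show ?thesis using t cdf_nondecreasing by auto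
    qed
    then have "cdf M t1 = s" using t1 by simp
    then show ?thesis by (subst eq) (simp add: cdf_def)
  qed
qed

text \<open>The probability integral transform. Both measures have the distribution function that
  truncates \<open>s\<close> to the interval from 0 to the total mass.\<close>

lemma distr_cdf: "distr M borel (cdf M) = density lborel (indicator {0..measure M (space M)})"
proof (rule cdf_unique')
  have "finite_measure (distr M borel (cdf M))"
    using cdf_measurable M_is_borel
    by (intro finite_measure_distr) (simp cong: measurable_cong_sets)
  then show "finite_borel_measure (distr M borel (cdf M))"
    unfolding finite_borel_measure_def finite_borel_measure_axioms_def by simp
  show "finite_borel_measure (density lborel (indicator {0..measure M (space M)}))"
    unfolding finite_borel_measure_def finite_borel_measure_axioms_def
    by (auto intro!: finite_measureI simp: emeasure_density)
  show "cdf (distr M borel (cdf M)) = cdf (density lborel (indicator {0..measure M (space M)}))"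
  proof
    fix s
    have meas: "cdf M \<in> measurable M borel"
      using cdf_measurable M_is_borel by (simp cong: measurable_cong_sets)
    have "cdf (distr M borel (cdf M)) s = measure M {t. cdf M t \<le> s}"
      unfolding cdf_def[of "distr M borel (cdf M)"] using meas
      by (subst measure_distr) (auto simp: borel_UNIV intro!: arg_cong[where f = "measure M"])
    also have "\<dots> = max 0 (min s (measure M (space M)))"
    proof -
      consider "s < 0" | "0 \<le> s" "s \<le> measure M (space M)" | "measure M (space M) < s" by linarith
      then show ?thesis
      proof cases
        case 1
        then have "{t. cdf M t \<le> s} = {}" using cdf_nonneg by (auto simp: not_le intro: less_le_trans)
        then show ?thesis using 1 by simp
      next
        case 2
        then show ?thesis using measure_cdf_le[of s] by (simp add: max_def min_def)
      next
        case 3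
        then have "{t. cdf M t \<le> s} = space M"
          using cdf_bounded borel_UNIV by (force intro: order_trans less_imp_le)
        then show ?thesis using 3 by (simp add: measure_nonneg)
      qed
    qed
    also have "\<dots> = measure lborel ({0..measure M (space M)} \<inter> {..s})"
    proof -
      have eq: "{0..measure M (space M)} \<inter> {..s} = {0..min s (measure M (space M))}" by auto
      show ?thesis unfolding eq by (auto simp: measure_nonneg not_le)
    qed
    also have "\<dots> = cdf (density lborel (indicator {0..measure M (space M)})) s"
      unfolding cdf_def measure_def by (simp add: emeasure_density nn_integral_indicator indicator_inter_arith[symmetric])
    finally show "cdf (distr M borel (cdf M)) s = cdf (density lborel (indicator {0..measure M (space M)})) s" .
  qed
qed

lemma emeasure_cdf_vimage:
  assumes "B \<in> sets borel"
  shows "emeasure M (cdf M -` B) = emeasure lborel ({0..measure M (space M)} \<inter> B)"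
proof -
  have meas: "cdf M \<in> measurable M borel"
    using cdf_measurable M_is_borel by (simp cong: measurable_cong_sets)
  have "emeasure M (cdf M -` B) = emeasure (distr M borel (cdf M)) B"
    using assms meas by (simp add: emeasure_distr borel_UNIV)
  then show ?thesis
    using assms by (simp add: distr_cdf emeasure_density indicator_inter_arith[symmetric])
qed

text \<open>Off the countably many level sets of \<open>cdf M\<close> that contain a rational or are extremal, the
  distribution function is injective.\<close>

definition cdf_regular :: "real set" where
  "cdf_regular = - cdf M -` (cdf M ` \<rat> \<union> {0, measure M (space M)})"

text \<open>Countably many levels are removed, and \<open>cdf M\<close> carries the measure to
  Lebesgue measure, for which countable sets are null.\<close>

lemma cdf_critical_null:
  "cdf_regular \<in> sets borel" "emeasure M (- cdf_regular) = 0"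
proof -
  have count: "countable (cdf M ` \<rat> \<union> {0, measure M (space M)})" by (simp add: countable_rat)
  then have borel: "cdf M ` \<rat> \<union> {0, measure M (space M)} \<in> sets borel"
    by (rule sets.countable[rotated]) auto
  then have *: "cdf M -` (cdf M ` \<rat> \<union> {0, measure M (space M)}) \<in> sets borel"
    using cdf_measurable by (rule measurable_sets_borel[rotated])
  then show "cdf_regular \<in> sets borel" unfolding cdf_regular_def by auto
  have "emeasure lborel ({0..measure M (space M)} \<inter> (cdf M ` \<rat> \<union> {0, measure M (space M)})) = 0"
    by (rule emeasure_lborel_countable) (use count in auto)
  then show "emeasure M (- cdf_regular) = 0"
    unfolding cdf_regular_def double_complement emeasure_cdf_vimage[OF borel] .
qed

text \<open>If \<open>cdf M\<close> were constant between the two points, its value there would be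
  attained at a rational and would have been removed.\<close>

lemma cdf_less_of_regular:
  assumes "t < t'" "t \<in> cdf_regular \<or> t' \<in> cdf_regular"
  shows "cdf M t < cdf M t'"
proof (rule ccontr)
  assume "\<not> cdf M t < cdf M t'"
  then have eq: "cdf M t = cdf M t'" using assms(1) cdf_nondecreasing[of t t'] by simp
  obtain q where q: "q \<in> \<rat>" "t < q" "q < t'" using Rats_dense_in_real[OF assms(1)] by blast
  then have "cdf M t = cdf M q" "cdf M t' = cdf M q"
    using cdf_nondecreasing[of t q] cdf_nondecreasing[of q t'] eq by auto
  then show False using assms(2) q(1) unfolding cdf_regular_def by auto
qed

lemma inj_on_cdf: "inj_on (cdf M) cdf_regular"
  by (rule linorder_inj_onI') (metis cdf_less_of_regular less_irrefl)

lemma image_cdf_regular: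
  "cdf M ` cdf_regular = {0<..<measure M (space M)} - cdf M ` \<rat>"
proof (intro equalityI subsetI)
  fix s assume "s \<in> cdf M ` cdf_regular"
  then obtain t where "s = cdf M t" "t \<in> cdf_regular" by blast
  then show "s \<in> {0<..<measure M (space M)} - cdf M ` \<rat>"
    using cdf_nonneg[of t] cdf_bounded[of t] unfolding cdf_regular_def by auto
next
  fix s assume s: "s \<in> {0<..<measure M (space M)} - cdf M ` \<rat>"
  then obtain t where "cdf M t = s" using cdf_attains by auto
  then show "s \<in> cdf M ` cdf_regular" using s unfolding cdf_regular_def by auto
qed

text \<open>On the regular part \<open>cdf M\<close> is strictly increasing, so the image of a
  half-line is a half-line cut with the Borel image of the regular part. Injectivity then handles
  complements.\<close>

lemma image_cdf_borel:
  assumes "E \<in> sets borel"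
  shows "cdf M ` (E \<inter> cdf_regular) \<in> sets borel"
proof -
  have R: "cdf M ` cdf_regular \<in> sets borel"
  proof -
    have "cdf M ` \<rat> \<in> sets borel" by (rule sets.countable) (auto simp: countable_rat)
    then show ?thesis unfolding image_cdf_regular by auto
  qed
  have "E \<in> sigma_sets UNIV (range atMost)" using assms by (simp add: borel_eq_atMost)
  then show ?thesis
  proof induction
    case (Basic a)
    then obtain q where q: "a = {..q}" by blast
    have "cdf M ` ({..q} \<inter> cdf_regular) = cdf M ` cdf_regular \<inter> {..cdf M q}"
    proof (intro equalityI subsetI)
      fix s assume "s \<in> cdf M ` cdf_regular \<inter> {..cdf M q}"
      then obtain t where t: "s = cdf M t" "t \<in> cdf_regular" "cdf M t \<le> cdf M q" by auto
      then have "t \<le> q" using cdf_less_of_regular[of q t] by (cases "t \<le> q") auto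
      then show "s \<in> cdf M ` ({..q} \<inter> cdf_regular)" using t by auto
    qed (auto intro: cdf_nondecreasing)
    then show ?case using R q by simp
  next
    case (Compl a)
    have "cdf M ` ((UNIV - a) \<inter> cdf_regular) = cdf M ` cdf_regular - cdf M ` (a \<inter> cdf_regular)"
      using inj_on_cdf unfolding inj_on_def by auto
    then show ?case using Compl R by simp
  next
    case (Union a)
    have "cdf M ` (\<Union> (range a) \<inter> cdf_regular) = (\<Union>i. cdf M ` (a i \<inter> cdf_regular))" by auto
    then show ?case using Union by (simp add: sets.countable_UN)
  qed simp
qed

end

end

lemma (in prob_space) singleton_null:
  assumes "atomless M" "{x} \<in> sets M"
  shows "measure M {x} = 0"
proof (rule ccontr)
  assume "measure M {x} \<noteq> 0"
  then have "0 < emeasure M {x}" by (simp add: emeasure_eq_measure zero_less_measure_iff)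
  then obtain B where "B \<subseteq> {x}" "0 < emeasure M B" "emeasure M B < emeasure M {x}"
    using assms unfolding atomless_def by blast
  then show False by (cases "B = {}") (auto simp: subset_singleton_iff)
qed

section \<open>Uniform coordinates on subsets of the space\<close>

locale atomless_standard_space = prob_space M for M :: "'a measure" +
  assumes std: "standard_borel M" and atomless: "atomless M"
begin

text \<open>A distribution function transports \<open>M\<close> restricted to \<open>A\<close> to an initial segment of the
  line, up to null sets.\<close>

lemma uniform_coordinate:
  assumes A: "A \<in> sets M"
  obtains u A1 where "u \<in> borel_measurable M" "A1 \<in> sets M" "A1 \<subseteq> A" "measure M (A - A1) = 0"
    "inj_on u A1" "\<And>E. E \<in> sets M \<Longrightarrow> E \<subseteq> A1 \<Longrightarrow> u ` E \<in> sets borel"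
    "\<And>E. E \<in> sets M \<Longrightarrow> E \<subseteq> A1 \<Longrightarrow> emeasure lborel (u ` E) = emeasure M E"
    "\<And>s. 0 \<le> s \<Longrightarrow> s \<le> measure M A \<Longrightarrow> measure M {x\<in>A. u x \<le> s} = s"
    "\<And>x. 0 \<le> u x" "\<And>x. u x \<le> measure M A"
proof -
  obtain f :: "'a \<Rightarrow> real" where f: "inj_on f (space M)" "f \<in> borel_measurable M"
      "\<And>E. E \<in> sets M \<Longrightarrow> f ` E \<in> sets borel"
    using standard_borel_real_embedding[OF std not_empty] by blast
  have AX: "A \<subseteq> space M" using A sets.sets_into_space by blast
  \<comment> \<open>The part of \<open>M\<close> on \<open>A\<close>, transported to the line by the
    embedding. The coordinate is \<open>f\<close> followed by the distribution function of
    \<open>N\<close>.\<close>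
  define N where "N = distr (density M (indicator A)) borel f"
  have fd: "f \<in> measurable (density M (indicator A)) borel" using f(2) by simp
  have N: "emeasure N B = emeasure M {x\<in>A. f x \<in> B}" if B: "B \<in> sets borel" for B
  proof -
    have vi: "f -` B \<inter> space M \<in> sets M" using f(2) B by (rule measurable_sets)
    have "emeasure N B = emeasure (density M (indicator A)) (f -` B \<inter> space M)"
      unfolding N_def using fd B by (simp add: emeasure_distr)
    also have "\<dots> = emeasure M (A \<inter> (f -` B \<inter> space M))"
      using vi A by (simp add: emeasure_density indicator_inter_arith[symmetric])
    also have "A \<inter> (f -` B \<inter> space M) = {x\<in>A. f x \<in> B}" using AX by auto
    finally show ?thesis .
  qed
  interpret N: finite_borel_measure N
    unfolding finite_borel_measure_def finite_borel_measure_axioms_def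
  proof
    show "finite_measure N" using N[of UNIV] by (intro finite_measureI) (simp add: N_def)
    show "sets N = sets borel" by (simp add: N_def)
  qed
  have NM: "measure N B = measure M {x\<in>A. f x \<in> B}" if "B \<in> sets borel" for B
    using N[OF that] by (simp add: measure_def)
  have diffuse: "measure N {t} = 0" for t
  proof (cases "\<exists>x\<in>A. f x = t")
    case True
    then obtain x where x: "x \<in> A" "f x = t" by blast
    have "{y\<in>A. f y \<in> {t}} = {x}" using x f(1) AX unfolding inj_on_def by blast
    moreover have "{x} \<in> sets M"
    proof -
      have "f -` {t} \<inter> space M \<in> sets M" using f(2) by (rule measurable_sets) simp
      moreover have "f -` {t} \<inter> space M = {x}" using x f(1) AX unfolding inj_on_def by blast
      ultimately show ?thesis by simp
    qed
    ultimately show ?thesis using NM[of "{t}"] singleton_null[OF atomless] by simp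
  next
    case False
    then have empty: "{y\<in>A. f y \<in> {t}} = {}" by auto
    show ?thesis using NM[of "{t}"] unfolding empty by simp
  qed
  note N_facts = N.cdf_critical_null[OF diffuse] N.inj_on_cdf[OF diffuse] N.image_cdf_borel[OF diffuse]
    N.emeasure_cdf_vimage[OF diffuse] N.measure_cdf_le[OF diffuse]
  define R where "R = N.cdf_regular"
  have a: "measure N (space N) = measure M A"
    using NM[of UNIV] by (simp add: N_def)
  define u where "u x = cdf N (f x)" for x
  \<comment> \<open>Restricting to regular values of \<open>f\<close> makes \<open>u\<close>
    injective and costs only a null set.\<close>
  define A1 where "A1 = {x\<in>A. f x \<in> R}"
  have R: "R \<in> sets borel" using N_facts(1) by (simp add: R_def)
  have u: "u \<in> borel_measurable M"
    unfolding u_def using measurable_compose[OF f(2) N.cdf_measurable[OF diffuse]] .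
  have A1: "A1 \<in> sets M"
  proof -
    have "A1 = A \<inter> (f -` R \<inter> space M)" using AX by (auto simp: A1_def)
    then show ?thesis using A measurable_sets[OF f(2) R] by simp
  qed
  have sub: "A1 \<subseteq> A" by (auto simp: A1_def)
  have null: "measure M (A - A1) = 0"
  proof -
    have "A - A1 = {x\<in>A. f x \<in> - R}" by (auto simp: A1_def)
    then show ?thesis using N[of "- R"] R N_facts(2) by (simp add: R_def measure_def)
  qed
  have fR: "f ` E \<subseteq> R" if "E \<subseteq> A1" for E using that by (auto simp: A1_def)
  have uE: "u ` E = cdf N ` (f ` E \<inter> R)" if "E \<subseteq> A1" for E
    using fR[OF that] by (simp add: u_def image_image Int_absorb2)
  have inj: "inj_on u A1"
  proof (rule inj_onI)
    fix x y assume "x \<in> A1" "y \<in> A1" "u x = u y"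
    then have "f x = f y" using N_facts(3) unfolding u_def A1_def R_def inj_on_def by blast
    then show "x = y" using f(1) AX sub \<open>x \<in> A1\<close> \<open>y \<in> A1\<close> unfolding inj_on_def by blast
  qed
  have borel: "u ` E \<in> sets borel" if "E \<in> sets M" "E \<subseteq> A1" for E
    unfolding uE[OF that(2)] R_def by (rule N_facts(4)) (rule f(3)[OF that(1)])
  have range: "0 \<le> u x" "u x \<le> measure M A" for x
    using N.cdf_nonneg N.cdf_bounded unfolding u_def a by auto
  \<comment> \<open>The two measures are compared through \<open>N\<close>: pulling the image of
    \<open>E\<close> back to \<open>A\<close> returns \<open>E\<close> up to points outside
    \<open>A1\<close>.\<close>
  have lborel: "emeasure lborel (u ` E) = emeasure M E" if E: "E \<in> sets M" "E \<subseteq> A1" for E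
  proof -
    have uEb: "u ` E \<in> sets borel" using borel[OF E] .
    have vi: "cdf N -` (u ` E) \<in> sets borel"
      using N.cdf_measurable[OF diffuse] uEb by (rule measurable_sets_borel)
    have "emeasure lborel (u ` E) = emeasure lborel ({0..measure M A} \<inter> u ` E)"
      using range by (intro arg_cong[where f = "emeasure lborel"]) auto
    also have "\<dots> = emeasure N (cdf N -` (u ` E))" using N_facts(5)[OF uEb] by (simp add: a)
    also have "\<dots> = emeasure M {x\<in>A. u x \<in> u ` E}" using N[OF vi] by (simp add: u_def)
    also have "\<dots> = emeasure M E"
    proof (rule emeasure_eq_AE)
      have "A - A1 \<in> null_sets M"
        using A A1 null by (simp add: null_sets_def emeasure_eq_measure)
      then have "AE x in M. x \<notin> A - A1" by (rule AE_not_in)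
      then show "AE x in M. x \<in> {x\<in>A. u x \<in> u ` E} \<longleftrightarrow> x \<in> E"
      proof eventually_elim
        case (elim x)
        then show ?case using inj E(2) sub unfolding inj_on_def by blast
      qed
      show "{x\<in>A. u x \<in> u ` E} \<in> sets M"
      proof -
        have "{x\<in>A. u x \<in> u ` E} = A \<inter> (u -` (u ` E) \<inter> space M)" using AX by auto
        then show ?thesis using A measurable_sets[OF u uEb] by simp
      qed
    qed (rule E(1))
    finally show ?thesis .
  qed
  have "measure M {x\<in>A. u x \<le> s} = s" if "0 \<le> s" "s \<le> measure M A" for s
  proof -
    have "{t. cdf N t \<le> s} \<in> sets borel"
      using N.cdf_measurable[OF diffuse] by measurable
    then show ?thesis using N_facts(6)[of s] that NM[of "{t. cdf N t \<le> s}"] by (simp add: a u_def)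
  qed
  then show thesis using that[OF u A1 sub null inj borel lborel _ range] by blast
qed

text \<open>Sublevel sets of a uniform coordinate on \<open>A\<close> realize every intermediate
  value.\<close>

lemma subset_of_measure:
  assumes "A \<in> sets M" "0 \<le> b" "b \<le> measure M A"
  obtains B where "B \<in> sets M" "B \<subseteq> A" "measure M B = b"
proof -
  obtain u where u: "u \<in> borel_measurable M"
      "\<And>s. 0 \<le> s \<Longrightarrow> s \<le> measure M A \<Longrightarrow> measure M {x\<in>A. u x \<le> s} = s"
    using uniform_coordinate[OF assms(1)] by metis
  have "{x\<in>A. u x \<le> b} = A \<inter> {x\<in>space M. u x \<le> b}" using sets.sets_into_space[OF assms(1)] by auto
  then have "{x\<in>A. u x \<le> b} \<in> sets M" using assms(1) u(1) by simp
  then show thesis using that[of "{x\<in>A. u x \<le> b}"] u(2)[OF assms(2,3)] by auto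
qed

text \<open>The union is \<open>A\<close> exactly and not just up to a null set: the last remaining
  piece takes everything that is left. At least one index is required for this.\<close>

lemma split_set:
  fixes t :: "nat \<Rightarrow> real"
  assumes "A \<in> sets M" "\<And>i. i < n \<Longrightarrow> 0 \<le> t i" "sum t {..<n} = measure M A" "0 < n"
  shows "\<exists>E. (\<forall>i<n. E i \<in> sets M \<and> measure M (E i) = t i) \<and> disjoint_family_on E {..<n} \<and>
           (\<Union>i<n. E i) = A"
  using assms
proof (induction n arbitrary: A)
  case (Suc n)
  show ?case
  proof (cases "n = 0")
    case True
    then show ?thesis using Suc.prems by (intro exI[of _ "\<lambda>_. A"]) (auto simp: disjoint_family_on_def)
  next
    case False
    have pos: "0 \<le> sum t {..<n}" using Suc.prems(2) by (intro sum_nonneg) auto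
    obtain B where B: "B \<in> sets M" "B \<subseteq> A" "measure M B = t n"
      using subset_of_measure[of A "t n"] Suc.prems pos by auto
    have "measure M (A - B) = sum t {..<n}"
      using B Suc.prems by (simp add: finite_measure_Diff)
    then obtain E where E: "\<forall>i<n. E i \<in> sets M \<and> measure M (E i) = t i" "disjoint_family_on E {..<n}"
        "(\<Union>i<n. E i) = A - B"
      using Suc.IH[of "A - B"] Suc.prems B False by auto
    define E' where "E' = E(n := B)"
    have "(\<Union>i<Suc n. E' i) = B \<union> (\<Union>i<n. E i)"
      by (auto simp: E'_def less_Suc_eq)
    then have "(\<Union>i<Suc n. E' i) = A" using E(3) B by auto
    moreover have "disjoint_family_on E' {..<Suc n}"
    proof -
      have "E i \<inter> B = {}" "B \<inter> E i = {}" if "i < n" for i using E(3) that by auto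
      then show ?thesis using E(2)
        unfolding disjoint_family_on_def E'_def by (simp add: less_Suc_eq lessThan_Suc)
    qed
    moreover have "\<forall>i<Suc n. E' i \<in> sets M \<and> measure M (E' i) = t i"
      using E(1) B by (auto simp: E'_def less_Suc_eq)
    ultimately show ?thesis by blast
  qed
qed simp

end

section \<open>The group of automorphisms\<close>

lemma equiv_ae_rel: "equiv D (ae_rel M D)"
proof (rule equivI)
  show "ae_rel M D \<subseteq> D \<times> D" by (auto simp: ae_rel_def)
  show "refl_on D (ae_rel M D)" by (auto simp: refl_on_def ae_rel_def)
  show "sym (ae_rel M D)" by (auto simp: sym_def ae_rel_def)
  show "trans (ae_rel M D)"
  proof (rule transI)
    fix f g h assume "(f, g) \<in> ae_rel M D" "(g, h) \<in> ae_rel M D"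
    then have fgh: "f \<in> D" "h \<in> D" "AE x in M. f x = g x" "AE x in M. g x = h x"
      by (auto simp: ae_rel_def)
    from fgh(3,4) have "AE x in M. f x = h x" by eventually_elim simp
    then show "(f, h) \<in> ae_rel M D" using fgh by (simp add: ae_rel_def)
  qed
qed

lemma ae_rel_class_eq_iff:
  assumes "f \<in> D" "g \<in> D"
  shows "ae_rel M D `` {f} = ae_rel M D `` {g} \<longleftrightarrow> (AE x in M. f x = g x)"
  using eq_equiv_class_iff[OF equiv_ae_rel assms] assms by (simp add: ae_rel_def)

lemma rep_quotient:
  assumes "A \<in> D // ae_rel M D"
  shows "rep A \<in> D" "ae_rel M D `` {rep A} = A"
proof -
  obtain x where x: "A = ae_rel M D `` {x}" "x \<in> D" using assms by (rule quotientE)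
  then have "x \<in> A" by (simp add: ae_rel_def)
  then have "rep A \<in> A" unfolding rep_def by (rule someI[where P = "\<lambda>f. f \<in> A"])
  then have r: "(x, rep A) \<in> ae_rel M D" using x by simp
  then show "rep A \<in> D" by (simp add: ae_rel_def)
  show "ae_rel M D `` {rep A} = A"
    using equiv_class_eq[OF equiv_ae_rel r] x by simp
qed

lemma AE_rep_class:
  assumes "f \<in> D"
  shows "AE x in M. rep (ae_rel M D `` {f}) x = f x"
proof -
  have q: "ae_rel M D `` {f} \<in> D // ae_rel M D" using assms by (rule quotientI)
  show ?thesis
    using rep_quotient[OF q] assms ae_rel_class_eq_iff[of "rep (ae_rel M D `` {f})" D f M] by simp
qed

lemma mp_transformationsI:
  assumes T: "T \<in> measurable M M" and S: "S \<in> measurable M M"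
    and ST: "\<And>x. x \<in> space M \<Longrightarrow> S (T x) = x" and TS: "\<And>x. x \<in> space M \<Longrightarrow> T (S x) = x"
    and distr: "distr M M T = M"
  shows "T \<in> mp_transformations M" "\<And>x. x \<in> space M \<Longrightarrow> inv_into (space M) T x = S x"
proof -
  have bij: "bij_betw T (space M) (space M)"
    by (rule bij_betw_byWitness[of _ S]) (use assms in \<open>auto dest: measurable_space\<close>)
  show inv: "inv_into (space M) T x = S x" if "x \<in> space M" for x
    using bij that TS[OF that] measurable_space[OF S that]
    by (metis bij_betw_inv_into_left)
  then have "inv_into (space M) T \<in> measurable M M"
    using S by (subst measurable_cong) auto
  then show "T \<in> mp_transformations M"
    using bij T distr by (simp add: mp_transformations_def)
qed

lemma mp_transformationsD:
  assumes "T \<in> mp_transformations M"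
  shows "T \<in> measurable M M" "inv_into (space M) T \<in> measurable M M" "distr M M T = M"
    "bij_betw T (space M) (space M)"
    "\<And>x. x \<in> space M \<Longrightarrow> inv_into (space M) T (T x) = x"
    "\<And>x. x \<in> space M \<Longrightarrow> T (inv_into (space M) T x) = x"
  using assms bij_betw_inv_into_left bij_betw_inv_into_right
  unfolding mp_transformations_def by fastforce+

lemma mp_transformations_id: "(\<lambda>x. x) \<in> mp_transformations M"
  by (rule mp_transformationsI[of _ _ "\<lambda>x. x"]) (auto simp: distr_id2)

lemma mp_transformations_comp:
  assumes "S \<in> mp_transformations M" "T \<in> mp_transformations M"
  shows "S \<circ> T \<in> mp_transformations M"
    "\<And>x. x \<in> space M \<Longrightarrow>
       inv_into (space M) (S \<circ> T) x = inv_into (space M) T (inv_into (space M) S x)"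
proof -
  note S = mp_transformationsD[OF assms(1)] and T = mp_transformationsD[OF assms(2)]
  have m: "S \<circ> T \<in> measurable M M" "inv_into (space M) T \<circ> inv_into (space M) S \<in> measurable M M"
    using S T by (auto intro: measurable_comp)
  have "distr M M (S \<circ> T) = M"
    using distr_distr[OF S(1) T(1)] S(3) T(3) by simp
  note * = mp_transformationsI[OF m _ _ this]
  show "S \<circ> T \<in> mp_transformations M"
    by (rule *(1)) (use S T measurable_space[OF T(1)] measurable_space[OF S(2)] in auto)
  show "inv_into (space M) (S \<circ> T) x = inv_into (space M) T (inv_into (space M) S x)"
    if "x \<in> space M" for x
    by (subst *(2)[OF _ _ that]) (use S T measurable_space[OF T(1)] measurable_space[OF S(2)] in auto)
qed

lemma mp_transformations_inv:
  assumes "T \<in> mp_transformations M"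
  shows "inv_into (space M) T \<in> mp_transformations M"
    "\<And>x. x \<in> space M \<Longrightarrow> inv_into (space M) (inv_into (space M) T) x = T x"
proof -
  note T = mp_transformationsD[OF assms]
  have "distr M M (inv_into (space M) T) = distr (distr M M T) M (inv_into (space M) T)"
    using T(3) by simp
  also have "\<dots> = distr M M (inv_into (space M) T \<circ> T)" by (rule distr_distr) (use T in auto)
  also have "\<dots> = distr M M (\<lambda>x. x)" by (rule distr_cong) (use T in auto)
  finally have "distr M M (inv_into (space M) T) = M" by (simp add: distr_id2)
  note * = mp_transformationsI[OF T(2,1) T(6,5) this]
  show "inv_into (space M) T \<in> mp_transformations M"
    "\<And>x. x \<in> space M \<Longrightarrow> inv_into (space M) (inv_into (space M) T) x = T x"
    using * by auto
qed

lemma AE_mp_transformations: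
  assumes "T \<in> mp_transformations M" "AE x in M. P x"
  shows "AE x in M. P (T x)"
proof (rule AE_distrD[of T M M P])
  show "T \<in> measurable M M" using assms(1) by (rule mp_transformationsD)
  show "AE x in distr M M T. P x" unfolding mp_transformationsD(3)[OF assms(1)] by (rule assms(2))
qed

lemma carrier_Aut: "carrier (Aut M) = mp_transformations M // ae_rel M (mp_transformations M)"
  by (simp add: Aut_def)

lemma aut_class_in_carrier: "T \<in> mp_transformations M \<Longrightarrow> aut_class M T \<in> carrier (Aut M)"
  unfolding carrier_Aut aut_class_def by (rule quotientI)

lemma rep_Aut:
  assumes "g \<in> carrier (Aut M)"
  shows "rep g \<in> mp_transformations M" "aut_class M (rep g) = g"
  using rep_quotient[OF assms[unfolded carrier_Aut]] unfolding aut_class_def by auto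

lemma AE_rep_aut_class: "T \<in> mp_transformations M \<Longrightarrow> AE x in M. rep (aut_class M T) x = T x"
  unfolding aut_class_def by (rule AE_rep_class)

lemma aut_class_eqI:
  "S \<in> mp_transformations M \<Longrightarrow> T \<in> mp_transformations M \<Longrightarrow> AE x in M. S x = T x \<Longrightarrow>
     aut_class M S = aut_class M T"
  unfolding aut_class_def by (simp add: ae_rel_class_eq_iff)

lemma AE_Aut_mult:
  "AE x in M. rep (g \<otimes>\<^bsub>Aut M\<^esub> h) x = rep g (rep h x)"
  if "g \<in> carrier (Aut M)" "h \<in> carrier (Aut M)"
  using AE_rep_aut_class[OF mp_transformations_comp(1)[OF rep_Aut(1)[OF that(1)] rep_Aut(1)[OF that(2)]]]
  by (simp add: Aut_def)

lemma aut_class_mult: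
  assumes "S \<in> mp_transformations M" "T \<in> mp_transformations M"
  shows "aut_class M S \<otimes>\<^bsub>Aut M\<^esub> aut_class M T = aut_class M (S \<circ> T)"
proof -
  let ?S = "rep (aut_class M S)" and ?T = "rep (aut_class M T)"
  have mp: "?S \<in> mp_transformations M" "?T \<in> mp_transformations M"
    using assms aut_class_in_carrier rep_Aut(1) by blast+
  have "AE x in M. ?S (?T x) = S (?T x)"
    by (rule AE_mp_transformations[OF mp(2) AE_rep_aut_class[OF assms(1)]])
  with AE_rep_aut_class[OF assms(2)] have "AE x in M. (?S \<circ> ?T) x = (S \<circ> T) x"
    by eventually_elim simp
  then have "aut_class M (?S \<circ> ?T) = aut_class M (S \<circ> T)"
    by (intro aut_class_eqI mp_transformations_comp assms mp)
  then show ?thesis by (simp add: Aut_def)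
qed

lemma one_Aut: "\<one>\<^bsub>Aut M\<^esub> = aut_class M (\<lambda>x. x)"
  by (simp add: Aut_def)

lemma Aut_induct:
  assumes "g \<in> carrier (Aut M)"
  obtains T where "T \<in> mp_transformations M" "g = aut_class M T"
  using rep_Aut[OF assms] by metis

lemma aut_class_inv_mult:
  assumes T: "T \<in> mp_transformations M"
  shows "aut_class M (inv_into (space M) T) \<otimes>\<^bsub>Aut M\<^esub> aut_class M T = \<one>\<^bsub>Aut M\<^esub>"
proof -
  have "aut_class M (inv_into (space M) T \<circ> T) = aut_class M (\<lambda>x. x)"
    using T mp_transformations_id mp_transformationsD(5)[OF T]
    by (intro aut_class_eqI mp_transformations_comp mp_transformations_inv) auto
  then show ?thesis using T by (simp add: aut_class_mult mp_transformations_inv one_Aut)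
qed

lemma group_Aut: "group (Aut M)"
proof (rule groupI)
  show "g \<otimes>\<^bsub>Aut M\<^esub> h \<in> carrier (Aut M)" if "g \<in> carrier (Aut M)" "h \<in> carrier (Aut M)" for g h
    using aut_class_in_carrier[OF mp_transformations_comp(1)[OF rep_Aut(1)[OF that(1)] rep_Aut(1)[OF that(2)]]]
    by (simp add: Aut_def)
  show "\<one>\<^bsub>Aut M\<^esub> \<in> carrier (Aut M)"
    by (simp add: one_Aut aut_class_in_carrier mp_transformations_id)
  show "g \<otimes>\<^bsub>Aut M\<^esub> h \<otimes>\<^bsub>Aut M\<^esub> k = g \<otimes>\<^bsub>Aut M\<^esub> (h \<otimes>\<^bsub>Aut M\<^esub> k)"
    if ghk: "g \<in> carrier (Aut M)" "h \<in> carrier (Aut M)" "k \<in> carrier (Aut M)" for g h k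
  proof -
    obtain R S T where "R \<in> mp_transformations M" "g = aut_class M R"
      "S \<in> mp_transformations M" "h = aut_class M S" "T \<in> mp_transformations M" "k = aut_class M T"
      using ghk Aut_induct by metis
    then show ?thesis by (simp add: aut_class_mult mp_transformations_comp comp_assoc)
  qed
  show "\<one>\<^bsub>Aut M\<^esub> \<otimes>\<^bsub>Aut M\<^esub> g = g" if g: "g \<in> carrier (Aut M)" for g
  proof -
    obtain T where "T \<in> mp_transformations M" "g = aut_class M T" using g Aut_induct by metis
    then show ?thesis by (simp add: one_Aut aut_class_mult mp_transformations_id comp_def)
  qed
  show "\<exists>h\<in>carrier (Aut M). h \<otimes>\<^bsub>Aut M\<^esub> g = \<one>\<^bsub>Aut M\<^esub>" if g: "g \<in> carrier (Aut M)" for g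
  proof -
    obtain T where T: "T \<in> mp_transformations M" "g = aut_class M T" using g Aut_induct by metis
    then show ?thesis
      using aut_class_inv_mult aut_class_in_carrier mp_transformations_inv(1) by metis
  qed
qed

lemma inv_Aut:
  assumes T: "T \<in> mp_transformations M"
  shows "inv\<^bsub>Aut M\<^esub> (aut_class M T) = aut_class M (inv_into (space M) T)"
  using group.inv_equality[OF group_Aut aut_class_inv_mult[OF T]] T
  by (simp add: aut_class_in_carrier mp_transformations_inv)

section \<open>The action on measurable sets, up to null sets\<close>

definition act :: "('a \<Rightarrow> 'a) set \<Rightarrow> 'a set \<Rightarrow> 'a set" where
  "act g A = rep g ` A"

definition set_dist :: "'a measure \<Rightarrow> 'a set \<Rightarrow> 'a set \<Rightarrow> real" where
  "set_dist M A B = measure M ((A - B) \<union> (B - A))"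

context prob_space
begin

abbreviation "dd \<equiv> set_dist M"

lemma dd_commute: "dd A B = dd B A"
  by (simp add: set_dist_def Un_commute)

lemma dd_self [simp]: "dd A A = 0"
  by (simp add: set_dist_def)

lemma dd_nonneg [simp]: "0 \<le> dd A B"
  by (simp add: set_dist_def)

lemma dd_triangle:
  assumes "A \<in> sets M" "B \<in> sets M" "C \<in> sets M"
  shows "dd A C \<le> dd A B + dd B C"
proof -
  have "dd A C \<le> measure M (((A - B) \<union> (B - A)) \<union> ((B - C) \<union> (C - B)))"
    unfolding set_dist_def by (rule finite_measure_mono) (use assms in auto)
  also have "\<dots> \<le> dd A B + dd B C"
    unfolding set_dist_def by (rule measure_Un_le) (use assms in auto)
  finally show ?thesis .
qed

lemma dd_cong:
  assumes "A \<in> sets M" "A' \<in> sets M" "B \<in> sets M" "B' \<in> sets M" "dd A A' = 0" "dd B B' = 0"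
  shows "dd A B = dd A' B'"
proof -
  have "dd A B \<le> dd A A' + (dd A' B' + dd B' B)" "dd A' B' \<le> dd A' A + (dd A B + dd B B')"
    using dd_triangle assms by (meson add_left_mono order_trans)+
  then show ?thesis using assms(5,6) by (simp add: dd_commute)
qed

lemma dd_trans_0:
  assumes "dd A B = 0" "dd B C = 0" "A \<in> sets M" "B \<in> sets M" "C \<in> sets M"
  shows "dd A C = 0"
  using dd_triangle[OF assms(3-5)] assms(1,2) by (intro antisym) auto

lemma dd_measure_le:
  assumes "A \<in> sets M" "B \<in> sets M"
  shows "\<bar>measure M A - measure M B\<bar> \<le> dd A B"
proof -
  have "measure M A \<le> measure M (B \<union> ((A - B) \<union> (B - A)))"
    by (rule finite_measure_mono) (use assms in auto)
  also have "\<dots> \<le> measure M B + dd A B"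
    unfolding set_dist_def by (rule measure_Un_le) (use assms in auto)
  finally have 1: "measure M A \<le> measure M B + dd A B" .
  have "measure M B \<le> measure M (A \<union> ((A - B) \<union> (B - A)))"
    by (rule finite_measure_mono) (use assms in auto)
  also have "\<dots> \<le> measure M A + dd A B"
    unfolding set_dist_def by (rule measure_Un_le) (use assms in auto)
  finally show ?thesis using 1 by simp
qed

lemma dd_subset:
  assumes "(A - B) \<union> (B - A) \<subseteq> (C - D) \<union> (D - C)" "C \<in> sets M" "D \<in> sets M"
  shows "dd A B \<le> dd C D"
  unfolding set_dist_def by (rule finite_measure_mono) (use assms in auto)

lemma dd_Int: "A \<in> sets M \<Longrightarrow> B \<in> sets M \<Longrightarrow> dd (A \<inter> C) (B \<inter> C) \<le> dd A B"
  by (rule dd_subset) auto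

lemma dd_Diff_right: "A \<in> sets M \<Longrightarrow> B \<in> sets M \<Longrightarrow> dd (C - A) (C - B) \<le> dd A B"
  by (rule dd_subset) auto

lemma dd_UN:
  assumes "finite I" "\<And>i. i \<in> I \<Longrightarrow> A i \<in> sets M" "\<And>i. i \<in> I \<Longrightarrow> B i \<in> sets M"
  shows "dd (\<Union>i\<in>I. A i) (\<Union>i\<in>I. B i) \<le> (\<Sum>i\<in>I. dd (A i) (B i))"
proof -
  have "dd (\<Union>i\<in>I. A i) (\<Union>i\<in>I. B i) \<le> measure M (\<Union>i\<in>I. (A i - B i) \<union> (B i - A i))"
    unfolding set_dist_def by (rule finite_measure_mono) (use assms in auto)
  also have "\<dots> \<le> (\<Sum>i\<in>I. dd (A i) (B i))"
    unfolding set_dist_def by (rule measure_UNION_le) (use assms in auto)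
  finally show ?thesis .
qed

lemma measure_Int_le_dd:
  assumes "A \<in> sets M" "B \<in> sets M" "C \<in> sets M"
  shows "\<bar>measure M (A \<inter> C) - measure M (B \<inter> C)\<bar> \<le> dd A B"
  using dd_measure_le[of "A \<inter> C" "B \<inter> C"] dd_Int[of A B C] assms by simp

lemma measure_Int_cong:
  assumes "A \<in> sets M" "B \<in> sets M" "C \<in> sets M" "dd A B = 0"
  shows "measure M (A \<inter> C) = measure M (B \<inter> C)"
  using measure_Int_le_dd[of A B C] assms by simp

lemma dd_eq_0_AE:
  assumes "A \<in> sets M" "B \<in> sets M" "AE x in M. x \<in> A \<longleftrightarrow> x \<in> B"
  shows "dd A B = 0"
proof -
  have "measure M ((A - B) \<union> (B - A)) = measure M {}"
    by (rule measure_eq_AE) (use assms in auto)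
  then show ?thesis by (simp add: set_dist_def)
qed

context
  fixes g assumes g: "g \<in> carrier (Aut M)"
begin

text \<open>An image under a bijection is a preimage under its inverse. This yields measurability
  and the compatibility with intersections and differences.\<close>

lemma act_altdef: "A \<in> sets M \<Longrightarrow> act g A = inv_into (space M) (rep g) -` A \<inter> space M"
proof (intro equalityI subsetI)
  note T = mp_transformationsD[OF rep_Aut(1)[OF g]]
  assume A: "A \<in> sets M"
  { fix x assume "x \<in> act g A"
    then obtain y where y: "x = rep g y" "y \<in> A" "y \<in> space M"
      using sets.sets_into_space[OF A] by (auto simp: act_def)
    then show "x \<in> inv_into (space M) (rep g) -` A \<inter> space M"
      using T(5)[of y] measurable_space[OF T(1)] by auto }
  { fix x assume "x \<in> inv_into (space M) (rep g) -` A \<inter> space M"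
    then show "x \<in> act g A" using T(6)[of x] by (auto simp: act_def intro: rev_image_eqI) }
qed

lemma act_sets [simp]: "A \<in> sets M \<Longrightarrow> act g A \<in> sets M"
  using act_altdef measurable_sets[OF mp_transformationsD(2)[OF rep_Aut(1)[OF g]]] by simp

lemma act_measure [simp]:
  assumes "A \<in> sets M" shows "measure M (act g A) = measure M A"
proof -
  note S = mp_transformationsD[OF mp_transformations_inv(1)[OF rep_Aut(1)[OF g]]]
  have "measure M A = measure (distr M M (inv_into (space M) (rep g))) A" by (simp add: S(3))
  also have "\<dots> = measure M (act g A)"
    using assms S(1) by (simp add: measure_distr act_altdef)
  finally show ?thesis by simp
qed

lemma act_space [simp]: "act g (space M) = space M"
  using mp_transformationsD(4)[OF rep_Aut(1)[OF g]] by (simp add: act_def bij_betw_def)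

lemma act_Int: "A \<in> sets M \<Longrightarrow> B \<in> sets M \<Longrightarrow> act g (A \<inter> B) = act g A \<inter> act g B"
  by (auto simp: act_altdef)

lemma act_Diff: "A \<in> sets M \<Longrightarrow> B \<in> sets M \<Longrightarrow> act g (A - B) = act g A - act g B"
  by (auto simp: act_altdef)

lemma act_Un: "act g (A \<union> B) = act g A \<union> act g B"
  by (auto simp: act_def)

lemma act_UN: "act g (\<Union>i\<in>I. A i) = (\<Union>i\<in>I. act g (A i))"
  by (auto simp: act_def)

lemma act_empty [simp]: "act g {} = {}"
  by (simp add: act_def)

lemma dd_act [simp]:
  assumes "A \<in> sets M" "B \<in> sets M" shows "dd (act g A) (act g B) = dd A B"
proof -
  have "(act g A - act g B) \<union> (act g B - act g A) = act g ((A - B) \<union> (B - A))"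
    using assms by (simp add: act_Un act_Diff)
  then show ?thesis using assms by (simp add: set_dist_def)
qed

lemma act_disjoint_family_on:
  assumes "disjoint_family_on A I" "\<And>i. i \<in> I \<Longrightarrow> A i \<in> sets M"
  shows "disjoint_family_on (\<lambda>i. act g (A i)) I"
  using assms unfolding disjoint_family_on_def by (metis act_Int act_empty)

end

text \<open>The set where \<open>T\<close> and the chosen representative differ is null, and so is
  its image, because the representative preserves the measure.\<close>

lemma dd_act_AE:
  assumes "g \<in> carrier (Aut M)" "T \<in> mp_transformations M" "AE x in M. rep g x = T x" "A \<in> sets M"
    "T ` A \<in> sets M"
  shows "dd (act g A) (T ` A) = 0"
proof -
  note S = mp_transformationsD[OF rep_Aut(1)[OF assms(1)]]
  note T = mp_transformationsD[OF assms(2)]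
  have "AE x in M. rep g (inv_into (space M) (rep g) x) = T (inv_into (space M) (rep g) x)"
    by (rule AE_mp_transformations[OF mp_transformations_inv(1)[OF rep_Aut(1)[OF assms(1)]] assms(3)])
  then have "AE x in M. x = T (inv_into (space M) (rep g) x)"
    using AE_space by eventually_elim (simp add: S(6))
  then have "AE x in M. x \<in> act g A \<longleftrightarrow> x \<in> T ` A"
    using AE_space
  proof eventually_elim
    case (elim x)
    show ?case
    proof
      assume "x \<in> act g A"
      then have "inv_into (space M) (rep g) x \<in> A" using act_altdef assms by simp
      then show "x \<in> T ` A" using elim by (metis image_eqI)
    next
      assume "x \<in> T ` A"
      then obtain y where y: "y \<in> A" "x = T y" by blast
      then have "y = inv_into (space M) (rep g) x"
        using elim T(4) sets.sets_into_space[OF assms(4)] measurable_space[OF S(2)]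
        unfolding bij_betw_def inj_on_def by (metis subsetD)
      then show "x \<in> act g A" using y elim act_altdef assms by simp
    qed
  qed
  then show ?thesis by (intro dd_eq_0_AE) (use assms in auto)
qed

text \<open>The chosen representative of a product agrees with the composite of the representatives
  only almost everywhere. So \<open>act\<close> is an action modulo null sets, and identities
  between images of sets are stated as a vanishing distance.\<close>

lemma dd_act_mult:
  assumes "g \<in> carrier (Aut M)" "h \<in> carrier (Aut M)" "A \<in> sets M"
  shows "dd (act (g \<otimes>\<^bsub>Aut M\<^esub> h) A) (act g (act h A)) = 0"
proof -
  have "dd (act (g \<otimes>\<^bsub>Aut M\<^esub> h) A) ((rep g \<circ> rep h) ` A) = 0"
  proof (rule dd_act_AE)
    show "g \<otimes>\<^bsub>Aut M\<^esub> h \<in> carrier (Aut M)"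
      using monoid.m_closed[OF group.is_monoid[OF group_Aut] assms(1,2)] .
    show "rep g \<circ> rep h \<in> mp_transformations M"
      by (rule mp_transformations_comp(1)[OF rep_Aut(1)[OF assms(1)] rep_Aut(1)[OF assms(2)]])
    show "AE x in M. rep (g \<otimes>\<^bsub>Aut M\<^esub> h) x = (rep g \<circ> rep h) x"
      using AE_Aut_mult[OF assms(1,2)] by simp
    show "(rep g \<circ> rep h) ` A \<in> sets M"
      using act_sets[OF assms(1) act_sets[OF assms(2,3)]] by (simp add: act_def image_comp)
  qed (rule assms(3))
  then show ?thesis by (simp add: act_def image_comp)
qed

lemma dd_act_one:
  assumes "A \<in> sets M"
  shows "dd (act \<one>\<^bsub>Aut M\<^esub> A) A = 0"
proof -
  have "dd (act \<one>\<^bsub>Aut M\<^esub> A) ((\<lambda>x. x) ` A) = 0"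
    unfolding one_Aut
    by (rule dd_act_AE[OF aut_class_in_carrier _ AE_rep_aut_class]) (use assms mp_transformations_id in auto)
  then show ?thesis by simp
qed

lemma dd_act_inv:
  assumes g: "g \<in> carrier (Aut M)" and A: "A \<in> sets M"
  shows "dd (act (inv\<^bsub>Aut M\<^esub> g) (act g A)) A = 0" "dd (act g (act (inv\<^bsub>Aut M\<^esub> g) A)) A = 0"
proof -
  interpret group "Aut M" by (rule group_Aut)
  have ig: "inv\<^bsub>Aut M\<^esub> g \<in> carrier (Aut M)" using g by simp
  have "dd (act (inv\<^bsub>Aut M\<^esub> g \<otimes>\<^bsub>Aut M\<^esub> g) A) (act (inv\<^bsub>Aut M\<^esub> g) (act g A)) = 0"
    by (rule dd_act_mult[OF ig g A])
  moreover have "dd (act (inv\<^bsub>Aut M\<^esub> g \<otimes>\<^bsub>Aut M\<^esub> g) A) A = 0" using dd_act_one[OF A] g by simp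
  ultimately show "dd (act (inv\<^bsub>Aut M\<^esub> g) (act g A)) A = 0"
    using dd_trans_0[of "act (inv\<^bsub>Aut M\<^esub> g) (act g A)" "act (inv\<^bsub>Aut M\<^esub> g \<otimes>\<^bsub>Aut M\<^esub> g) A" A]
      g ig A by (simp add: dd_commute del: l_inv)
  have "dd (act (g \<otimes>\<^bsub>Aut M\<^esub> inv\<^bsub>Aut M\<^esub> g) A) (act g (act (inv\<^bsub>Aut M\<^esub> g) A)) = 0"
    by (rule dd_act_mult[OF g ig A])
  moreover have "dd (act (g \<otimes>\<^bsub>Aut M\<^esub> inv\<^bsub>Aut M\<^esub> g) A) A = 0" using dd_act_one[OF A] g by simp
  ultimately show "dd (act g (act (inv\<^bsub>Aut M\<^esub> g) A)) A = 0"
    using dd_trans_0[of "act g (act (inv\<^bsub>Aut M\<^esub> g) A)" "act (g \<otimes>\<^bsub>Aut M\<^esub> inv\<^bsub>Aut M\<^esub> g) A" A]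
      g ig A by (simp add: dd_commute del: r_inv)
qed

lemma dd_act_left:
  assumes g: "g \<in> carrier (Aut M)" and A: "A \<in> sets M" "B \<in> sets M"
  shows "dd (act g A) B = dd A (act (inv\<^bsub>Aut M\<^esub> g) B)"
proof -
  interpret group "Aut M" by (rule group_Aut)
  have ig: "inv\<^bsub>Aut M\<^esub> g \<in> carrier (Aut M)" using g by simp
  have "dd (act g A) B = dd (act g A) (act g (act (inv\<^bsub>Aut M\<^esub> g) B))"
    using dd_cong[of "act g A" "act g A" B "act g (act (inv\<^bsub>Aut M\<^esub> g) B)"] dd_act_inv(2)[OF g A(2)]
      dd_commute[of B "act g (act (inv\<^bsub>Aut M\<^esub> g) B)"]
      act_sets[OF g A(1)] act_sets[OF g act_sets[OF ig A(2)]] A by simp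
  also have "\<dots> = dd A (act (inv\<^bsub>Aut M\<^esub> g) B)" by (rule dd_act[OF g A(1) act_sets[OF ig A(2)]])
  finally show ?thesis .
qed

lemma measure_act_Int:
  assumes g: "g \<in> carrier (Aut M)" and A: "A \<in> sets M" "B \<in> sets M"
  shows "measure M (act g A \<inter> B) = measure M (A \<inter> act (inv\<^bsub>Aut M\<^esub> g) B)"
proof -
  interpret group "Aut M" by (rule group_Aut)
  have ig: "inv\<^bsub>Aut M\<^esub> g \<in> carrier (Aut M)" using g by simp
  have "measure M (B \<inter> act g A) = measure M (act g (act (inv\<^bsub>Aut M\<^esub> g) B) \<inter> act g A)"
    using measure_Int_cong[of B "act g (act (inv\<^bsub>Aut M\<^esub> g) B)" "act g A"] dd_act_inv(2)[OF g A(2)]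
      dd_commute[of B "act g (act (inv\<^bsub>Aut M\<^esub> g) B)"]
      act_sets[OF g A(1)] act_sets[OF g act_sets[OF ig A(2)]] A by simp
  also have "\<dots> = measure M (act g (act (inv\<^bsub>Aut M\<^esub> g) B \<inter> A))"
    by (simp only: act_Int[OF g act_sets[OF ig A(2)] A(1)])
  also have "\<dots> = measure M (act (inv\<^bsub>Aut M\<^esub> g) B \<inter> A)" 
    by (rule act_measure[OF g]) (use act_sets[OF ig A(2)] A in auto)
  finally show ?thesis by (simp add: Int_commute)
qed

end

section \<open>Moving sets\<close>

definition finite_partition :: "'a measure \<Rightarrow> nat \<Rightarrow> (nat \<Rightarrow> 'a set) \<Rightarrow> bool" where
  "finite_partition M n P \<longleftrightarrow> (\<forall>i<n. P i \<in> sets M) \<and> disjoint_family_on P {..<n} \<and>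
     (\<Union>i<n. P i) = space M"

definition equipartition :: "'a measure \<Rightarrow> nat \<Rightarrow> (nat \<Rightarrow> 'a set) \<Rightarrow> bool" where
  "equipartition M n P \<longleftrightarrow> finite_partition M n P \<and> (\<forall>i<n. measure M (P i) = 1 / n)"

context atomless_standard_space
begin

text \<open>The set is the pullback of \<open>E\<close> under the partial map that matches equal
  coordinates. Its \<open>u\<close>-image is the \<open>v\<close>-image of
  \<open>D2 \<inter> E\<close>, and both coordinates turn the measure into Lebesgue measure. Two
  applications with exchanged roles show that the swap of two sets preserves the measure.\<close>

lemma transfer_set:
  fixes u v :: "'a \<Rightarrow> real"
  assumes u: "u \<in> borel_measurable M" "C1 \<in> sets M" "inj_on u C1"
      "\<And>E. E \<in> sets M \<Longrightarrow> E \<subseteq> C1 \<Longrightarrow> emeasure lborel (u ` E) = emeasure M E"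
    and v: "D1 \<in> sets M" "inj_on v D1"
      "\<And>E. E \<in> sets M \<Longrightarrow> E \<subseteq> D1 \<Longrightarrow> v ` E \<in> sets borel"
      "\<And>E. E \<in> sets M \<Longrightarrow> E \<subseteq> D1 \<Longrightarrow> emeasure lborel (v ` E) = emeasure M E"
    and W: "W \<in> sets borel" "W \<subseteq> u ` C1" "W \<subseteq> v ` D1"
    and D2: "D2 = {y\<in>D1. v y \<in> W}" "D2 \<in> sets M"
    and E: "E \<in> sets M"
  shows "{x\<in>C1. u x \<in> W \<and> inv_into D1 v (u x) \<in> E} \<in> sets M"
    "emeasure M {x\<in>C1. u x \<in> W \<and> inv_into D1 v (u x) \<in> E} = emeasure M (D2 \<inter> E)"
proof -
  let ?F = "{x\<in>C1. u x \<in> W \<and> inv_into D1 v (u x) \<in> E}"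
  have inv: "inv_into D1 v (v y) = y" if "y \<in> D1" for y using v(2) that by simp
  have uF: "u ` ?F = v ` (D2 \<inter> E)"
  proof (intro equalityI subsetI)
    fix s assume "s \<in> u ` ?F"
    then obtain x where x: "x \<in> C1" "s = u x" "u x \<in> W" "inv_into D1 v (u x) \<in> E" by blast
    then obtain y where y: "y \<in> D1" "u x = v y" using W(3) by blast
    then show "s \<in> v ` (D2 \<inter> E)" using x inv[OF y(1)] unfolding D2 by auto
  next
    fix s assume "s \<in> v ` (D2 \<inter> E)"
    then obtain y where y: "y \<in> D1" "s = v y" "v y \<in> W" "y \<in> E" unfolding D2 by blast
    then obtain x where x: "x \<in> C1" "v y = u x" using W(2) by blast
    then show "s \<in> u ` ?F" using y inv[OF y(1)] by (intro image_eqI[of _ _ x]) auto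
  qed
  have DE: "D2 \<inter> E \<in> sets M" "D2 \<inter> E \<subseteq> D1" using D2 E by auto
  have "?F = C1 \<inter> (u -` (v ` (D2 \<inter> E)) \<inter> space M)"
  proof (intro equalityI subsetI)
    fix x assume x: "x \<in> ?F"
    then have "u x \<in> v ` (D2 \<inter> E)" unfolding uF[symmetric] by (rule imageI)
    then show "x \<in> C1 \<inter> (u -` (v ` (D2 \<inter> E)) \<inter> space M)"
      using x sets.sets_into_space[OF u(2)] by blast
  next
    fix x assume x: "x \<in> C1 \<inter> (u -` (v ` (D2 \<inter> E)) \<inter> space M)"
    then have "u x \<in> u ` ?F" unfolding uF by blast
    then obtain y where y: "y \<in> ?F" "u x = u y" by blast
    then have "x = y" using x by (intro inj_onD[OF u(3)]) auto
    then show "x \<in> ?F" using y by simp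
  qed
  then show F: "?F \<in> sets M"
    using u(2) measurable_sets[OF u(1) v(3)[OF DE]] by simp
  have "emeasure M ?F = emeasure lborel (u ` ?F)" by (rule u(4)[OF F, symmetric]) auto
  also have "\<dots> = emeasure lborel (v ` (D2 \<inter> E))" by (simp only: uF)
  also have "\<dots> = emeasure M (D2 \<inter> E)" by (rule v(4)[OF DE])
  finally show "emeasure M ?F = emeasure M (D2 \<inter> E)" .
qed

text \<open>Sets of equal measure have uniform coordinates with the same range up to null sets.
  Points with equal coordinates are exchanged and all other points are fixed. The result is an
  involution, so one measurability argument serves the map and its inverse.\<close>

lemma swap_exists:
  assumes C: "C \<in> sets M" and D: "D \<in> sets M" and disj: "C \<inter> D = {}"
    and eq: "measure M C = measure M D"
  shows "\<exists>s\<in>carrier (Aut M). dd (act s C) D = 0 \<and>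
           (\<forall>E\<in>sets M. E \<inter> (C \<union> D) = {} \<longrightarrow> dd (act s E) E = 0)"
proof -
  obtain u C1 where u: "u \<in> borel_measurable M" "C1 \<in> sets M" "C1 \<subseteq> C" "measure M (C - C1) = 0"
    "inj_on u C1" "\<And>E. E \<in> sets M \<Longrightarrow> E \<subseteq> C1 \<Longrightarrow> u ` E \<in> sets borel"
    "\<And>E. E \<in> sets M \<Longrightarrow> E \<subseteq> C1 \<Longrightarrow> emeasure lborel (u ` E) = emeasure M E"
    "\<And>s. 0 \<le> s \<Longrightarrow> s \<le> measure M C \<Longrightarrow> measure M {x\<in>C. u x \<le> s} = s"
    "\<And>x. 0 \<le> u x" "\<And>x. u x \<le> measure M C"
    by (rule uniform_coordinate[OF C], rule that)
  obtain v D1 where v: "v \<in> borel_measurable M" "D1 \<in> sets M" "D1 \<subseteq> D" "measure M (D - D1) = 0"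
    "inj_on v D1" "\<And>E. E \<in> sets M \<Longrightarrow> E \<subseteq> D1 \<Longrightarrow> v ` E \<in> sets borel"
    "\<And>E. E \<in> sets M \<Longrightarrow> E \<subseteq> D1 \<Longrightarrow> emeasure lborel (v ` E) = emeasure M E"
    "\<And>s. 0 \<le> s \<Longrightarrow> s \<le> measure M D \<Longrightarrow> measure M {x\<in>D. v x \<le> s} = s"
    "\<And>x. 0 \<le> v x" "\<And>x. v x \<le> measure M D"
    by (rule uniform_coordinate[OF D], rule that)
  \<comment> \<open>Only coordinates attained on both sides can be exchanged. Both images have full
    measure in the same interval, so nothing but null sets is lost.\<close>
  define W where "W = u ` C1 \<inter> v ` D1"
  define C2 where "C2 = {x\<in>C1. u x \<in> W}"
  define D2 where "D2 = {y\<in>D1. v y \<in> W}"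
  have uC1: "u ` C1 \<in> sets borel" and vD1: "v ` D1 \<in> sets borel" using u v by auto
  have W: "W \<in> sets borel" "W \<subseteq> u ` C1" "W \<subseteq> v ` D1" using uC1 vD1 by (auto simp: W_def)
  have sub: "C1 \<subseteq> space M" "D1 \<subseteq> space M" 
    using sets.sets_into_space[OF u(2)] sets.sets_into_space[OF v(2)] by auto
  have C2: "C2 \<in> sets M"
  proof -
    have "C2 = C1 \<inter> (u -` W \<inter> space M)" using sub by (auto simp: C2_def)
    then show ?thesis using u(2) measurable_sets[OF u(1) W(1)] by simp
  qed
  have D2: "D2 \<in> sets M"
  proof -
    have "D2 = D1 \<inter> (v -` W \<inter> space M)" using sub by (auto simp: D2_def)
    then show ?thesis using v(2) measurable_sets[OF v(1) W(1)] by simp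
  qed
  have CD: "C2 \<inter> D2 = {}" "C2 \<subseteq> C" "D2 \<subseteq> D" using disj u(3) v(3) by (auto simp: C2_def D2_def)
  \<comment> \<open>Stated with parameters because it serves both sides. Points of \<open>A1\<close>
    without a partner have their coordinate in the interval but outside the image of
    \<open>w\<close>, which has full measure there.\<close>
  have null: "measure M (A1 - A2) = 0"
    if A: "A1 \<in> sets M" "A2 \<in> sets M" "A2 = {x\<in>A1. u' x \<in> W}" "inj_on u' A1"
      "\<And>E. E \<in> sets M \<Longrightarrow> E \<subseteq> A1 \<Longrightarrow> u' ` E \<in> sets borel"
      "\<And>E. E \<in> sets M \<Longrightarrow> E \<subseteq> A1 \<Longrightarrow> emeasure lborel (u' ` E) = emeasure M E"
      "\<And>x. 0 \<le> u' x" "\<And>x. u' x \<le> measure M B"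
      "W = u' ` A1 \<inter> w ` B1" "w ` B1 \<in> sets borel" "emeasure lborel (w ` B1) = emeasure M B"
      "w ` B1 \<subseteq> {0..measure M B}"
    for A1 A2 B B1 and u' w :: "'a \<Rightarrow> real"
  proof -
    have "emeasure M (A1 - A2) = emeasure lborel (u' ` (A1 - A2))" using A(1,2,6) by simp
    also have "\<dots> \<le> emeasure lborel ({0..measure M B} - w ` B1)"
      by (rule emeasure_mono) (use A(3,7-10) in auto)
    also have "\<dots> = emeasure lborel {0..measure M B} - emeasure lborel (w ` B1)"
      by (rule emeasure_Diff) (use A(10-12) in \<open>auto simp: emeasure_eq_measure\<close>)
    also have "\<dots> = 0" using A(11) by (simp add: emeasure_eq_measure)
    finally show ?thesis by (simp add: measure_def)
  qed
  have full: "emeasure M A1 = emeasure M A" if "A1 \<in> sets M" "A \<in> sets M" "A1 \<subseteq> A" "measure M (A - A1) = 0" for A A1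
    using that finite_measure_Diff[of A A1] by (simp add: emeasure_eq_measure)
  have lC: "emeasure lborel (u ` C1) = emeasure M C" "u ` C1 \<subseteq> {0..measure M C}"
    using u(7)[OF u(2) subset_refl] full[OF u(2) C u(3,4)] u(9,10) by auto
  have lD: "emeasure lborel (v ` D1) = emeasure M D" "v ` D1 \<subseteq> {0..measure M D}"
    using v(7)[OF v(2) subset_refl] full[OF v(2) D v(3,4)] v(9,10) by auto
  have "measure M (C1 - C2) = 0"
    by (rule null[OF u(2) C2 C2_def u(5,6,7,9) u(10)[unfolded eq] W_def vD1 lD])
  moreover have "measure M (C - C2) \<le> measure M ((C - C1) \<union> (C1 - C2))"
    by (rule finite_measure_mono) (use C C2 u in auto)
  moreover have "measure M ((C - C1) \<union> (C1 - C2)) \<le> measure M (C - C1) + measure M (C1 - C2)"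
    by (rule measure_Un_le) (use C C2 u(2) in auto)
  ultimately have nC: "measure M (C - C2) = 0"
    
    using u(4) measure_nonneg[of M "C - C2"] by linarith
  have W_def': "W = v ` D1 \<inter> u ` C1" by (unfold W_def, rule Int_commute)
  have "measure M (D1 - D2) = 0"
    by (rule null[OF v(2) D2 D2_def v(5,6,7,9) v(10)[folded eq] W_def' uC1 lC])
  moreover have "measure M (D - D2) \<le> measure M ((D - D1) \<union> (D1 - D2))"
    by (rule finite_measure_mono) (use D D2 v in auto)
  moreover have "measure M ((D - D1) \<union> (D1 - D2)) \<le> measure M (D - D1) + measure M (D1 - D2)"
    by (rule measure_Un_le) (use D D2 v(2) in auto)
  ultimately have nD: "measure M (D - D2) = 0"
    
    using v(4) measure_nonneg[of M "D - D2"] by linarith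
  define T where "T x = (if x \<in> C2 then inv_into D1 v (u x) else if x \<in> D2 then inv_into C1 u (v x) else x)" for x
  have TC: "T x \<in> D2 \<and> v (T x) = u x" if "x \<in> C2" for x
    using that W(3) by (auto simp: T_def C2_def D2_def inv_into_into f_inv_into_f subset_iff)
  have TD: "T y \<in> C2 \<and> u (T y) = v y" if "y \<in> D2" for y
  proof -
    have "y \<notin> C2" using that CD by auto
    then show ?thesis
      using that W(2) by (auto simp: T_def C2_def D2_def inv_into_into f_inv_into_f subset_iff)
  qed
  have TT: "T (T x) = x" for x
  proof -
    consider "x \<in> C2" | "x \<in> D2" | "x \<notin> C2" "x \<notin> D2" by blast
    then show ?thesis
    proof cases
      case 1
      then have "T (T x) \<in> C2 \<and> u (T (T x)) = u x" using TC[of x] TD[of "T x"] by simp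
      then show ?thesis using 1 u(5) unfolding C2_def inj_on_def by blast
    next
      case 2
      then have "T (T x) \<in> D2 \<and> v (T (T x)) = v x" using TD[of x] TC[of "T x"] by simp
      then show ?thesis using 2 v(5) unfolding D2_def inj_on_def by blast
    qed (simp add: T_def)
  qed
  have T_space: "T x \<in> space M" if "x \<in> space M" for x
  proof -
    consider "x \<in> C2" | "x \<in> D2" | "x \<notin> C2" "x \<notin> D2" by blast
    then show ?thesis
    proof cases
      case 1
      then show ?thesis using TC sets.sets_into_space[OF D2] by blast
    next
      case 2
      then show ?thesis using TD sets.sets_into_space[OF C2] by blast
    qed (use that in \<open>simp add: T_def\<close>)
  qed
  have pre: "T -` E \<inter> space M \<in> sets M \<and> emeasure M (T -` E \<inter> space M) = emeasure M E"
    if E: "E \<in> sets M" for E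
  proof -
    let ?F = "{x\<in>C1. u x \<in> W \<and> inv_into D1 v (u x) \<in> E}"
    let ?G = "{x\<in>D1. v x \<in> W \<and> inv_into C1 u (v x) \<in> E}"
    have F: "?F \<in> sets M" by (rule transfer_set(1)[OF u(1,2,5,7) v(2,5,6,7) W D2_def D2 E])
    have F': "emeasure M ?F = emeasure M (D2 \<inter> E)"
      by (rule transfer_set(2)[OF u(1,2,5,7) v(2,5,6,7) W D2_def D2 E])
    have G: "?G \<in> sets M" by (rule transfer_set(1)[OF v(1,2,5,7) u(2,5,6,7) W(1,3,2) C2_def C2 E])
    have G': "emeasure M ?G = emeasure M (C2 \<inter> E)"
      by (rule transfer_set(2)[OF v(1,2,5,7) u(2,5,6,7) W(1,3,2) C2_def C2 E])
    have T1: "T x = inv_into D1 v (u x)" if "x \<in> C2" for x using that by (simp add: T_def)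
    have T2: "T x = inv_into C1 u (v x)" if "x \<in> D2" for x using that CD(1) by (auto simp: T_def)
    have FG_iff: "x \<in> ?F \<longleftrightarrow> x \<in> C2 \<and> T x \<in> E" "x \<in> ?G \<longleftrightarrow> x \<in> D2 \<and> T x \<in> E" for x
      using T1[of x] T2[of x] by (auto simp: C2_def D2_def)
    have dec: "T -` E \<inter> space M = (?F \<union> ?G) \<union> (E - (C2 \<union> D2))"
    proof (intro equalityI subsetI)
      fix x assume x: "x \<in> T -` E \<inter> space M"
      then show "x \<in> (?F \<union> ?G) \<union> (E - (C2 \<union> D2))"
        unfolding Un_iff FG_iff by (auto simp: T_def)
    next
      fix x assume x: "x \<in> (?F \<union> ?G) \<union> (E - (C2 \<union> D2))"
      then have "x \<in> space M" using sub sets.sets_into_space[OF E] by auto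
      moreover have "T x \<in> E" using x unfolding Un_iff FG_iff by (auto simp: T_def)
      ultimately show "x \<in> T -` E \<inter> space M" by simp
    qed
    have FG: "?F \<inter> ?G = {}" "(?F \<union> ?G) \<inter> (E - (C2 \<union> D2)) = {}"
      using CD(1) by (auto simp: C2_def D2_def)
    have CDE: "(D2 \<inter> E) \<inter> (C2 \<inter> E) = {}" "(D2 \<inter> E \<union> C2 \<inter> E) \<inter> (E - (C2 \<union> D2)) = {}"
      using CD(1) by auto
    have sets: "D2 \<inter> E \<in> sets M" "C2 \<inter> E \<in> sets M" "E - (C2 \<union> D2) \<in> sets M"
      "D2 \<inter> E \<union> C2 \<inter> E \<in> sets M" "?F \<union> ?G \<in> sets M"
      using E C2 D2 F G by auto
    have "emeasure M (T -` E \<inter> space M) = emeasure M ?F + emeasure M ?G + emeasure M (E - (C2 \<union> D2))"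
      unfolding dec plus_emeasure[OF F G FG(1)] plus_emeasure[OF sets(5,3) FG(2)] ..
    also have "\<dots> = emeasure M (D2 \<inter> E) + emeasure M (C2 \<inter> E) + emeasure M (E - (C2 \<union> D2))"
      by (simp only: F' G')
    also have "\<dots> = emeasure M ((D2 \<inter> E) \<union> (C2 \<inter> E) \<union> (E - (C2 \<union> D2)))"
      unfolding plus_emeasure[OF sets(1,2) CDE(1)] plus_emeasure[OF sets(4,3) CDE(2)] ..
    also have "(D2 \<inter> E) \<union> (C2 \<inter> E) \<union> (E - (C2 \<union> D2)) = E" by auto
    finally show ?thesis using sets(3,5) unfolding dec by blast
  qed
  have meas: "T \<in> measurable M M" using T_space pre by (auto intro: measurableI)
  have distr: "distr M M T = M"
    by (rule measure_eqI) (use pre meas in \<open>auto simp: emeasure_distr\<close>)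
  have T: "T \<in> mp_transformations M"
    by (rule mp_transformationsI(1)[OF meas meas TT TT distr])
  define s where "s = aut_class M T"
  have s: "s \<in> carrier (Aut M)" using T by (simp add: s_def aut_class_in_carrier)
  have s_act: "dd (act s A) (T ` A) = 0" if "A \<in> sets M" "T ` A \<in> sets M" for A
    using dd_act_AE[OF s T _ that] AE_rep_aut_class[OF T] by (simp add: s_def)
  have TC_image: "T ` C = D2 \<union> (C - C2)"
  proof -
    have "T ` C2 = D2" using TC TD TT by (metis image_subset_iff subset_antisym subsetI image_eqI)
    moreover have "T ` (C - C2) = C - C2"
    proof -
      have "T x = x" if "x \<in> C - C2" for x using that disj CD by (auto simp: T_def)
      then show ?thesis by (metis (no_types, lifting) image_cong image_ident)
    qed
    moreover have "T ` C = T ` C2 \<union> T ` (C - C2)" using CD by blast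
    ultimately show ?thesis by simp
  qed
  have img: "T ` C \<in> sets M" using TC_image C C2 D2 by simp
  have "dd (T ` C) D \<le> measure M ((C - C2) \<union> (D - D2))"
    unfolding set_dist_def TC_image by (rule finite_measure_mono) (use C D C2 D2 CD in auto)
  also have "\<dots> \<le> 0" using measure_Un_le[of "C - C2" M "D - D2"] C D C2 D2 nC nD by simp
  finally have "dd (T ` C) D = 0" using dd_nonneg[of "T ` C" D] by linarith
  then have "dd (act s C) D = 0"
    using dd_trans_0[of "act s C" "T ` C" D] s_act[OF C img] img C D s by simp
  moreover have "dd (act s E) E = 0" if "E \<in> sets M" "E \<inter> (C \<union> D) = {}" for E
  proof -
    have "T x = x" if "x \<in> E" for x using that \<open>E \<inter> (C \<union> D) = {}\<close> CD by (auto simp: T_def)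
    then have "T ` E = E" by (metis (no_types, lifting) image_cong image_ident)
    then show ?thesis using s_act[of E] that by simp
  qed
  ultimately show ?thesis using s by blast
qed

text \<open>Induction on \<open>I\<close>: once the sets with index in \<open>I\<close> are in
  place, the current image of \<open>A a\<close> is swapped with \<open>B a\<close>. The swap leaves
  the earlier sets in place because both exchanged pieces avoid every earlier
  \<open>B i\<close>.\<close>

lemma move_family:
  assumes "finite I" "\<And>i. i \<in> I \<Longrightarrow> A i \<in> sets M" "\<And>i. i \<in> I \<Longrightarrow> B i \<in> sets M"
    "disjoint_family_on A I" "disjoint_family_on B I"
    "\<And>i. i \<in> I \<Longrightarrow> measure M (A i) = measure M (B i)"
  shows "\<exists>g\<in>carrier (Aut M). \<forall>i\<in>I. dd (act g (A i)) (B i) = 0"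
  using assms
proof (induction I)
  case empty
  then show ?case using monoid.one_closed[OF group.is_monoid[OF group_Aut]] by auto
next
  case (insert a I)
  interpret group "Aut M" by (rule group_Aut)
  obtain g where g: "g \<in> carrier (Aut M)" "\<forall>i\<in>I. dd (act g (A i)) (B i) = 0"
    using insert.IH insert.prems by (auto simp: disjoint_family_on_def)
  define C where "C = act g (A a)"
  define D where "D = B a"
  have CD: "C \<in> sets M" "D \<in> sets M" "measure M C = measure M D"
    using insert.prems g by (auto simp: C_def D_def)
  have BI: "B i \<in> sets M" "A i \<in> sets M" if "i \<in> I" for i using insert.prems that by auto
  define U where "U = (\<Union>i\<in>I. B i)"
  have U: "U \<in> sets M" using BI insert.hyps(1) by (auto simp: U_def)
  have DU: "D \<inter> U = {}"
    using insert.prems(4) insert.hyps(2) by (auto simp: D_def U_def disjoint_family_on_def)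
  have "measure M (C \<inter> U) \<le> (\<Sum>i\<in>I. measure M (C \<inter> B i))"
  proof -
    have "C \<inter> U = (\<Union>i\<in>I. C \<inter> B i)" by (auto simp: U_def)
    then show ?thesis using measure_UNION_le[of I "\<lambda>i. C \<inter> B i" M] insert.hyps(1) BI CD by auto
  qed
  also have "\<dots> = 0"
  proof (rule sum.neutral, rule ballI)
    fix i assume i: "i \<in> I"
    have "measure M (B i \<inter> C) = measure M (act g (A i) \<inter> C)"
      by (rule measure_Int_cong) (use i BI g CD in \<open>auto simp: dd_commute\<close>)
    also have "act g (A i) \<inter> C = act g (A i \<inter> A a)"
      using g BI[OF i] insert.prems(1) by (simp add: C_def act_Int)
    also have "A i \<inter> A a = {}" using insert.prems(3) insert.hyps(2) i by (auto simp: disjoint_family_on_def)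
    finally show "measure M (C \<inter> B i) = 0" using g by (simp add: Int_commute)
  qed
  finally have CU: "measure M (C \<inter> U) = 0" using measure_nonneg[of M "C \<inter> U"] by simp
  \<comment> \<open>\<open>C\<close> meets the sets already placed in a null set only, but the swap
    is known to fix sets that are literally disjoint from the exchanged ones, hence the removal of
    \<open>U\<close>. The overlap of \<open>C\<close> and \<open>D\<close> stays where it
    is.\<close>
  define C' where "C' = C - D - U"
  define D' where "D' = D - C"
  have CD': "C' \<in> sets M" "D' \<in> sets M" "C' \<inter> D' = {}" using CD U by (auto simp: C'_def D'_def)
  have mC': "dd C' (C - D) = 0"
  proof -
    have "dd C' (C - D) \<le> measure M (C \<inter> U)"
      unfolding set_dist_def by (rule finite_measure_mono) (use CD U in \<open>auto simp: C'_def\<close>)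
    then show ?thesis using CU dd_nonneg[of C' "C - D"] by simp
  qed
  have "measure M C' = measure M (C - D)" using dd_measure_le[of C' "C - D"] mC' CD CD' by simp
  also have "\<dots> = measure M D'"
    using CD by (simp add: D'_def finite_measure_Diff' Int_commute)
  finally obtain s where s: "s \<in> carrier (Aut M)" "dd (act s C') D' = 0"
      "\<And>E. E \<in> sets M \<Longrightarrow> E \<inter> (C' \<union> D') = {} \<Longrightarrow> dd (act s E) E = 0"
    using swap_exists[OF CD'] by metis
  have sg: "s \<otimes>\<^bsub>Aut M\<^esub> g \<in> carrier (Aut M)" using s g by simp
  have mult: "dd (act (s \<otimes>\<^bsub>Aut M\<^esub> g) E) (act s (act g E)) = 0" if "E \<in> sets M" for E
    using dd_act_mult s g that by blast
  have "dd (act (s \<otimes>\<^bsub>Aut M\<^esub> g) (A i)) (B i) = 0" if i: "i \<in> I" for i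
  proof -
    have "B i \<inter> (C' \<union> D') = {}" using i DU by (auto simp: C'_def D'_def U_def)
    then have "dd (act s (B i)) (B i) = 0" using s(3) BI i by simp
    moreover have "dd (act s (act g (A i))) (act s (B i)) = 0" using s g i BI by simp
    ultimately have "dd (act s (act g (A i))) (B i) = 0"
      using dd_trans_0[of "act s (act g (A i))" "act s (B i)" "B i"] s(1) g(1) BI[OF i]
      by (simp del: dd_act)
    then show ?thesis
      using dd_trans_0[of "act (s \<otimes>\<^bsub>Aut M\<^esub> g) (A i)" "act s (act g (A i))" "B i"] mult[of "A i"]
        s(1) g(1) sg BI[OF i] by simp
  qed
  moreover have "dd (act (s \<otimes>\<^bsub>Aut M\<^esub> g) (A a)) (B a) = 0"
  proof -
    have Aa: "A a \<in> sets M" using insert.prems by simp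
    have sub: "dd (X \<union> Y) (X' \<union> Y') \<le> dd X X' + dd Y Y'"
      if "X \<in> sets M" "Y \<in> sets M" "X' \<in> sets M" "Y' \<in> sets M" for X Y X' Y'
      using dd_UN[of "UNIV :: bool set" "\<lambda>b. if b then X else Y" "\<lambda>b. if b then X' else Y'"] that
      by (simp add: UNIV_bool Un_commute add.commute)
    have "dd (act s (C - D)) D' \<le> dd (act s (C - D)) (act s C') + dd (act s C') D'"
      by (rule dd_triangle) (use s CD CD' in auto)
    also have "\<dots> = 0" using s CD CD' mC' by (simp add: dd_commute)
    finally have 1: "dd (act s (C - D)) D' \<le> 0" .
    have 2: "dd (act s (C \<inter> D)) (C \<inter> D) = 0"
      by (rule s(3)) (use CD in \<open>auto simp: C'_def D'_def\<close>)
    have "dd (act s ((C - D) \<union> (C \<inter> D))) (D' \<union> (C \<inter> D)) \<le> 0 + 0"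
      unfolding act_Un[OF s(1)] by (rule order_trans[OF sub]) (use 1 2 s CD CD' in auto)
    moreover have "(C - D) \<union> (C \<inter> D) = C" "D' \<union> (C \<inter> D) = D" by (auto simp: D'_def)
    ultimately have "dd (act s C) D \<le> 0" by simp
    then have "dd (act s C) D = 0" using dd_nonneg[of "act s C" D] by linarith
    then show ?thesis
      using dd_trans_0[of "act (s \<otimes>\<^bsub>Aut M\<^esub> g) (A a)" "act s C" D] mult[OF Aa] s(1) g(1) sg Aa CD
      by (simp add: C_def D_def)
  qed
  ultimately show ?case using sg by blast
qed

end

section \<open>Independence and approximation\<close>

lemma finite_partitionD:
  assumes "finite_partition M n P"
  shows "\<And>i. i < n \<Longrightarrow> P i \<in> sets M" "disjoint_family_on P {..<n}" "(\<Union>i<n. P i) = space M"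
    "\<And>i j. i < n \<Longrightarrow> j < n \<Longrightarrow> i \<noteq> j \<Longrightarrow> P i \<inter> P j = {}"
  using assms by (auto simp: finite_partition_def disjoint_family_on_def)

lemma equipartitionD:
  assumes "equipartition M n P"
  shows "finite_partition M n P" "\<And>i. i < n \<Longrightarrow> P i \<in> sets M"
    "\<And>i. i < n \<Longrightarrow> measure M (P i) = 1 / n"
  using assms by (auto simp: equipartition_def finite_partition_def)

context prob_space
begin

lemma finite_partition_pos: "finite_partition M n P \<Longrightarrow> 0 < n"
  using not_empty by (cases n) (auto simp: finite_partition_def)

lemma sum_measure_Int_partition:
  assumes P: "finite_partition M n P" and A: "A \<in> sets M"
  shows "(\<Sum>i<n. measure M (A \<inter> P i)) = measure M A"
proof -
  have "measure M (\<Union>i<n. A \<inter> P i) = (\<Sum>i<n. measure M (A \<inter> P i))"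
  proof (rule finite_measure_finite_Union)
    show "disjoint_family_on (\<lambda>i. A \<inter> P i) {..<n}"
      using finite_partitionD(2)[OF P] unfolding disjoint_family_on_def by blast
  qed (use finite_partitionD(1)[OF P] A in auto)
  moreover have "(\<Union>i<n. A \<inter> P i) = A"
    using finite_partitionD(3)[OF P] sets.sets_into_space[OF A] by blast
  ultimately show ?thesis by simp
qed

lemma finite_partition_act:
  assumes "finite_partition M n P" "g \<in> carrier (Aut M)"
  shows "finite_partition M n (\<lambda>i. act g (P i))"
  using assms act_disjoint_family_on[OF assms(2), of P "{..<n}"]
  by (auto simp: finite_partition_def act_UN[OF assms(2), symmetric])

lemma equipartition_act:
  assumes "equipartition M n P" "g \<in> carrier (Aut M)"
  shows "equipartition M n (\<lambda>i. act g (P i))"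
  using assms finite_partition_act[of n P g] by (auto simp: equipartition_def finite_partition_def)

end

context atomless_standard_space
begin

text \<open>Inside each cell of \<open>Q\<close> the sets \<open>B i\<close> become independent of the sets \<open>C l\<close>.\<close>

lemma spread:
  assumes Q: "finite_partition M N Q" and B: "finite_partition M m B" and C: "finite_partition M L C"
  shows "\<exists>p\<in>carrier (Aut M). (\<forall>k<N. dd (act p (Q k)) (Q k) = 0) \<and>
    (\<forall>i<m. \<forall>l<L. measure M (act p (B i) \<inter> C l) =
       (\<Sum>k<N. measure M (B i \<inter> Q k) * measure M (C l \<inter> Q k) / measure M (Q k)))"
proof -
  note Qs = finite_partitionD[OF Q] and Bs = finite_partitionD[OF B] and Cs = finite_partitionD[OF C]
  \<comment> \<open>The measure that independence inside \<open>Q k\<close> prescribes for the part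
    of \<open>B i\<close> placed in \<open>C l\<close>. On a null cell the division by zero returns
    the correct value 0.\<close>
  define t where "t k l i = measure M (B i \<inter> Q k) * measure M (C l \<inter> Q k) / measure M (Q k)" for k l i
  have zero: "measure M (A \<inter> Q k) = 0" if "measure M (Q k) = 0" "A \<in> sets M" "k < N" for A k
    using finite_measure_mono[of "A \<inter> Q k" "Q k"] that Qs(1) measure_nonneg[of M "A \<inter> Q k"]
    by (metis Int_lower2 measure_le_0_iff)
  define Phi where "Phi k l E \<longleftrightarrow> (\<forall>i<m. E i \<in> sets M \<and> measure M (E i) = t k l i) \<and>
      disjoint_family_on E {..<m} \<and> (\<Union>i<m. E i) = C l \<inter> Q k" for k l E
  have "\<exists>E. Phi k l E" if kl: "k < N" "l < L" for k l
    unfolding Phi_def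
  proof (rule split_set)
    show "C l \<inter> Q k \<in> sets M" using kl Qs Cs by auto
    show "0 < m" using B by (rule finite_partition_pos)
    have "sum (t k l) {..<m} = (\<Sum>i<m. measure M (Q k \<inter> B i)) * measure M (C l \<inter> Q k) / measure M (Q k)"
      unfolding t_def by (simp add: sum_distrib_right sum_divide_distrib Int_commute)
    also have "\<dots> = measure M (C l \<inter> Q k)"
      using sum_measure_Int_partition[OF B Qs(1)[OF kl(1)]] zero[OF _ Cs(1)[OF kl(2)] kl(1)]
      by (cases "measure M (Q k) = 0") auto
    finally show "sum (t k l) {..<m} = measure M (C l \<inter> Q k)" .
    show "0 \<le> t k l i" for i by (simp add: t_def)
  qed
  then obtain E where "\<And>k l. k < N \<Longrightarrow> l < L \<Longrightarrow> Phi k l (E k l)" by metis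
  then have E: "\<And>k l i. k < N \<Longrightarrow> l < L \<Longrightarrow> i < m \<Longrightarrow> E k l i \<in> sets M"
      "\<And>k l i. k < N \<Longrightarrow> l < L \<Longrightarrow> i < m \<Longrightarrow> measure M (E k l i) = t k l i"
      "\<And>k l. k < N \<Longrightarrow> l < L \<Longrightarrow> disjoint_family_on (E k l) {..<m}"
      "\<And>k l. k < N \<Longrightarrow> l < L \<Longrightarrow> (\<Union>i<m. E k l i) = C l \<inter> Q k"
    unfolding Phi_def by simp_all
  have E_sub: "E k l i \<subseteq> C l \<inter> Q k" if "k < N" "l < L" "i < m" for k l i
    using E(4)[OF that(1,2)] that(3) by blast
  have E_inj: "k = k' \<and> l = l' \<and> i = i'"
    if x: "x \<in> E k l i" "x \<in> E k' l' i'" "k < N" "l < L" "i < m" "k' < N" "l' < L" "i' < m" for x k l i k' l' i'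
  proof -
    have "x \<in> C l \<inter> Q k" "x \<in> C l' \<inter> Q k'" using E_sub x by blast+
    then have kl: "k = k'" "l = l'" using Qs(4) Cs(4) x by blast+
    then show ?thesis using E(3)[OF x(3,4)] x unfolding disjoint_family_on_def by blast
  qed
  \<comment> \<open>The part of \<open>B i\<close> in \<open>Q k\<close> goes to the prescribed
    pieces gathered over all \<open>l\<close>. Source and target lie in the same \<open>Q k\<close>,
    which is why every cell is preserved.\<close>
  define S where "S = (\<lambda>(k, i). B i \<inter> Q k)"
  define T where "T = (\<lambda>(k, i). \<Union>l<L. E k l i)"
  define J where "J = {..<N} \<times> {..<m}"
  have "\<exists>p\<in>carrier (Aut M). \<forall>j\<in>J. dd (act p (S j)) (T j) = 0"
  proof (rule move_family)
    show "finite J" by (simp add: J_def)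
    show "S j \<in> sets M" if "j \<in> J" for j using that Qs Bs by (auto simp: S_def J_def)
    show "T j \<in> sets M" if "j \<in> J" for j using that E(1) by (auto simp: T_def J_def)
    show "disjoint_family_on S J"
      unfolding disjoint_family_on_def S_def J_def using Qs(4) Bs(4) by (clarsimp, blast)
    show "disjoint_family_on T J"
      unfolding disjoint_family_on_def T_def J_def using E_inj by (clarsimp, blast)
    show "measure M (S j) = measure M (T j)" if jJ: "j \<in> J" for j
    proof -
      obtain k i where j: "j = (k, i)" "k < N" "i < m" using jJ by (auto simp: J_def)
      have "measure M (T j) = (\<Sum>l<L. measure M (E k l i))"
        unfolding T_def j prod.case
      proof (rule finite_measure_finite_Union)
        show "disjoint_family_on (\<lambda>l. E k l i) {..<L}"
          unfolding disjoint_family_on_def using E_inj j(2,3) by blast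
      qed (use E(1) j in auto)
      also have "\<dots> = (\<Sum>l<L. t k l i)" using E(2) j by simp
      also have "\<dots> = measure M (B i \<inter> Q k) * (\<Sum>l<L. measure M (Q k \<inter> C l)) / measure M (Q k)"
        unfolding t_def by (simp add: sum_distrib_left sum_divide_distrib Int_commute)
      also have "\<dots> = measure M (B i \<inter> Q k)"
        using sum_measure_Int_partition[OF C Qs(1)[OF j(2)]] zero[OF _ Bs(1)[OF j(3)] j(2)]
        by (cases "measure M (Q k) = 0") auto
      finally show ?thesis by (simp add: S_def j)
    qed
  qed
  then obtain p where p: "p \<in> carrier (Aut M)" "\<And>k i. k < N \<Longrightarrow> i < m \<Longrightarrow> dd (act p (B i \<inter> Q k)) (T (k, i)) = 0"
    by (auto simp: J_def S_def)
  have Ts: "T (k, i) \<in> sets M" if "k < N" "i < m" for k i using that E(1) by (auto simp: T_def)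
  have Bp: "act p (B i \<inter> Q k) \<in> sets M" if "k < N" "i < m" for k i using that Bs Qs p(1) by auto
  have "dd (act p (Q k)) (Q k) = 0" if k: "k < N" for k
  proof -
    have "Q k = (\<Union>i<m. B i \<inter> Q k)" using Bs(3) sets.sets_into_space[OF Qs(1)[OF k]] by blast
    then have "act p (Q k) = act p (\<Union>i<m. B i \<inter> Q k)" by (rule arg_cong)
    then have 1: "act p (Q k) = (\<Union>i<m. act p (B i \<inter> Q k))" by (simp only: act_UN[OF p(1)])
    have 2: "Q k = (\<Union>i<m. T (k, i))"
    proof -
      have "(\<Union>i<m. T (k, i)) = (\<Union>l<L. \<Union>i<m. E k l i)" by (auto simp: T_def)
      also have "\<dots> = (\<Union>l<L. C l \<inter> Q k)" using E(4) k by simp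
      also have "\<dots> = Q k" using Cs(3) sets.sets_into_space[OF Qs(1)[OF k]] by blast
      finally show ?thesis by simp
    qed
    have "dd (\<Union>i<m. act p (B i \<inter> Q k)) (\<Union>i<m. T (k, i)) \<le> (\<Sum>i<m. dd (act p (B i \<inter> Q k)) (T (k, i)))"
      by (rule dd_UN) (use Ts Bp k in auto)
    also have "\<dots> = 0" using p(2) k by simp
    finally have "dd (act p (Q k)) (Q k) \<le> 0" unfolding 1[symmetric] 2[symmetric] .
    then show ?thesis by (intro antisym) auto
  qed
  moreover have "measure M (act p (B i) \<inter> C l) = (\<Sum>k<N. t k l i)" if il: "i < m" "l < L" for i l
  proof -
    have "B i = (\<Union>k<N. B i \<inter> Q k)" using Qs(3) sets.sets_into_space[OF Bs(1)[OF il(1)]] by blast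
    then have "act p (B i) = act p (\<Union>k<N. B i \<inter> Q k)" by (rule arg_cong)
    then have 1: "act p (B i) = (\<Union>k<N. act p (B i \<inter> Q k))" by (simp only: act_UN[OF p(1)])
    have "dd (act p (B i)) (\<Union>k<N. T (k, i)) \<le> (\<Sum>k<N. dd (act p (B i \<inter> Q k)) (T (k, i)))"
      unfolding 1 by (rule dd_UN) (use Ts Bp il in auto)
    also have "\<dots> = 0" using p(2) il by simp
    finally have "dd (act p (B i)) (\<Union>k<N. T (k, i)) = 0" by (intro antisym) auto
    then have "measure M (act p (B i) \<inter> C l) = measure M ((\<Union>k<N. T (k, i)) \<inter> C l)"
      by (intro measure_Int_cong) (use Ts il Bs Cs p(1) in auto)
    also have "(\<Union>k<N. T (k, i)) \<inter> C l = (\<Union>k<N. E k l i)"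
    proof (intro equalityI subsetI)
      fix x assume "x \<in> (\<Union>k<N. T (k, i)) \<inter> C l"
      then obtain k l' where kl: "k < N" "l' < L" "x \<in> E k l' i" "x \<in> C l" by (auto simp: T_def)
      then have "x \<in> C l'" using E_sub il by blast
      then have "l = l'" using Cs(4) kl il by blast
      then show "x \<in> (\<Union>k<N. E k l i)" using kl by blast
    next
      fix x assume "x \<in> (\<Union>k<N. E k l i)"
      then obtain k where k: "k < N" "x \<in> E k l i" by blast
      then have "x \<in> C l" "x \<in> T (k, i)" using E_sub il by (auto simp: T_def)
      then show "x \<in> (\<Union>k<N. T (k, i)) \<inter> C l" using k by blast
    qed
    also have "measure M (\<Union>k<N. E k l i) = (\<Sum>k<N. measure M (E k l i))"
    proof (rule finite_measure_finite_Union)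
      show "disjoint_family_on (\<lambda>k. E k l i) {..<N}"
        unfolding disjoint_family_on_def using E_inj il by blast
    qed (use E(1) il in auto)
    also have "\<dots> = (\<Sum>k<N. t k l i)" using E(2) il by simp
    finally show ?thesis .
  qed
  ultimately show ?thesis using p(1) unfolding t_def by blast
qed

text \<open>The numbering gives \<open>P j\<close> a block of consecutive indices, so that the
  indicator of \<open>P j\<close> becomes the indicator of an index set.\<close>

lemma refine_equipartition:
  assumes P: "equipartition M n P" and r: "0 < r"
  shows "\<exists>R. equipartition M (n * r) R \<and> (\<forall>j<n. P j = (\<Union>k\<in>{j*r..<Suc j * r}. R k))"
proof -
  note Ps = finite_partitionD[OF equipartitionD(1)[OF P]]
  have n: "0 < n" using equipartitionD(1)[OF P] by (rule finite_partition_pos)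
  define Phi where "Phi j E \<longleftrightarrow> (\<forall>i<r. E i \<in> sets M \<and> measure M (E i) = 1 / (n * r)) \<and>
      disjoint_family_on E {..<r} \<and> (\<Union>i<r. E i) = P j" for j E
  have "\<exists>E. Phi j E" if "j < n" for j
    unfolding Phi_def
    by (rule split_set) (use that r n Ps(1) equipartitionD(3)[OF P] in auto)
  then obtain E where "\<And>j. j < n \<Longrightarrow> Phi j (E j)" by metis
  then have E: "\<And>j i. j < n \<Longrightarrow> i < r \<Longrightarrow> E j i \<in> sets M"
      "\<And>j i. j < n \<Longrightarrow> i < r \<Longrightarrow> measure M (E j i) = 1 / (n * r)"
      "\<And>j. j < n \<Longrightarrow> disjoint_family_on (E j) {..<r}" "\<And>j. j < n \<Longrightarrow> (\<Union>i<r. E j i) = P j"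
    unfolding Phi_def by simp_all
  define R where "R k = E (k div r) (k mod r)" for k
  have dm: "k div r < n" "k mod r < r" if "k < n * r" for k
    using that r by (auto simp: less_mult_imp_div_less)
  have block: "(\<Union>k\<in>{j*r..<Suc j * r}. R k) = (\<Union>i<r. E j i)" for j
  proof (intro equalityI subsetI)
    fix x assume "x \<in> (\<Union>k\<in>{j*r..<Suc j * r}. R k)"
    then obtain k where k: "j * r \<le> k" "k < Suc j * r" "x \<in> R k" by auto
    then have "k div r = j" by (intro div_nat_eqI) (auto simp: mult.commute)
    then show "x \<in> (\<Union>i<r. E j i)" using k(3) r by (auto simp: R_def)
  next
    fix x assume "x \<in> (\<Union>i<r. E j i)"
    then obtain i where i: "i < r" "x \<in> E j i" by blast
    then have "x \<in> R (j * r + i)" "j * r + i \<in> {j*r..<Suc j * r}" by (auto simp: R_def)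
    then show "x \<in> (\<Union>k\<in>{j*r..<Suc j * r}. R k)" by blast
  qed
  have "disjoint_family_on R {..<n * r}"
    unfolding disjoint_family_on_def
  proof (intro ballI impI)
    fix k k' assume k: "k \<in> {..<n * r}" "k' \<in> {..<n * r}" "k \<noteq> k'"
    show "R k \<inter> R k' = {}"
    proof (cases "k div r = k' div r")
      case True
      then have "k mod r \<noteq> k' mod r" using k(3) by (metis div_mult_mod_eq)
      then show ?thesis using True E(3)[of "k div r"] dm k unfolding disjoint_family_on_def R_def by auto
    next
      case False
      have "R k \<subseteq> P (k div r)" "R k' \<subseteq> P (k' div r)" using E(4) dm k unfolding R_def by blast+
      then show ?thesis using Ps(4)[OF _ _ False] dm k by blast
    qed
  qed
  moreover have "(\<Union>k<n * r. R k) = space M"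
  proof -
    have "(\<Union>k<n * r. R k) = (\<Union>j<n. \<Union>k\<in>{j*r..<Suc j * r}. R k)"
    proof (intro equalityI subsetI)
      fix x assume "x \<in> (\<Union>k<n * r. R k)"
      then obtain k where k: "k < n * r" "x \<in> R k" by blast
      have "k < r + (k div r) * r" using dividend_less_div_times[OF r] by simp
      then have "k \<in> {(k div r) * r..<Suc (k div r) * r}"
        using div_times_less_eq_dividend[of k r] by simp
      then show "x \<in> (\<Union>j<n. \<Union>k\<in>{j*r..<Suc j * r}. R k)" using k dm by blast
    next
      fix x assume "x \<in> (\<Union>j<n. \<Union>k\<in>{j*r..<Suc j * r}. R k)"
      then obtain j k where jk: "j < n" "k < Suc j * r" "x \<in> R k" by auto
      then have "Suc j * r \<le> n * r" by (intro mult_le_mono1) simp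
      then show "x \<in> (\<Union>k<n * r. R k)" using jk by auto
    qed
    also have "\<dots> = (\<Union>j<n. P j)" using block E(4) by simp
    finally show ?thesis using Ps(3) by simp
  qed
  ultimately have "equipartition M (n * r) R"
    using E(1,2) dm by (auto simp: equipartition_def finite_partition_def R_def)
  moreover have "\<forall>j<n. P j = (\<Union>k\<in>{j*r..<Suc j * r}. R k)" using block E(4) by simp
  ultimately show ?thesis by blast
qed

text \<open>The cells are level intervals of length \<open>1 / n\<close> of a uniform coordinate.
  Sublevel sets are approximable, and approximability passes to complements and countable unions.
  Asking for approximation along all large \<open>n\<close> allows two sets to be treated by one
  partition even though these partitions do not refine each other.\<close>

lemma approximating_equipartitions:
  obtains P where "\<And>n. 0 < n \<Longrightarrow> equipartition M n (P n)"
    "\<And>A e. A \<in> sets M \<Longrightarrow> 0 < e \<Longrightarrow>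
       \<exists>n0. \<forall>n\<ge>n0. \<exists>I\<subseteq>{..<n}. dd A (\<Union>i\<in>I. P n i) \<le> e"
proof -
  obtain u A1 where u: "u \<in> borel_measurable M" "A1 \<in> sets M" "A1 \<subseteq> space M" "measure M (space M - A1) = 0"
    "inj_on u A1" "\<And>E. E \<in> sets M \<Longrightarrow> E \<subseteq> A1 \<Longrightarrow> u ` E \<in> sets borel"
    "\<And>E. E \<in> sets M \<Longrightarrow> E \<subseteq> A1 \<Longrightarrow> emeasure lborel (u ` E) = emeasure M E"
    "\<And>s. 0 \<le> s \<Longrightarrow> s \<le> measure M (space M) \<Longrightarrow> measure M {x\<in>space M. u x \<le> s} = s"
    "\<And>x. 0 \<le> u x" "\<And>x. u x \<le> measure M (space M)"
    by (rule uniform_coordinate[OF sets.top], rule that)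
  \<comment> \<open>Cells are open on the left, except that the first one also takes the points with
    \<open>u x = 0\<close>.\<close>
  define P where "P n i = {x\<in>space M. (i = 0 \<or> real i / real n < u x) \<and> u x \<le> real (Suc i) / real n}" for n i :: nat
  have u1: "u x \<le> 1" for x using u(10) by (simp add: prob_space)
  have us: "measure M {x\<in>space M. u x \<le> s} = s" if "0 \<le> s" "s \<le> 1" for s
    using u(8) that by (simp add: prob_space)
  note [measurable] = u(1)
  have P_sets [measurable]: "P n i \<in> sets M" for n i unfolding P_def by measurable
  have P_measure: "measure M (P n i) = 1 / n" if i: "i < n" for n i
  proof (cases "i = 0")
    case True
    then show ?thesis using us[of "1 / n"] i by (simp add: P_def)
  next
    case False
    have "P n i = {x\<in>space M. u x \<le> real (Suc i) / n} - {x\<in>space M. u x \<le> real i / n}"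
      using False by (auto simp: P_def not_le)
    moreover have "measure M ({x\<in>space M. u x \<le> real (Suc i) / n} - {x\<in>space M. u x \<le> real i / n}) =
        measure M {x\<in>space M. u x \<le> real (Suc i) / n} - measure M {x\<in>space M. u x \<le> real i / n}"
      by (rule finite_measure_Diff) (use i in \<open>auto simp: field_simps\<close>)
    moreover have "measure M {x\<in>space M. u x \<le> real (Suc i) / n} = real (Suc i) / n"
      by (rule us) (use i in auto)
    moreover have "measure M {x\<in>space M. u x \<le> real i / n} = real i / n"
      by (rule us) (use i in auto)
    ultimately show ?thesis by (simp add: diff_divide_distrib[symmetric])
  qed
  have P_disj: "P n i \<inter> P n j = {}" if "i < j" "0 < n" for n i j
  proof -
    have "real (Suc i) / n \<le> real j / n" using that by (intro divide_right_mono) auto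
    then show ?thesis using that by (auto simp: P_def)
  qed
  have P_cover: "\<exists>i<n. x \<in> P n i" if "x \<in> space M" "0 < n" for n x
  proof -
    define i where "i = (LEAST i. u x \<le> real (Suc i) / n)"
    have ex: "u x \<le> real (Suc (n - 1)) / n" using that u1[of x] by simp
    have "u x \<le> real (Suc i) / n" unfolding i_def using ex by (rule LeastI)
    moreover have "i \<le> n - 1" unfolding i_def using ex by (rule Least_le)
    moreover have "real i / n < u x" if "i \<noteq> 0"
    proof -
      have "\<not> u x \<le> real (Suc (i - 1)) / n"
        unfolding i_def by (rule not_less_Least) (use that in \<open>simp add: i_def\<close>)
      then show ?thesis using that by simp
    qed
    ultimately show ?thesis using that by (intro exI[of _ i]) (auto simp: P_def)
  qed
  have equi: "equipartition M n (P n)" if "0 < n" for n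
  proof -
    have "disjoint_family_on (P n) {..<n}"
      unfolding disjoint_family_on_def
    proof (intro ballI impI)
      fix i j :: nat assume "i \<noteq> j"
      then show "P n i \<inter> P n j = {}" using P_disj[of i j n] P_disj[of j i n] that by (cases "i < j") auto
    qed
    moreover have "(\<Union>i<n. P n i) = space M"
      using P_cover that by (auto simp: P_def)
    ultimately show ?thesis
      using P_sets P_measure that by (auto simp: equipartition_def finite_partition_def)
  qed
  define D where "D A \<longleftrightarrow> (\<forall>e>0. \<exists>n0. \<forall>n\<ge>n0. \<exists>I\<subseteq>{..<n}. dd A (\<Union>i\<in>I. P n i) \<le> e)" for A
  have UP: "(\<Union>i\<in>I. P n i) \<in> sets M" if "I \<subseteq> {..<n}" for I n
    by (rule sets.finite_UN) (use finite_subset[OF that] P_sets in auto)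
  have D_0: "D A" if DB: "D B" and "dd A B = 0" "A \<in> sets M" "B \<in> sets M" for A B
    unfolding D_def
  proof (intro allI impI)
    fix e :: real assume "0 < e"
    then obtain n0 where n0: "\<And>n. n \<ge> n0 \<Longrightarrow> \<exists>I\<subseteq>{..<n}. dd B (\<Union>i\<in>I. P n i) \<le> e"
      using DB unfolding D_def by blast
    have "\<exists>I\<subseteq>{..<n}. dd A (\<Union>i\<in>I. P n i) \<le> e" if n: "n \<ge> n0" for n
    proof -
      obtain I where I: "I \<subseteq> {..<n}" "dd B (\<Union>i\<in>I. P n i) \<le> e" using n0[OF n] by blast
      then have "dd A (\<Union>i\<in>I. P n i) \<le> e"
        using dd_triangle[OF \<open>A \<in> sets M\<close> \<open>B \<in> sets M\<close> UP[OF I(1)]] \<open>dd A B = 0\<close> by simp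
      then show ?thesis using I by blast
    qed
    then show "\<exists>n0. \<forall>n\<ge>n0. \<exists>I\<subseteq>{..<n}. dd A (\<Union>i\<in>I. P n i) \<le> e" by blast
  qed
  have D_Un: "D (A \<union> B)" if AB: "D A" "D B" "A \<in> sets M" "B \<in> sets M" for A B
    unfolding D_def
  proof (intro allI impI)
    fix e :: real assume "0 < e"
    then have e2: "0 < e / 2" by simp
    obtain n1 where n1: "\<And>n. n \<ge> n1 \<Longrightarrow> \<exists>I\<subseteq>{..<n}. dd A (\<Union>i\<in>I. P n i) \<le> e / 2"
      using AB(1) e2 unfolding D_def by blast
    obtain n2 where n2: "\<And>n. n \<ge> n2 \<Longrightarrow> \<exists>I\<subseteq>{..<n}. dd B (\<Union>i\<in>I. P n i) \<le> e / 2"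
      using AB(2) e2 unfolding D_def by blast
    have "\<exists>I\<subseteq>{..<n}. dd (A \<union> B) (\<Union>i\<in>I. P n i) \<le> e" if n: "n \<ge> max n1 n2" for n
    proof -
      obtain I J where I: "I \<subseteq> {..<n}" "dd A (\<Union>i\<in>I. P n i) \<le> e / 2"
        and J: "J \<subseteq> {..<n}" "dd B (\<Union>i\<in>J. P n i) \<le> e / 2"
        using n1[of n] n2[of n] n by auto
      have "dd (A \<union> B) (\<Union>i\<in>I \<union> J. P n i) \<le>
          measure M (((A - (\<Union>i\<in>I. P n i)) \<union> ((\<Union>i\<in>I. P n i) - A)) \<union> ((B - (\<Union>i\<in>J. P n i)) \<union> ((\<Union>i\<in>J. P n i) - B)))"
        unfolding set_dist_def by (rule finite_measure_mono) (use AB UP I J in auto)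
      also have "\<dots> \<le> dd A (\<Union>i\<in>I. P n i) + dd B (\<Union>i\<in>J. P n i)"
        unfolding set_dist_def by (rule measure_Un_le) (use AB UP I J in auto)
      finally show ?thesis using I J by (intro exI[of _ "I \<union> J"]) auto
    qed
    then show "\<exists>n0. \<forall>n\<ge>n0. \<exists>I\<subseteq>{..<n}. dd (A \<union> B) (\<Union>i\<in>I. P n i) \<le> e" by blast
  qed
  have D_empty: "D {}" unfolding D_def by (auto intro!: exI[of _ 0] exI[of _ "{}"])
  have D_compl: "D (space M - A)" if A: "D A" "A \<in> sets M" for A
    unfolding D_def
  proof (intro allI impI)
    fix e :: real assume "0 < e"
    then obtain n0 where n0: "\<And>n. n \<ge> n0 \<Longrightarrow> \<exists>I\<subseteq>{..<n}. dd A (\<Union>i\<in>I. P n i) \<le> e"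
      using A(1) unfolding D_def by blast
    have "\<exists>I\<subseteq>{..<n}. dd (space M - A) (\<Union>i\<in>I. P n i) \<le> e" if n: "n \<ge> Suc n0" for n
    proof -
      obtain I where I: "I \<subseteq> {..<n}" "dd A (\<Union>i\<in>I. P n i) \<le> e" using n0[of n] n by auto
      note Ps = finite_partitionD[OF equipartitionD(1)[OF equi[of n]]]
      have "(\<Union>i\<in>{..<n} - I. P n i) = space M - (\<Union>i\<in>I. P n i)"
        using Ps(3,4) I(1) n by fastforce
      then have "dd (space M - A) (\<Union>i\<in>{..<n} - I. P n i) \<le> dd A (\<Union>i\<in>I. P n i)"
        using dd_Diff_right[OF A(2) UP[OF I(1)], of "space M"] by simp
      then show ?thesis using I by (intro exI[of _ "{..<n} - I"]) auto
    qed
    then show "\<exists>n0. \<forall>n\<ge>n0. \<exists>I\<subseteq>{..<n}. dd (space M - A) (\<Union>i\<in>I. P n i) \<le> e" by blast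
  qed
  have D_UN: "D (\<Union>k. A k)" if A: "\<And>k. D (A k)" "\<And>k. A k \<in> sets M" for A :: "nat \<Rightarrow> 'a set"
    unfolding D_def
  proof (intro allI impI)
    fix e :: real assume e: "0 < e"
    define F where "F K = (\<Union>k<K. A k)" for K
    have Fs: "F K \<in> sets M" for K using A by (auto simp: F_def)
    have DF: "D (F K)" for K
    proof (induction K)
      case (Suc K)
      then show ?case using D_Un[OF Suc A(1)[of K] Fs A(2)] by (simp add: F_def lessThan_Suc Un_commute)
    qed (simp add: F_def D_empty)
    have "(\<lambda>K. measure M (F K)) \<longlonglongrightarrow> measure M (\<Union>K. F K)"
      by (rule finite_Lim_measure_incseq) (use Fs in \<open>auto simp: incseq_def F_def intro: less_le_trans\<close>)
    moreover have FU: "(\<Union>K. F K) = (\<Union>k. A k)" by (auto simp: F_def)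
    ultimately have "eventually (\<lambda>K. measure M (\<Union>k. A k) - e / 2 < measure M (F K)) sequentially"
      using order_tendstoD(1)[of "\<lambda>K. measure M (F K)" "measure M (\<Union>k. A k)" sequentially "measure M (\<Union>k. A k) - e / 2"] e
      by simp
    then obtain K where K: "measure M (\<Union>k. A k) - e / 2 < measure M (F K)"
      by (auto simp: eventually_sequentially)
    have "F K \<subseteq> (\<Union>k. A k)" by (auto simp: F_def)
    then have "((\<Union>k. A k) - F K) \<union> (F K - (\<Union>k. A k)) = (\<Union>k. A k) - F K" by auto
    then have close: "dd (\<Union>k. A k) (F K) \<le> e / 2"
      using K A(2) Fs[of K] \<open>F K \<subseteq> (\<Union>k. A k)\<close> finite_measure_Diff[of "\<Union>k. A k" "F K"]
      by (simp add: set_dist_def)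
    obtain n0 where n0: "\<And>n. n \<ge> n0 \<Longrightarrow> \<exists>I\<subseteq>{..<n}. dd (F K) (\<Union>i\<in>I. P n i) \<le> e / 2"
      using DF[of K] e unfolding D_def by (meson half_gt_zero)
    have "\<exists>I\<subseteq>{..<n}. dd (\<Union>k. A k) (\<Union>i\<in>I. P n i) \<le> e" if n: "n \<ge> n0" for n
    proof -
      obtain I where I: "I \<subseteq> {..<n}" "dd (F K) (\<Union>i\<in>I. P n i) \<le> e / 2" using n0[OF n] by blast
      have "dd (\<Union>k. A k) (\<Union>i\<in>I. P n i) \<le> dd (\<Union>k. A k) (F K) + dd (F K) (\<Union>i\<in>I. P n i)"
        by (rule dd_triangle) (use A Fs UP I in auto)
      then show ?thesis using I close by (intro exI[of _ I]) auto
    qed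
    then show "\<exists>n0. \<forall>n\<ge>n0. \<exists>I\<subseteq>{..<n}. dd (\<Union>k. A k) (\<Union>i\<in>I. P n i) \<le> e" by blast
  qed
  have D_atMost: "D {x\<in>space M. u x \<le> s}" for s
    unfolding D_def
  proof (intro allI impI)
    fix e :: real assume e: "0 < e"
    obtain n0 :: nat where n0: "1 / e < n0" using reals_Archimedean2 by blast
    have "\<exists>I\<subseteq>{..<n}. dd {x\<in>space M. u x \<le> s} (\<Union>i\<in>I. P n i) \<le> e" if n: "n \<ge> n0" for n
    proof -
      have "0 < 1 / e" using e by simp
      then have npos: "0 < n" "0 < n0" using n n0 by linarith+
      define I where "I = {i\<in>{..<n}. real (Suc i) / n \<le> s}"
      \<comment> \<open>The only cell that the level \<open>s\<close> can cut, so the error is at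
        most \<open>1 / n\<close>.\<close>
      define j where "j = nat \<lfloor>n * s\<rfloor>"
      have I: "I \<subseteq> {..<n}" by (auto simp: I_def)
      have sub: "(\<Union>i\<in>I. P n i) \<subseteq> {x\<in>space M. u x \<le> s}" by (auto simp: I_def P_def)
      have rest: "x \<in> P n j \<and> j < n" if x: "x \<in> {x\<in>space M. u x \<le> s}" "x \<notin> (\<Union>i\<in>I. P n i)" for x
      proof -
        obtain i where i: "i < n" "x \<in> P n i" using P_cover[of x n] x npos by auto
        then have "i \<notin> I" using x by blast
        then have "s < real (Suc i) / n" using i by (simp add: I_def not_le)
        moreover have "real i / n \<le> s"
          using i(2) x u(9)[of x] by (auto simp: P_def)
        ultimately have "real i \<le> n * s" "n * s < real i + 1" using npos by (auto simp: field_simps)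
        then have "\<lfloor>n * s\<rfloor> = int i" by (intro floor_unique) auto
        then have "j = i" by (simp add: j_def)
        then show ?thesis using i by simp
      qed
      have "dd {x\<in>space M. u x \<le> s} (\<Union>i\<in>I. P n i) \<le> 1 / n"
      proof (cases "{x\<in>space M. u x \<le> s} - (\<Union>i\<in>I. P n i) = {}")
        case True
        then have "{x\<in>space M. u x \<le> s} = (\<Union>i\<in>I. P n i)" using sub by blast
        then show ?thesis by simp
      next
        case False
        then have "j < n" using rest by blast
        have "dd {x\<in>space M. u x \<le> s} (\<Union>i\<in>I. P n i) \<le> measure M (P n j)"
          unfolding set_dist_def by (rule finite_measure_mono) (use rest sub in auto)
        then show ?thesis using P_measure[OF \<open>j < n\<close>] by simp
      qed
      also have "1 / n \<le> e"
      proof -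
        have "1 / e \<le> n" using n n0 by linarith
        then show ?thesis using e npos by (simp add: field_simps)
      qed
      finally show ?thesis using I by blast
    qed
    then show "\<exists>n0. \<forall>n\<ge>n0. \<exists>I\<subseteq>{..<n}. dd {x\<in>space M. u x \<le> s} (\<Union>i\<in>I. P n i) \<le> e" by blast
  qed
  have D_borel: "D {x\<in>space M. u x \<in> B}" if "B \<in> sets borel" for B
  proof -
    have meas: "{x\<in>space M. u x \<in> B} \<in> sets M" if "B \<in> sets borel" for B using that by measurable
    have "B \<in> sigma_sets UNIV (range atMost)" using that by (simp add: borel_eq_atMost)
    then show ?thesis
    proof induction
      case (Basic B)
      then show ?case using D_atMost by auto
    next
      case Empty
      then show ?case using D_empty by simp
    next
      case (Compl B)
      then have "B \<in> sets borel" by (simp add: borel_eq_atMost)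
      moreover have "{x\<in>space M. u x \<in> UNIV - B} = space M - {x\<in>space M. u x \<in> B}" by auto
      ultimately show ?case using D_compl[OF Compl.IH meas] by simp
    next
      case (Union B)
      then have "B k \<in> sets borel" for k by (simp add: borel_eq_atMost)
      then have "D (\<Union>k. {x\<in>space M. u x \<in> B k})" by (intro D_UN Union.IH meas)
      moreover have "(\<Union>k. {x\<in>space M. u x \<in> B k}) = {x\<in>space M. u x \<in> \<Union> (range B)}" by auto
      ultimately show ?case by simp
    qed
  qed
  \<comment> \<open>Injectivity of \<open>u\<close> on \<open>A1\<close> recovers \<open>A\<close>
    from the image of \<open>A \<inter> A1\<close>, up to the null complement of
    \<open>A1\<close>.\<close>
  have "D A" if A: "A \<in> sets M" for A
  proof (rule D_0)
    have uB: "u ` (A \<inter> A1) \<in> sets borel" by (rule u(6)) (use A u(2) in auto)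
    then show "D {x\<in>space M. u x \<in> u ` (A \<inter> A1)}" by (rule D_borel)
    show meas: "{x\<in>space M. u x \<in> u ` (A \<inter> A1)} \<in> sets M" using uB by measurable
    have "(A - {x\<in>space M. u x \<in> u ` (A \<inter> A1)}) \<union> ({x\<in>space M. u x \<in> u ` (A \<inter> A1)} - A) \<subseteq> space M - A1"
      using sets.sets_into_space[OF A] u(5) by (auto dest: inj_onD)
    then have "dd A {x\<in>space M. u x \<in> u ` (A \<inter> A1)} \<le> measure M (space M - A1)"
      unfolding set_dist_def by (intro finite_measure_mono) (use u(2) in auto)
    then show "dd A {x\<in>space M. u x \<in> u ` (A \<inter> A1)} = 0" using u(4) by (intro antisym) auto
  qed (rule A)
  then show thesis using that[of P] equi unfolding D_def by blast
qed

end

section \<open>The weak topology\<close>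

definition nrm2 :: "'a measure \<Rightarrow> ('a \<Rightarrow> complex) \<Rightarrow> real" where
  "nrm2 M f = sqrt (LINT x|M. (cmod (f x))\<^sup>2)"

lemma sq_integrableD:
  assumes "f \<in> sq_integrable M"
  shows "f \<in> borel_measurable M" "integrable M (\<lambda>x. (cmod (f x))\<^sup>2)"
  using assms by (auto simp: sq_integrable_def)

lemma sq_integrable_add:
  assumes f: "f \<in> sq_integrable M" and g: "g \<in> sq_integrable M"
  shows "(\<lambda>x. f x + g x) \<in> sq_integrable M"
proof -
  note [measurable] = sq_integrableD(1)[OF f] sq_integrableD(1)[OF g]
  have "integrable M (\<lambda>x. (cmod (f x + g x))\<^sup>2)"
  proof (rule Bochner_Integration.integrable_bound)
    show "integrable M (\<lambda>x. 2 * (cmod (f x))\<^sup>2 + 2 * (cmod (g x))\<^sup>2)"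
      using sq_integrableD[OF f] sq_integrableD[OF g] by simp
    have "(cmod (f x + g x))\<^sup>2 \<le> 2 * (cmod (f x))\<^sup>2 + 2 * (cmod (g x))\<^sup>2" for x
    proof -
      have "(cmod (f x + g x))\<^sup>2 \<le> (cmod (f x) + cmod (g x))\<^sup>2"
        by (rule power_mono[OF norm_triangle_ineq]) simp
      also have "\<dots> \<le> 2 * (cmod (f x))\<^sup>2 + 2 * (cmod (g x))\<^sup>2"
        using sum_squares_bound[of "cmod (f x)" "cmod (g x)"] by (simp add: power2_sum)
      finally show ?thesis .
    qed
    then show "AE x in M. norm ((cmod (f x + g x))\<^sup>2) \<le> norm (2 * (cmod (f x))\<^sup>2 + 2 * (cmod (g x))\<^sup>2)"
      by simp
  qed simp
  then show ?thesis by (simp add: sq_integrable_def)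
qed

lemma sq_integrable_scale:
  assumes f: "f \<in> sq_integrable M"
  shows "(\<lambda>x. c * f x) \<in> sq_integrable M"
proof -
  note [measurable] = sq_integrableD(1)[OF f]
  show ?thesis using sq_integrableD(2)[OF f] by (simp add: sq_integrable_def norm_mult power_mult_distrib)
qed

lemma sq_integrable_diff:
  assumes "f \<in> sq_integrable M" "g \<in> sq_integrable M"
  shows "(\<lambda>x. f x - g x) \<in> sq_integrable M"
  using sq_integrable_add[OF assms(1) sq_integrable_scale[OF assms(2), of "-1"]] by simp

lemma sq_integrable_comp:
  assumes f: "f \<in> sq_integrable M" and T: "T \<in> mp_transformations M"
  shows "(\<lambda>x. f (T x)) \<in> sq_integrable M" "nrm2 M (\<lambda>x. f (T x)) = nrm2 M f"
proof -
  note T = mp_transformationsD[OF T]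
  note [measurable] = sq_integrableD(1)[OF f] T(1)
  have "integrable (distr M M T) (\<lambda>x. (cmod (f x))\<^sup>2)" using sq_integrableD(2)[OF f] T(3) by simp
  then have "integrable M (\<lambda>x. (cmod (f (T x)))\<^sup>2)" by (subst (asm) integrable_distr_eq) auto
  then show "(\<lambda>x. f (T x)) \<in> sq_integrable M" by (simp add: sq_integrable_def)
  have "(LINT x|M. (cmod (f (T x)))\<^sup>2) = (LINT x|distr M M T. (cmod (f x))\<^sup>2)"
    by (subst integral_distr) auto
  then show "nrm2 M (\<lambda>x. f (T x)) = nrm2 M f" by (simp add: nrm2_def T(3))
qed

lemma nrm2_nonneg: "0 \<le> nrm2 M f"
  by (simp add: nrm2_def)

lemma nrm2_square: "(nrm2 M f)\<^sup>2 = (LINT x|M. (cmod (f x))\<^sup>2)"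
  by (simp add: nrm2_def)

text \<open>Pointwise, (p + q)^2 is at most (a + b)/a * p^2 + (a + b)/b * q^2. With \<open>a\<close>
  and \<open>b\<close> slightly above the two norms the integral of the right side is at most (a +
  b)^2. The surplus keeps the denominators positive when a norm vanishes.\<close>

lemma nrm2_triangle:
  assumes f: "f \<in> sq_integrable M" and g: "g \<in> sq_integrable M"
  shows "nrm2 M (\<lambda>x. f x + g x) \<le> nrm2 M f + nrm2 M g"
proof (rule field_le_epsilon)
  fix e :: real assume e: "0 < e"
  define a where "a = nrm2 M f + e / 2"
  define b where "b = nrm2 M g + e / 2"
  have ab: "0 < a" "0 < b" "nrm2 M f \<le> a" "nrm2 M g \<le> b"
    using e nrm2_nonneg[of M f] nrm2_nonneg[of M g] by (auto simp: a_def b_def)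
  have pt: "(cmod (f x + g x))\<^sup>2 \<le> (a + b) / a * (cmod (f x))\<^sup>2 + (a + b) / b * (cmod (g x))\<^sup>2" for x
  proof -
    let ?p = "cmod (f x)" and ?q = "cmod (g x)"
    have "(cmod (f x + g x))\<^sup>2 \<le> (?p + ?q)\<^sup>2"
      by (rule power_mono[OF norm_triangle_ineq]) simp
    also have "\<dots> \<le> (a + b) / a * ?p\<^sup>2 + (a + b) / b * ?q\<^sup>2"
    proof -
      have "(a + b) / a * ?p\<^sup>2 + (a + b) / b * ?q\<^sup>2 - (?p + ?q)\<^sup>2 = (b * ?p - a * ?q)\<^sup>2 / (a * b)"
        using ab by (simp add: field_simps power2_eq_square)
      also have "0 \<le> (b * ?p - a * ?q)\<^sup>2 / (a * b)" using ab by simp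
      finally show ?thesis by simp
    qed
    finally show ?thesis .
  qed
  have "(nrm2 M (\<lambda>x. f x + g x))\<^sup>2 \<le>
      (LINT x|M. (a + b) / a * (cmod (f x))\<^sup>2 + (a + b) / b * (cmod (g x))\<^sup>2)"
    unfolding nrm2_square
    by (rule integral_mono)
      (use pt sq_integrableD(2)[OF f] sq_integrableD(2)[OF g] sq_integrableD(2)[OF sq_integrable_add[OF f g]] in auto)
  also have "\<dots> = (a + b) / a * (nrm2 M f)\<^sup>2 + (a + b) / b * (nrm2 M g)\<^sup>2"
    unfolding nrm2_square using sq_integrableD(2)[OF f] sq_integrableD(2)[OF g] by simp
  also have "\<dots> \<le> (a + b) / a * a\<^sup>2 + (a + b) / b * b\<^sup>2"
    using ab nrm2_nonneg[of M f] nrm2_nonneg[of M g]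
    by (intro add_mono mult_left_mono power_mono) auto
  also have "\<dots> = (a + b)\<^sup>2" using ab by (simp add: field_simps power2_eq_square)
  finally have "nrm2 M (\<lambda>x. f x + g x) \<le> a + b"
    by (rule power2_le_imp_le) (use ab in auto)
  then show "nrm2 M (\<lambda>x. f x + g x) \<le> nrm2 M f + nrm2 M g + e" by (simp add: a_def b_def)
qed

lemma nrm2_diff_triangle:
  assumes "f \<in> sq_integrable M" "g \<in> sq_integrable M" "h \<in> sq_integrable M"
  shows "nrm2 M (\<lambda>x. f x - h x) \<le> nrm2 M (\<lambda>x. f x - g x) + nrm2 M (\<lambda>x. g x - h x)"
  using nrm2_triangle[OF sq_integrable_diff[OF assms(1,2)] sq_integrable_diff[OF assms(2,3)]] by simp

lemma nrm2_diff_commute: "nrm2 M (\<lambda>x. f x - g x) = nrm2 M (\<lambda>x. g x - f x)"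
  by (simp add: nrm2_def norm_minus_commute)

lemma L2_rep:
  assumes "F \<in> L2 M"
  shows "rep F \<in> sq_integrable M" "L2_class M (rep F) = F"
  using rep_quotient[OF assms[unfolded L2_def]] unfolding L2_class_def by auto

lemma L2_class_in: "f \<in> sq_integrable M \<Longrightarrow> L2_class M f \<in> L2 M"
  unfolding L2_def L2_class_def by (rule quotientI)

lemma AE_rep_L2_class: "f \<in> sq_integrable M \<Longrightarrow> AE x in M. rep (L2_class M f) x = f x"
  unfolding L2_class_def by (rule AE_rep_class)

lemma L2_class_eqI:
  "f \<in> sq_integrable M \<Longrightarrow> g \<in> sq_integrable M \<Longrightarrow> AE x in M. f x = g x \<Longrightarrow> L2_class M f = L2_class M g"
  unfolding L2_class_def by (simp add: ae_rel_class_eq_iff)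

lemma L2_dist_class:
  assumes f: "f \<in> sq_integrable M" and g: "g \<in> sq_integrable M"
  shows "L2_dist M (L2_class M f) (L2_class M g) = nrm2 M (\<lambda>x. f x - g x)"
proof -
  note m = sq_integrableD(1)[OF L2_rep(1)[OF L2_class_in[OF f]]]
    sq_integrableD(1)[OF L2_rep(1)[OF L2_class_in[OF g]]] sq_integrableD(1)[OF f] sq_integrableD(1)[OF g]
  note [measurable] = m
  have "(LINT x|M. (cmod (rep (L2_class M f) x - rep (L2_class M g) x))\<^sup>2) = (LINT x|M. (cmod (f x - g x))\<^sup>2)"
  proof (rule integral_cong_AE)
    show "AE x in M. (cmod (rep (L2_class M f) x - rep (L2_class M g) x))\<^sup>2 = (cmod (f x - g x))\<^sup>2"
      using AE_rep_L2_class[OF f] AE_rep_L2_class[OF g] by eventually_elim simp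
  qed measurable
  then show ?thesis by (simp add: L2_dist_def nrm2_def)
qed

lemma L2_dist_rep: "L2_dist M F H = nrm2 M (\<lambda>x. rep F x - rep H x)"
  by (simp add: L2_dist_def nrm2_def)

lemma L2_metric: "Metric_space (L2 M) (L2_dist M)"
proof
  show "0 \<le> L2_dist M F H" for F H by (simp add: L2_dist_rep nrm2_nonneg)
  show "L2_dist M F H = L2_dist M H F" for F H unfolding L2_dist_rep by (rule nrm2_diff_commute)
  show "L2_dist M F H = 0 \<longleftrightarrow> F = H" if FH: "F \<in> L2 M" "H \<in> L2 M" for F H
  proof
    assume "L2_dist M F H = 0"
    then have "(LINT x|M. (cmod (rep F x - rep H x))\<^sup>2) = 0" by (simp add: L2_dist_def)
    then have "AE x in M. (cmod (rep F x - rep H x))\<^sup>2 = 0"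
      using sq_integrableD(2)[OF sq_integrable_diff[OF L2_rep(1)[OF FH(1)] L2_rep(1)[OF FH(2)]]]
      by (subst (asm) integral_nonneg_eq_0_iff_AE) auto
    then have "AE x in M. rep F x = rep H x" by eventually_elim simp
    then show "F = H" using L2_class_eqI L2_rep[OF FH(1)] L2_rep[OF FH(2)] by metis
  qed (simp add: L2_dist_def)
  show "L2_dist M F K \<le> L2_dist M F H + L2_dist M H K" if "F \<in> L2 M" "H \<in> L2 M" "K \<in> L2 M" for F H K
    unfolding L2_dist_rep by (rule nrm2_diff_triangle) (use that L2_rep(1) in auto)
qed

text \<open>The Koopman operator of \<open>g\<close> is composition with the inverse of a
  representative. Allowing any transformation here separates the operator from the choice of
  representatives of group elements.\<close>

definition composition :: "'a measure \<Rightarrow> ('a \<Rightarrow> 'a) \<Rightarrow> ('a \<Rightarrow> complex) set \<Rightarrow> ('a \<Rightarrow> complex) set" where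
  "composition M T = (\<lambda>F\<in>L2 M. L2_class M (\<lambda>x. rep F (T x)))"

lemma koopman_composition: "koopman M g = composition M (inv_into (space M) (rep g))"
  by (simp add: koopman_def composition_def)

lemma composition_class:
  assumes T: "T \<in> mp_transformations M" and f: "f \<in> sq_integrable M"
  shows "composition M T (L2_class M f) = L2_class M (\<lambda>x. f (T x))"
proof -
  have "AE x in M. rep (L2_class M f) (T x) = f (T x)"
    by (rule AE_mp_transformations[OF T AE_rep_L2_class[OF f]])
  then have "L2_class M (\<lambda>x. rep (L2_class M f) (T x)) = L2_class M (\<lambda>x. f (T x))"
    by (rule L2_class_eqI[OF sq_integrable_comp(1)[OF L2_rep(1)[OF L2_class_in[OF f]] T] sq_integrable_comp(1)[OF f T]])
  then show ?thesis using L2_class_in[OF f] by (simp add: composition_def)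
qed

lemma L2_cases:
  assumes "F \<in> L2 M" obtains f where "f \<in> sq_integrable M" "F = L2_class M f"
  using L2_rep[OF assms] by metis

lemma composition_in: "T \<in> mp_transformations M \<Longrightarrow> F \<in> L2 M \<Longrightarrow> composition M T F \<in> L2 M"
  by (simp add: composition_def L2_class_in sq_integrable_comp(1) L2_rep(1))

lemma composition_composition:
  assumes "S \<in> mp_transformations M" "T \<in> mp_transformations M" "\<And>x. x \<in> space M \<Longrightarrow> T (S x) = x" "F \<in> L2 M"
  shows "composition M S (composition M T F) = F"
proof -
  obtain f where f: "f \<in> sq_integrable M" "F = L2_class M f" using L2_cases[OF assms(4)] by metis
  have "composition M S (composition M T F) = L2_class M (\<lambda>x. f (T (S x)))"
    using f assms by (simp add: composition_class sq_integrable_comp(1))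
  also have "\<dots> = L2_class M f"
  proof (rule L2_class_eqI)
    show "(\<lambda>x. f (T (S x))) \<in> sq_integrable M"
      using sq_integrable_comp(1)[OF sq_integrable_comp(1)[OF f(1) assms(2)] assms(1)] .
    show "AE x in M. f (T (S x)) = f x" using assms(3) by (auto intro: AE_I2)
  qed (rule f)
  finally show ?thesis using f by simp
qed

lemma L2_add_class:
  assumes "f \<in> sq_integrable M" "g \<in> sq_integrable M"
  shows "L2_add M (L2_class M f) (L2_class M g) = L2_class M (\<lambda>x. f x + g x)"
  unfolding L2_add_def
proof (rule L2_class_eqI)
  show "AE x in M. rep (L2_class M f) x + rep (L2_class M g) x = f x + g x"
    using AE_rep_L2_class[OF assms(1)] AE_rep_L2_class[OF assms(2)] by eventually_elim simp
qed (simp_all add: assms sq_integrable_add L2_rep(1) L2_class_in)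

lemma L2_scale_class:
  assumes "f \<in> sq_integrable M"
  shows "L2_scale M c (L2_class M f) = L2_class M (\<lambda>x. c * f x)"
  unfolding L2_scale_def
proof (rule L2_class_eqI)
  show "AE x in M. c * rep (L2_class M f) x = c * f x"
    using AE_rep_L2_class[OF assms(1)] by eventually_elim simp
qed (simp_all add: assms sq_integrable_scale L2_rep(1) L2_class_in)

lemma L2_inner_class:
  assumes "f \<in> sq_integrable M" "g \<in> sq_integrable M"
  shows "L2_inner M (L2_class M f) (L2_class M g) = (LINT x|M. f x * cnj (g x))"
  unfolding L2_inner_def
proof (rule integral_cong_AE)
  note [measurable] = sq_integrableD(1)[OF assms(1)] sq_integrableD(1)[OF assms(2)]
    sq_integrableD(1)[OF L2_rep(1)[OF L2_class_in[OF assms(1)]]]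
    sq_integrableD(1)[OF L2_rep(1)[OF L2_class_in[OF assms(2)]]]
  show "AE x in M. rep (L2_class M f) x * cnj (rep (L2_class M g) x) = f x * cnj (g x)"
    using AE_rep_L2_class[OF assms(1)] AE_rep_L2_class[OF assms(2)] by eventually_elim simp
  have cnj: "cnj \<in> borel_measurable borel" by (intro borel_measurable_continuous_onI continuous_intros)
  show "(\<lambda>x. rep (L2_class M f) x * cnj (rep (L2_class M g) x)) \<in> borel_measurable M"
    by (intro borel_measurable_times measurable_compose[OF _ cnj]) measurable
  show "(\<lambda>x. f x * cnj (g x)) \<in> borel_measurable M"
    by (intro borel_measurable_times measurable_compose[OF _ cnj]) measurable
qed

lemma composition_unitary:
  assumes T: "T \<in> mp_transformations M"
  shows "composition M T \<in> unitary_operators M"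
  unfolding unitary_operators_def
proof (intro CollectI conjI ballI allI)
  note Ts = mp_transformationsD[OF T] and S = mp_transformations_inv(1)[OF T]
  show "composition M T \<in> extensional (L2 M)" by (simp add: composition_def)
  show "bij_betw (composition M T) (L2 M) (L2 M)"
  proof (rule bij_betw_byWitness[of _ "composition M (inv_into (space M) T)"])
    show "\<forall>F\<in>L2 M. composition M (inv_into (space M) T) (composition M T F) = F"
      using composition_composition[OF S T] Ts by simp
    show "\<forall>F\<in>L2 M. composition M T (composition M (inv_into (space M) T) F) = F"
      using composition_composition[OF T S] Ts by simp
  qed (use composition_in T S in auto)
  fix F assume "F \<in> L2 M"
  then obtain f where f: "f \<in> sq_integrable M" "F = L2_class M f" by (rule L2_cases)
  show "composition M T (L2_scale M c F) = L2_scale M c (composition M T F)" for c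
    using f T by (simp add: L2_scale_class composition_class sq_integrable_scale sq_integrable_comp)
  fix H assume "H \<in> L2 M"
  then obtain h where h: "h \<in> sq_integrable M" "H = L2_class M h" by (rule L2_cases)
  show "composition M T (L2_add M F H) = L2_add M (composition M T F) (composition M T H)"
    using f h T by (simp add: L2_add_class composition_class sq_integrable_add sq_integrable_comp)
  have "(LINT x|M. f (T x) * cnj (h (T x))) = (LINT x|distr M M T. f x * cnj (h x))"
  proof (rule integral_distr[symmetric])
    have cnj: "cnj \<in> borel_measurable borel" by (intro borel_measurable_continuous_onI continuous_intros)
    show "(\<lambda>x. f x * cnj (h x)) \<in> borel_measurable M"
      by (intro borel_measurable_times measurable_compose[OF _ cnj] sq_integrableD f h)
  qed (rule Ts)
  then show "L2_inner M (composition M T F) (composition M T H) = L2_inner M F H"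
    using f h T by (simp add: composition_class L2_inner_class sq_integrable_comp Ts(3))
qed

lemma koopman_unitary: "g \<in> carrier (Aut M) \<Longrightarrow> koopman M g \<in> unitary_operators M"
  unfolding koopman_composition
  by (intro composition_unitary mp_transformations_inv(1) rep_Aut(1))

lemma topspace_weak: "topspace (weak_topology M) = carrier (Aut M)"
proof -
  have "unitary_operators M \<subseteq> topspace (product_topology (\<lambda>_. L2_topology M) (L2 M))"
    by (auto simp: unitary_operators_def L2_topology_def Metric_space.topspace_mtopology[OF L2_metric]
        PiE_def bij_betw_def)
  then have "topspace (strong_operator_topology M) = unitary_operators M"
    by (auto simp: strong_operator_topology_def)
  then show ?thesis
    using koopman_unitary by (auto simp: weak_topology_def topspace_pullback_topology)
qed

lemma openin_weak_ball:
  assumes g: "g \<in> carrier (Aut M)" and F: "F \<in> L2 M"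
  shows "openin (weak_topology M) {h\<in>carrier (Aut M). L2_dist M (koopman M g F) (koopman M h F) < e}"
proof -
  interpret Metric_space "L2 M" "L2_dist M" by (rule L2_metric)
  have in_L2: "koopman M h F \<in> L2 M" if "h \<in> carrier (Aut M)" for h
    using koopman_unitary[OF that] F by (auto simp: unitary_operators_def bij_betw_def)
  have "continuous_map (product_topology (\<lambda>_. L2_topology M) (L2 M)) (L2_topology M) (\<lambda>u. u F)"
    using F by (rule continuous_map_product_projection)
  then have "continuous_map (strong_operator_topology M) (L2_topology M) (\<lambda>u. u F)"
    unfolding strong_operator_topology_def by (rule continuous_map_from_subtopology)
  then have "continuous_map (weak_topology M) (L2_topology M) ((\<lambda>u. u F) \<circ> koopman M)"
    unfolding weak_topology_def by (rule continuous_map_pullback)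
  then have "openin (weak_topology M) {h\<in>topspace (weak_topology M). ((\<lambda>u. u F) \<circ> koopman M) h \<in> mball (koopman M g F) e}"
    by (rule openin_continuous_map_preimage) (simp add: L2_topology_def)
  moreover have "{h\<in>topspace (weak_topology M). ((\<lambda>u. u F) \<circ> koopman M) h \<in> mball (koopman M g F) e} =
      {h\<in>carrier (Aut M). L2_dist M (koopman M g F) (koopman M h F) < e}"
    using in_L2 g by (auto simp: topspace_weak)
  ultimately show ?thesis by simp
qed

text \<open>A basic open set of the product topology restricts finitely many coordinates, and the
  smallest of the radii found there serves as \<open>e\<close>.\<close>

lemma openin_weak_imp_L2:
  assumes U: "openin (weak_topology M) U" and g: "g \<in> U"
  shows "\<exists>J e. finite J \<and> J \<subseteq> L2 M \<and> 0 < e \<and>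
     (\<forall>h\<in>carrier (Aut M). (\<forall>F\<in>J. L2_dist M (koopman M g F) (koopman M h F) < e) \<longrightarrow> h \<in> U)"
proof -
  interpret Metric_space "L2 M" "L2_dist M" by (rule L2_metric)
  obtain V where V: "openin (product_topology (\<lambda>_. L2_topology M) (L2 M)) V"
      "U = koopman M -` (V \<inter> unitary_operators M) \<inter> carrier (Aut M)"
    using U unfolding weak_topology_def strong_operator_topology_def openin_pullback_topology openin_subtopology
    by blast
  have in_L2: "koopman M h F \<in> L2 M" if "h \<in> carrier (Aut M)" "F \<in> L2 M" for h F
    using koopman_unitary[OF that(1)] that(2) by (auto simp: unitary_operators_def bij_betw_def)
  have top: "topspace (L2_topology M) = L2 M" by (simp add: L2_topology_def)
  have gc: "g \<in> carrier (Aut M)" using g V by auto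
  obtain W where W: "finite {F\<in>L2 M. W F \<noteq> L2 M}" "\<And>F. F \<in> L2 M \<Longrightarrow> openin (L2_topology M) (W F)"
      "koopman M g \<in> Pi\<^sub>E (L2 M) W" "Pi\<^sub>E (L2 M) W \<subseteq> V"
    using V g unfolding openin_product_topology_alt top by fast
  define J where "J = {F\<in>L2 M. W F \<noteq> L2 M}"
  have "\<exists>r>0. mball (koopman M g F) r \<subseteq> W F" if "F \<in> J" for F
  proof -
    have "koopman M g F \<in> W F" "F \<in> L2 M" using W(3) that by (auto simp: J_def PiE_def Pi_def)
    then show ?thesis using W(2)[of F] unfolding L2_topology_def openin_mtopology by auto
  qed
  then obtain r where r: "\<And>F. F \<in> J \<Longrightarrow> 0 < r F" "\<And>F. F \<in> J \<Longrightarrow> mball (koopman M g F) (r F) \<subseteq> W F"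
    by metis
  define e where "e = Min (insert 1 (r ` J))"
  have J: "finite J" using W(1) by (simp add: J_def)
  then have e: "0 < e" "\<And>F. F \<in> J \<Longrightarrow> e \<le> r F" using r(1) by (auto simp: e_def)
  have "h \<in> U" if h: "h \<in> carrier (Aut M)" "\<forall>F\<in>J. L2_dist M (koopman M g F) (koopman M h F) < e" for h
  proof -
    have "koopman M h F \<in> W F" if F: "F \<in> L2 M" for F
    proof (cases "F \<in> J")
      case True
      then have "koopman M h F \<in> mball (koopman M g F) (r F)"
        using h e(2)[OF True] in_L2[OF h(1) F] in_L2[OF gc F] by auto
      then show ?thesis using r(2) True by blast
    qed (use in_L2[OF h(1) F] F in \<open>simp add: J_def\<close>)
    moreover have "koopman M h \<in> extensional (L2 M)" by (simp add: koopman_def)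
    ultimately have "koopman M h \<in> Pi\<^sub>E (L2 M) W" by (auto simp: PiE_def)
    then show ?thesis using W(4) V h koopman_unitary by blast
  qed
  then show ?thesis using J e(1) by (intro exI[of _ J] exI[of _ e]) (auto simp: J_def)
qed

section \<open>Weak neighbourhoods given by finitely many measurable sets\<close>

context prob_space
begin

lemma indicator_sq_integrable:
  assumes "A \<in> sets M" shows "(indicator A :: 'a \<Rightarrow> complex) \<in> sq_integrable M"
proof -
  have "(\<lambda>x. (cmod (indicator A x))\<^sup>2) = indicator A" by (auto simp: indicator_def)
  then show ?thesis using assms by (simp add: sq_integrable_def less_top[symmetric])
qed

text \<open>The squared modulus of the difference of two indicators is the indicator of the
  symmetric difference.\<close>

lemma koopman_indicator_dist:
  assumes g: "g \<in> carrier (Aut M)" and h: "h \<in> carrier (Aut M)" and A: "A \<in> sets M"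
  shows "L2_dist M (koopman M g (L2_class M (indicator A))) (koopman M h (L2_class M (indicator A))) =
     sqrt (dd (act h A) (act g A))"
proof -
  let ?S = "\<lambda>g. inv_into (space M) (rep g)"
  have mp: "?S k \<in> mp_transformations M" if "k \<in> carrier (Aut M)" for k
    by (intro mp_transformations_inv(1) rep_Aut(1) that)
  note ind = indicator_sq_integrable[OF A]
  have "L2_dist M (koopman M g (L2_class M (indicator A))) (koopman M h (L2_class M (indicator A))) =
      nrm2 M (\<lambda>x. indicator A (?S g x) - indicator A (?S h x))"
    unfolding koopman_composition composition_class[OF mp[OF g] ind] composition_class[OF mp[OF h] ind]
    by (rule L2_dist_class[OF sq_integrable_comp(1)[OF ind mp[OF g]] sq_integrable_comp(1)[OF ind mp[OF h]]])
  also have "\<dots> = sqrt (LINT x|M. indicator ((act h A - act g A) \<union> (act g A - act h A)) x)"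
    unfolding nrm2_def
    by (intro arg_cong[where f = sqrt] Bochner_Integration.integral_cong refl)
      (auto simp: act_altdef[OF g A] act_altdef[OF h A] indicator_def)
  also have "\<dots> = sqrt (dd (act h A) (act g A))"
  proof -
    have "(act h A - act g A) \<union> (act g A - act h A) \<in> sets M"
      by (intro sets.Un sets.Diff act_sets A g h)
    from sets.Int_space_eq2[OF this] show ?thesis by (simp add: set_dist_def)
  qed
  finally show ?thesis .
qed

text \<open>For finite families of measurable sets and positive \<open>e\<close> these sets form
  neighbourhood bases of the weak topology. Once this is shown, functions and operators no longer
  appear.\<close>

definition nbhd :: "('a \<Rightarrow> 'a) set \<Rightarrow> 'a set set \<Rightarrow> real \<Rightarrow> ('a \<Rightarrow> 'a) set set" where
  "nbhd g \<A> e = {h\<in>carrier (Aut M). \<forall>A\<in>\<A>. dd (act h A) (act g A) < e}"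

lemma openin_nbhd:
  assumes "g \<in> carrier (Aut M)" "finite \<A>" "\<A> \<subseteq> sets M"
  shows "openin (weak_topology M) (nbhd g \<A> e)"
proof -
  have single: "openin (weak_topology M) (nbhd g {A} e)" if A: "A \<in> sets M" for A
  proof -
    have "nbhd g {A} e = {h\<in>carrier (Aut M). L2_dist M (koopman M g (L2_class M (indicator A)))
        (koopman M h (L2_class M (indicator A))) < sqrt e}"
      using koopman_indicator_dist[OF assms(1) _ A] by (auto simp: nbhd_def)
    then show ?thesis
      using openin_weak_ball[OF assms(1) L2_class_in[OF indicator_sq_integrable[OF A]]] by simp
  qed
  show ?thesis using assms(2,3)
  proof (induction \<A>)
    case empty
    have "nbhd g {} e = topspace (weak_topology M)" by (simp add: nbhd_def topspace_weak)
    then show ?case by simp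
  next
    case (insert A \<A>)
    have "nbhd g (insert A \<A>) e = nbhd g {A} e \<inter> nbhd g \<A> e" by (auto simp: nbhd_def)
    then show ?case using insert single by auto
  qed
qed

text \<open>Dominated convergence: the approximating functions have modulus at most twice that of
  \<open>f\<close>, so the error is at most three times the modulus of \<open>f\<close>, which
  explains the factor 9 in the dominating function.\<close>

lemma simple_approximation:
  assumes f: "f \<in> sq_integrable M" and e: "0 < e"
  shows "\<exists>s. simple_function M s \<and> s \<in> sq_integrable M \<and> nrm2 M (\<lambda>x. f x - s x) < e"
proof -
  note [measurable] = sq_integrableD(1)[OF f]
  obtain s where s: "\<And>i. simple_function M (s i)" "\<And>x. x \<in> space M \<Longrightarrow> (\<lambda>i. s i x) \<longlonglongrightarrow> f x"
      "\<And>i x. x \<in> space M \<Longrightarrow> dist (s i x) 0 \<le> 2 * dist (f x) 0"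
    using borel_measurable_implies_sequence_metric[OF sq_integrableD(1)[OF f], of 0] by blast
  have [measurable]: "s i \<in> borel_measurable M" for i
    using s(1) by (rule borel_measurable_simple_function)
  have "(\<lambda>i. LINT x|M. (cmod (f x - s i x))\<^sup>2) \<longlonglongrightarrow> (LINT x|M. 0)"
  proof (rule integral_dominated_convergence[where w = "\<lambda>x. 9 * (cmod (f x))\<^sup>2"])
    show "integrable M (\<lambda>x. 9 * (cmod (f x))\<^sup>2)" using sq_integrableD(2)[OF f] by simp
    show "AE x in M. (\<lambda>i. (cmod (f x - s i x))\<^sup>2) \<longlonglongrightarrow> 0"
    proof (rule AE_I2)
      fix x assume "x \<in> space M"
      then have "(\<lambda>i. (cmod (f x - s i x))\<^sup>2) \<longlonglongrightarrow> (cmod (f x - f x))\<^sup>2"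
        using s(2) by (intro tendsto_intros)
      then show "(\<lambda>i. (cmod (f x - s i x))\<^sup>2) \<longlonglongrightarrow> 0" by simp
    qed
    show "AE x in M. norm ((cmod (f x - s i x))\<^sup>2) \<le> 9 * (cmod (f x))\<^sup>2" for i
    proof (rule AE_I2)
      fix x assume "x \<in> space M"
      then have "cmod (s i x) \<le> 2 * cmod (f x)" using s(3) by simp
      then have "cmod (f x - s i x) \<le> 3 * cmod (f x)"
        using norm_triangle_ineq4[of "f x" "s i x"] by linarith
      then have "(cmod (f x - s i x))\<^sup>2 \<le> (3 * cmod (f x))\<^sup>2" by (rule power_mono) simp
      then show "norm ((cmod (f x - s i x))\<^sup>2) \<le> 9 * (cmod (f x))\<^sup>2" by (simp add: power_mult_distrib)
    qed
  qed auto
  then have "eventually (\<lambda>i. (LINT x|M. (cmod (f x - s i x))\<^sup>2) < e\<^sup>2) sequentially"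
    using e by (intro order_tendstoD(2)) auto
  then obtain i where "(LINT x|M. (cmod (f x - s i x))\<^sup>2) < e\<^sup>2" by (auto simp: eventually_sequentially)
  then have "nrm2 M (\<lambda>x. f x - s i x) < e"
    unfolding nrm2_def using e real_sqrt_less_mono by fastforce
  moreover have "s i \<in> sq_integrable M"
  proof -
    have "integrable M (\<lambda>x. (cmod (s i x))\<^sup>2)"
    proof (rule Bochner_Integration.integrable_bound[where f = "\<lambda>x. 4 * (cmod (f x))\<^sup>2"])
      show "AE x in M. norm ((cmod (s i x))\<^sup>2) \<le> norm (4 * (cmod (f x))\<^sup>2)"
      proof (rule AE_I2)
        fix x assume "x \<in> space M"
        then have "cmod (s i x) \<le> 2 * cmod (f x)" using s(3) by simp
        then have "(cmod (s i x))\<^sup>2 \<le> (2 * cmod (f x))\<^sup>2" by (rule power_mono) simp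
        then show "norm ((cmod (s i x))\<^sup>2) \<le> norm (4 * (cmod (f x))\<^sup>2)" by (simp add: power_mult_distrib)
      qed
    qed (use sq_integrableD(2)[OF f] in auto)
    then show ?thesis by (simp add: sq_integrable_def)
  qed
  ultimately show ?thesis using s(1) by blast
qed

text \<open>A simple function close to \<open>F\<close> reduces the claim to its finitely many level
  sets. Composition with a measure preserving map is isometric, so the approximation error is the
  same for all group elements and the choice of sets and \<open>d\<close> is uniform in
  \<open>g\<close> and \<open>h\<close>.\<close>

lemma koopman_continuity:
  assumes F: "F \<in> L2 M" and e: "0 < e"
  shows "\<exists>\<A> d. finite \<A> \<and> \<A> \<subseteq> sets M \<and> 0 < d \<and>
    (\<forall>g\<in>carrier (Aut M). \<forall>h\<in>carrier (Aut M). (\<forall>A\<in>\<A>. dd (act h A) (act g A) < d) \<longrightarrow>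
       L2_dist M (koopman M g F) (koopman M h F) < e)"
proof -
  obtain f where f: "f \<in> sq_integrable M" "F = L2_class M f" using L2_cases[OF F] by metis
  obtain s where s: "simple_function M s" "s \<in> sq_integrable M" "nrm2 M (\<lambda>x. f x - s x) < e / 3"
    using simple_approximation[OF f(1), of "e / 3"] e by auto
  define Y where "Y = s ` space M"
  have Y: "finite Y" using s(1) by (simp add: Y_def simple_function_def)
  define A where "A y = s -` {y} \<inter> space M" for y
  have A: "A y \<in> sets M" for y
    unfolding A_def using s(1) by (rule simple_functionD)
  define B where "B = (\<Sum>y\<in>Y. cmod y)"
  have B: "cmod y \<le> B" if "y \<in> Y" for y
    unfolding B_def using Y that by (intro member_le_sum) auto
  have B0: "0 \<le> B" unfolding B_def by (intro sum_nonneg) auto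
  \<comment> \<open>The summand 1 keeps the denominator positive when \<open>B\<close> vanishes and
    makes the estimate below strict.\<close>
  define d where "d = (e / 3)\<^sup>2 / ((2 * B)\<^sup>2 * card Y + 1)"
  have den: "0 < (2 * B)\<^sup>2 * card Y + 1" by (intro add_nonneg_pos) auto
  have d: "0 < d" unfolding d_def using e den by simp
  have "L2_dist M (koopman M g F) (koopman M h F) < e"
    if g: "g \<in> carrier (Aut M)" and h: "h \<in> carrier (Aut M)"
      and close: "\<forall>E\<in>A ` Y. dd (act h E) (act g E) < d" for g h
  proof -
    let ?S = "\<lambda>g. inv_into (space M) (rep g)"
    have mp: "?S k \<in> mp_transformations M" if "k \<in> carrier (Aut M)" for k
      by (intro mp_transformations_inv(1) rep_Aut(1) that)
    have sp: "?S k x \<in> space M" if "k \<in> carrier (Aut M)" "x \<in> space M" for k x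
      using mp_transformationsD(1)[OF mp[OF that(1)]] that(2) by (rule measurable_space)
    note fg = sq_integrable_comp[OF f(1) mp[OF g]] and fh = sq_integrable_comp[OF f(1) mp[OF h]]
      and sg = sq_integrable_comp[OF s(2) mp[OF g]] and sh = sq_integrable_comp[OF s(2) mp[OF h]]
    define E where "E y = (act h (A y) - act g (A y)) \<union> (act g (A y) - act h (A y))" for y
    have E: "E y \<in> sets M" for y 
      unfolding E_def by (intro sets.Un sets.Diff act_sets A g h)
    \<comment> \<open>Where the two values differ, \<open>x\<close> lies in the symmetric difference
      that belongs to the value \<open>s (?S g x)\<close>, and no two values of \<open>s\<close> are
      further apart than \<open>2 * B\<close>.\<close>
    have pt: "(cmod (s (?S g x) - s (?S h x)))\<^sup>2 \<le> (2 * B)\<^sup>2 * (\<Sum>y\<in>Y. indicator (E y) x)"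
      if x: "x \<in> space M" for x
    proof (cases "s (?S g x) = s (?S h x)")
      case True
      then show ?thesis by (simp add: sum_nonneg)
    next
      case False
      let ?y = "s (?S g x)"
      have Ys: "?y \<in> Y" "s (?S h x) \<in> Y" using sp g h x by (auto simp: Y_def)
      have "x \<in> act k (A y) \<longleftrightarrow> s (?S k x) = y" if "k \<in> carrier (Aut M)" for k y
        using sp[OF that x] x act_altdef[OF that A[of y]] by (auto simp: A_def)
      then have "x \<in> act g (A ?y)" "x \<notin> act h (A ?y)" using False g h by auto
      then have "x \<in> E ?y" by (simp add: E_def)
      then have "1 \<le> (\<Sum>y\<in>Y. indicator (E y) x :: real)"
        using member_le_sum[of ?y Y "\<lambda>y. indicator (E y) x :: real"] Ys Y by simp
      moreover have "(cmod (s (?S g x) - s (?S h x)))\<^sup>2 \<le> (2 * B)\<^sup>2"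
        using norm_triangle_ineq4[of "s (?S g x)" "s (?S h x)"] B[OF Ys(1)] B[OF Ys(2)]
        by (intro power_mono) auto
      ultimately show ?thesis
        using mult_left_mono[of 1 "(\<Sum>y\<in>Y. indicator (E y) x :: real)" "(2 * B)\<^sup>2"] by simp
    qed
    have "(nrm2 M (\<lambda>x. s (?S g x) - s (?S h x)))\<^sup>2 \<le> (LINT x|M. (2 * B)\<^sup>2 * (\<Sum>y\<in>Y. indicator (E y) x))"
      unfolding nrm2_square
      by (rule integral_mono)
        (use pt sq_integrableD(2)[OF sq_integrable_diff[OF sg(1) sh(1)]] E in \<open>auto simp: less_top[symmetric]\<close>)
    also have "\<dots> = (2 * B)\<^sup>2 * (\<Sum>y\<in>Y. measure M (E y))"
      using E by (simp add: Bochner_Integration.integral_sum less_top[symmetric])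
    also have "\<dots> = (2 * B)\<^sup>2 * (\<Sum>y\<in>Y. dd (act h (A y)) (act g (A y)))"
      by (simp add: E_def set_dist_def)
    also have "\<dots> \<le> (2 * B)\<^sup>2 * (\<Sum>y\<in>Y. d)"
      using close by (intro mult_left_mono sum_mono) (auto intro: less_imp_le)
    also have "\<dots> = (2 * B)\<^sup>2 * card Y * d" by simp
    also have "\<dots> < ((2 * B)\<^sup>2 * card Y + 1) * d" using d by (simp add: distrib_right)
    also have "\<dots> = (e / 3)\<^sup>2" using den by (simp add: d_def)
    finally have mid: "nrm2 M (\<lambda>x. s (?S g x) - s (?S h x)) < e / 3"
      by (rule power2_less_imp_less) (use e in auto)
    have outer: "nrm2 M (\<lambda>x. f (?S k x) - s (?S k x)) < e / 3" if "k \<in> carrier (Aut M)" for k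
      using sq_integrable_comp(2)[OF sq_integrable_diff[OF f(1) s(2)] mp[OF that]] s(3) by simp
    have "L2_dist M (koopman M g F) (koopman M h F) = nrm2 M (\<lambda>x. f (?S g x) - f (?S h x))"
      unfolding koopman_composition f(2) composition_class[OF mp[OF g] f(1)] composition_class[OF mp[OF h] f(1)]
      by (rule L2_dist_class[OF fg(1) fh(1)])
    also have "\<dots> \<le> nrm2 M (\<lambda>x. f (?S g x) - s (?S g x)) + nrm2 M (\<lambda>x. s (?S g x) - f (?S h x))"
      by (rule nrm2_diff_triangle[OF fg(1) sg(1) fh(1)])
    also have "nrm2 M (\<lambda>x. s (?S g x) - f (?S h x)) \<le>
        nrm2 M (\<lambda>x. s (?S g x) - s (?S h x)) + nrm2 M (\<lambda>x. s (?S h x) - f (?S h x))"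
      by (rule nrm2_diff_triangle[OF sg(1) sh(1) fh(1)])
    also have "nrm2 M (\<lambda>x. s (?S h x) - f (?S h x)) = nrm2 M (\<lambda>x. f (?S h x) - s (?S h x))"
      by (rule nrm2_diff_commute)
    finally show ?thesis using mid outer[OF g] outer[OF h] by simp
  qed
  then show ?thesis using Y A d by (intro exI[of _ "A ` Y"] exI[of _ d]) auto
qed

lemma openin_weak_imp_nbhd:
  assumes U: "openin (weak_topology M) U" and g: "g \<in> U"
  shows "\<exists>\<A> e. finite \<A> \<and> \<A> \<subseteq> sets M \<and> 0 < e \<and> nbhd g \<A> e \<subseteq> U"
proof -
  obtain J e where J: "finite J" "J \<subseteq> L2 M" "0 < e"
     "\<And>h. h \<in> carrier (Aut M) \<Longrightarrow> (\<forall>F\<in>J. L2_dist M (koopman M g F) (koopman M h F) < e) \<Longrightarrow> h \<in> U"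
    using openin_weak_imp_L2[OF assms] by blast
  have gc: "g \<in> carrier (Aut M)" using openin_subset[OF U] g by (auto simp: topspace_weak)
  define Phi where "Phi F \<A> d \<longleftrightarrow> finite \<A> \<and> \<A> \<subseteq> sets M \<and> 0 < d \<and>
    (\<forall>g\<in>carrier (Aut M). \<forall>h\<in>carrier (Aut M). (\<forall>A\<in>\<A>. dd (act h A) (act g A) < d) \<longrightarrow>
       L2_dist M (koopman M g F) (koopman M h F) < e)" for F \<A> d
  have "\<exists>\<A> d. Phi F \<A> d" if "F \<in> J" for F
    unfolding Phi_def by (rule koopman_continuity) (use that J in auto)
  then obtain \<A> d where Phi: "\<And>F. F \<in> J \<Longrightarrow> Phi F (\<A> F) (d F)" by metis
  then have A: "\<And>F. F \<in> J \<Longrightarrow> finite (\<A> F)" "\<And>F. F \<in> J \<Longrightarrow> \<A> F \<subseteq> sets M"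
     "\<And>F. F \<in> J \<Longrightarrow> 0 < d F"
    unfolding Phi_def by blast+
  have A4: "L2_dist M (koopman M g F) (koopman M h F) < e"
    if "F \<in> J" "h \<in> carrier (Aut M)" "\<forall>A\<in>\<A> F. dd (act h A) (act g A) < d F" for F h
    using Phi[OF that(1)] gc that(2,3) unfolding Phi_def by simp
  define r where "r = Min (insert 1 (d ` J))"
  have r: "0 < r" "\<And>F. F \<in> J \<Longrightarrow> r \<le> d F" using J(1) A(3) by (auto simp: r_def)
  have "nbhd g (\<Union>F\<in>J. \<A> F) r \<subseteq> U"
  proof
    fix h assume h: "h \<in> nbhd g (\<Union>F\<in>J. \<A> F) r"
    show "h \<in> U"
    proof (rule J(4))
      show hc: "h \<in> carrier (Aut M)" using h by (simp add: nbhd_def)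
      show "\<forall>F\<in>J. L2_dist M (koopman M g F) (koopman M h F) < e"
      proof
        fix F assume F: "F \<in> J"
        show "L2_dist M (koopman M g F) (koopman M h F) < e"
        proof (rule A4[OF F hc], rule ballI)
          fix A assume "A \<in> \<A> F"
          then have "dd (act h A) (act g A) < r" using h F by (auto simp: nbhd_def)
          then show "dd (act h A) (act g A) < d F" using r(2)[OF F] by simp
        qed
      qed
    qed
  qed
  then show ?thesis using J(1) A r(1) by (intro exI[of _ "\<Union>F\<in>J. \<A> F"] exI[of _ r]) auto
qed

end

section \<open>Topological groups\<close>

lemma topological_groupI:
  assumes G: "group G" and T: "topspace T = carrier G"
    and mult: "\<And>U g h. openin T U \<Longrightarrow> g \<in> carrier G \<Longrightarrow> h \<in> carrier G \<Longrightarrow> g \<otimes>\<^bsub>G\<^esub> h \<in> U \<Longrightarrow>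
       \<exists>V W. openin T V \<and> openin T W \<and> g \<in> V \<and> h \<in> W \<and> (\<forall>x\<in>V. \<forall>y\<in>W. x \<otimes>\<^bsub>G\<^esub> y \<in> U)"
    and inv: "\<And>U g. openin T U \<Longrightarrow> g \<in> carrier G \<Longrightarrow> inv\<^bsub>G\<^esub> g \<in> U \<Longrightarrow>
       \<exists>V. openin T V \<and> g \<in> V \<and> (\<forall>x\<in>V. inv\<^bsub>G\<^esub> x \<in> U)"
  shows "topological_group G T"
  unfolding topological_group_def
proof (intro conjI)
  interpret group G by (rule G)
  show "continuous_map (prod_topology T T) T (\<lambda>(x, y). x \<otimes>\<^bsub>G\<^esub> y)"
    unfolding continuous_map_def
  proof (intro conjI allI impI)
    show "(\<lambda>(x, y). x \<otimes>\<^bsub>G\<^esub> y) \<in> topspace (prod_topology T T) \<rightarrow> topspace T" using T by auto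
    fix U assume U: "openin T U"
    show "openin (prod_topology T T) {x \<in> topspace (prod_topology T T). (case x of (x, y) \<Rightarrow> x \<otimes>\<^bsub>G\<^esub> y) \<in> U}"
      unfolding openin_prod_topology_alt
    proof (intro allI impI)
      fix g h assume "(g, h) \<in> {x \<in> topspace (prod_topology T T). (case x of (x, y) \<Rightarrow> x \<otimes>\<^bsub>G\<^esub> y) \<in> U}"
      then have gh: "g \<in> carrier G" "h \<in> carrier G" "g \<otimes>\<^bsub>G\<^esub> h \<in> U" using T by auto
      obtain V W where VW: "openin T V" "openin T W" "g \<in> V" "h \<in> W" "\<forall>x\<in>V. \<forall>y\<in>W. x \<otimes>\<^bsub>G\<^esub> y \<in> U"
        using mult[OF U gh] by blast
      then show "\<exists>V W. openin T V \<and> openin T W \<and> g \<in> V \<and> h \<in> W \<and>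
          V \<times> W \<subseteq> {x \<in> topspace (prod_topology T T). (case x of (x, y) \<Rightarrow> x \<otimes>\<^bsub>G\<^esub> y) \<in> U}"
        using openin_subset[OF VW(1)] openin_subset[OF VW(2)] by (intro exI[of _ V] exI[of _ W]) auto
    qed
  qed
  show "continuous_map T T (\<lambda>x. inv\<^bsub>G\<^esub> x)"
    unfolding continuous_map_def
  proof (intro conjI allI impI)
    show "(\<lambda>x. inv\<^bsub>G\<^esub> x) \<in> topspace T \<rightarrow> topspace T" using T by auto
    fix U assume U: "openin T U"
    show "openin T {x \<in> topspace T. inv\<^bsub>G\<^esub> x \<in> U}"
      unfolding openin_subopen[of T "{x \<in> topspace T. inv\<^bsub>G\<^esub> x \<in> U}"]
    proof
      fix g assume "g \<in> {x \<in> topspace T. inv\<^bsub>G\<^esub> x \<in> U}"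
      then have g: "g \<in> carrier G" "inv\<^bsub>G\<^esub> g \<in> U" using T by auto
      obtain V where V: "openin T V" "g \<in> V" "\<forall>x\<in>V. inv\<^bsub>G\<^esub> x \<in> U" using inv[OF U g] by blast
      then show "\<exists>V. openin T V \<and> g \<in> V \<and> V \<subseteq> {x \<in> topspace T. inv\<^bsub>G\<^esub> x \<in> U}"
        using openin_subset[OF V(1)] by blast
    qed
  qed
qed (use G T in auto)

lemma topological_groupD:
  assumes TG: "topological_group G T"
  shows "group G" "topspace T = carrier G"
    "\<And>U g h. openin T U \<Longrightarrow> g \<in> carrier G \<Longrightarrow> h \<in> carrier G \<Longrightarrow> g \<otimes>\<^bsub>G\<^esub> h \<in> U \<Longrightarrow>
       \<exists>V W. openin T V \<and> openin T W \<and> g \<in> V \<and> h \<in> W \<and> (\<forall>x\<in>V. \<forall>y\<in>W. x \<otimes>\<^bsub>G\<^esub> y \<in> U)"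
    "\<And>U g. openin T U \<Longrightarrow> g \<in> carrier G \<Longrightarrow> inv\<^bsub>G\<^esub> g \<in> U \<Longrightarrow>
       \<exists>V. openin T V \<and> g \<in> V \<and> (\<forall>x\<in>V. inv\<^bsub>G\<^esub> x \<in> U)"
proof -
  show G: "group G" and top: "topspace T = carrier G" using TG by (auto simp: topological_group_def)
  have cm: "continuous_map (prod_topology T T) T (\<lambda>(x, y). x \<otimes>\<^bsub>G\<^esub> y)"
    and ci: "continuous_map T T (\<lambda>x. inv\<^bsub>G\<^esub> x)" using TG by (auto simp: topological_group_def)
  { fix U g h assume U: "openin T U" "g \<in> carrier G" "h \<in> carrier G" "g \<otimes>\<^bsub>G\<^esub> h \<in> U"
    define S where "S = {x \<in> topspace (prod_topology T T). (case x of (x, y) \<Rightarrow> x \<otimes>\<^bsub>G\<^esub> y) \<in> U}"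
    have S: "openin (prod_topology T T) S"
      unfolding S_def by (rule openin_continuous_map_preimage[OF cm U(1)])
    have gh: "(g, h) \<in> S" using U top by (auto simp: S_def)
    from S[unfolded openin_prod_topology_alt, rule_format, OF gh]
    obtain V W where VW: "openin T V" "openin T W" "g \<in> V" "h \<in> W" "V \<times> W \<subseteq> S"
      by (elim exE conjE)
    moreover have "\<forall>x\<in>V. \<forall>y\<in>W. x \<otimes>\<^bsub>G\<^esub> y \<in> U" using VW(5) by (auto simp: S_def)
    ultimately show "\<exists>V W. openin T V \<and> openin T W \<and> g \<in> V \<and> h \<in> W \<and> (\<forall>x\<in>V. \<forall>y\<in>W. x \<otimes>\<^bsub>G\<^esub> y \<in> U)"
      by blast }
  { fix U g assume U: "openin T U" "g \<in> carrier G" "inv\<^bsub>G\<^esub> g \<in> U"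
    have "openin T {x \<in> topspace T. inv\<^bsub>G\<^esub> x \<in> U}" by (rule openin_continuous_map_preimage[OF ci U(1)])
    then show "\<exists>V. openin T V \<and> g \<in> V \<and> (\<forall>x\<in>V. inv\<^bsub>G\<^esub> x \<in> U)"
      using U top by (intro exI[of _ "{x \<in> topspace T. inv\<^bsub>G\<^esub> x \<in> U}"]) auto }
qed

lemma openin_translate:
  assumes TG: "topological_group G T" and U: "openin T U" and g: "g \<in> carrier G"
  shows "openin T {x\<in>carrier G. g \<otimes>\<^bsub>G\<^esub> x \<in> U}" "openin T {x\<in>carrier G. x \<otimes>\<^bsub>G\<^esub> g \<in> U}"
proof -
  note D = topological_groupD[OF TG]
  show "openin T {x\<in>carrier G. g \<otimes>\<^bsub>G\<^esub> x \<in> U}"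
    unfolding openin_subopen[of T "{x\<in>carrier G. g \<otimes>\<^bsub>G\<^esub> x \<in> U}"]
  proof
    fix x assume x: "x \<in> {x\<in>carrier G. g \<otimes>\<^bsub>G\<^esub> x \<in> U}"
    then have "x \<in> carrier G" "g \<otimes>\<^bsub>G\<^esub> x \<in> U" by auto
    from D(3)[OF U g this] obtain V W
      where "openin T W" "g \<in> V" "x \<in> W" "\<forall>x\<in>V. \<forall>y\<in>W. x \<otimes>\<^bsub>G\<^esub> y \<in> U" by blast
    then show "\<exists>W. openin T W \<and> x \<in> W \<and> W \<subseteq> {x\<in>carrier G. g \<otimes>\<^bsub>G\<^esub> x \<in> U}"
      using openin_subset[of T W] D(2) by blast
  qed
  show "openin T {x\<in>carrier G. x \<otimes>\<^bsub>G\<^esub> g \<in> U}"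
    unfolding openin_subopen[of T "{x\<in>carrier G. x \<otimes>\<^bsub>G\<^esub> g \<in> U}"]
  proof
    fix x assume x: "x \<in> {x\<in>carrier G. x \<otimes>\<^bsub>G\<^esub> g \<in> U}"
    then have "x \<in> carrier G" "x \<otimes>\<^bsub>G\<^esub> g \<in> U" by auto
    from D(3)[OF U this(1) g this(2)] obtain V W
      where "openin T V" "g \<in> W" "x \<in> V" "\<forall>x\<in>V. \<forall>y\<in>W. x \<otimes>\<^bsub>G\<^esub> y \<in> U" by blast
    then show "\<exists>W. openin T W \<and> x \<in> W \<and> W \<subseteq> {x\<in>carrier G. x \<otimes>\<^bsub>G\<^esub> g \<in> U}"
      using openin_subset[of T V] D(2) by blast
  qed
qed

text \<open>For products, the images of \<open>E\<close> under \<open>x\<close> after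
  \<open>y\<close> and under \<open>g\<close> after \<open>h\<close> are compared through
  \<open>x\<close> after \<open>h\<close>: \<open>y\<close> has to be close to \<open>h\<close> on
  \<open>E\<close>, and \<open>x\<close> close to \<open>g\<close> on the translate
  \<open>act h E\<close>. For inverses, the distance between the two inverse images of
  \<open>E\<close> is the distance from \<open>E\<close> to the image under \<open>x\<close> of
  \<open>act (inv g) E\<close>.\<close>

lemma (in prob_space) topological_group_weak: "topological_group (Aut M) (weak_topology M)"
proof (rule topological_groupI)
  interpret group "Aut M" by (rule group_Aut)
  show "group (Aut M)" by (rule group_Aut)
  show "topspace (weak_topology M) = carrier (Aut M)" by (rule topspace_weak)
  fix U g assume U: "openin (weak_topology M) U" and g: "g \<in> carrier (Aut M)"
  { fix h assume h: "h \<in> carrier (Aut M)" and ghU: "g \<otimes>\<^bsub>Aut M\<^esub> h \<in> U"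
    from openin_weak_imp_nbhd[OF U ghU] obtain \<A> e where A: "finite \<A>" "\<A> \<subseteq> sets M" "0 < e" "nbhd (g \<otimes>\<^bsub>Aut M\<^esub> h) \<A> e \<subseteq> U"
      by (elim exE conjE)
    define V where "V = nbhd g (act h ` \<A>) (e / 2)"
    define W where "W = nbhd h \<A> (e / 2)"
    have "openin (weak_topology M) V" "openin (weak_topology M) W"
      unfolding V_def W_def using A g h by (auto intro!: openin_nbhd)
    moreover have "g \<in> V" "h \<in> W" using g h A(3) by (auto simp: V_def W_def nbhd_def)
    moreover have "x \<otimes>\<^bsub>Aut M\<^esub> y \<in> U" if xy: "x \<in> V" "y \<in> W" for x y
    proof -
      have xyc: "x \<in> carrier (Aut M)" "y \<in> carrier (Aut M)" using xy by (auto simp: V_def W_def nbhd_def)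
      have "dd (act (x \<otimes>\<^bsub>Aut M\<^esub> y) E) (act (g \<otimes>\<^bsub>Aut M\<^esub> h) E) < e" if E: "E \<in> \<A>" for E
      proof -
        have Es: "E \<in> sets M" using A(2) E by auto
        have "dd (act (x \<otimes>\<^bsub>Aut M\<^esub> y) E) (act (g \<otimes>\<^bsub>Aut M\<^esub> h) E) = dd (act x (act y E)) (act g (act h E))"
          by (rule dd_cong[OF _ _ _ _ dd_act_mult[OF xyc Es] dd_act_mult[OF g h Es]])
            (use xyc g h Es in auto)
        also have "\<dots> \<le> dd (act x (act y E)) (act x (act h E)) + dd (act x (act h E)) (act g (act h E))"
          by (rule dd_triangle) (use xyc g h Es in auto)
        also have "dd (act x (act y E)) (act x (act h E)) = dd (act y E) (act h E)"
          by (rule dd_act[OF xyc(1)]) (use xyc h Es in auto)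
        also have "\<dots> < e / 2" using xy(2) E by (auto simp: W_def nbhd_def)
        also have "dd (act x (act h E)) (act g (act h E)) < e / 2" using xy(1) E by (auto simp: V_def nbhd_def)
        finally show ?thesis by simp
      qed
      then have "x \<otimes>\<^bsub>Aut M\<^esub> y \<in> nbhd (g \<otimes>\<^bsub>Aut M\<^esub> h) \<A> e" using xyc by (simp add: nbhd_def)
      then show ?thesis using A(4) by blast
    qed
    ultimately show "\<exists>V W. openin (weak_topology M) V \<and> openin (weak_topology M) W \<and> g \<in> V \<and> h \<in> W \<and>
       (\<forall>x\<in>V. \<forall>y\<in>W. x \<otimes>\<^bsub>Aut M\<^esub> y \<in> U)" by blast }
  assume igU: "inv\<^bsub>Aut M\<^esub> g \<in> U"
  from openin_weak_imp_nbhd[OF U igU] obtain \<A> e where A: "finite \<A>" "\<A> \<subseteq> sets M" "0 < e" "nbhd (inv\<^bsub>Aut M\<^esub> g) \<A> e \<subseteq> U"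
    by (elim exE conjE)
  have ig: "inv\<^bsub>Aut M\<^esub> g \<in> carrier (Aut M)" using g by simp
  define V where "V = nbhd g (act (inv\<^bsub>Aut M\<^esub> g) ` \<A>) e"
  have Vo: "openin (weak_topology M) V"
    unfolding V_def using A g ig by (auto intro!: openin_nbhd)
  have gV: "g \<in> V" using g A(3) by (auto simp: V_def nbhd_def)
  have "inv\<^bsub>Aut M\<^esub> x \<in> U" if x: "x \<in> V" for x
  proof -
    have xc: "x \<in> carrier (Aut M)" using x by (auto simp: V_def nbhd_def)
    have "dd (act (inv\<^bsub>Aut M\<^esub> x) E) (act (inv\<^bsub>Aut M\<^esub> g) E) < e" if E: "E \<in> \<A>" for E
    proof -
      have Es: "E \<in> sets M" using A(2) E by auto
      have "dd (act (inv\<^bsub>Aut M\<^esub> x) E) (act (inv\<^bsub>Aut M\<^esub> g) E) = dd (act x (act (inv\<^bsub>Aut M\<^esub> g) E)) E"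
        using dd_act_left[OF xc act_sets[OF ig Es] Es] by (simp add: dd_commute)
      also have "\<dots> = dd (act x (act (inv\<^bsub>Aut M\<^esub> g) E)) (act g (act (inv\<^bsub>Aut M\<^esub> g) E))"
        by (rule dd_cong) (use dd_act_inv(2)[OF g Es] xc g ig Es in \<open>auto simp: dd_commute\<close>)
      also have "\<dots> < e" using x E by (auto simp: V_def nbhd_def)
      finally show ?thesis .
    qed
    then have "inv\<^bsub>Aut M\<^esub> x \<in> nbhd (inv\<^bsub>Aut M\<^esub> g) \<A> e" using xc by (simp add: nbhd_def)
    then show ?thesis using A(4) by blast
  qed
  then show "\<exists>V. openin (weak_topology M) V \<and> g \<in> V \<and> (\<forall>x\<in>V. inv\<^bsub>Aut M\<^esub> x \<in> U)"
    using Vo gV by blast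
qed

context atomless_standard_space
begin

text \<open>Countably many sets suffice: those where a Borel embedding into the line lies below a
  rational. Agreement on each of them modulo null sets makes the inverses of the representatives
  agree at almost every point.\<close>

lemma Aut_eqI:
  assumes g: "g \<in> carrier (Aut M)" and h: "h \<in> carrier (Aut M)"
    and eq: "\<And>A. A \<in> sets M \<Longrightarrow> dd (act g A) (act h A) = 0"
  shows "g = h"
proof -
  obtain f :: "'a \<Rightarrow> real" where f: "inj_on f (space M)" "f \<in> borel_measurable M"
    using standard_borel_real_embedding[OF std not_empty] by blast
  let ?S = "\<lambda>g. inv_into (space M) (rep g)"
  have mp: "?S k \<in> mp_transformations M" if "k \<in> carrier (Aut M)" for k
    by (intro mp_transformations_inv(1) rep_Aut(1) that)
  have sp: "?S k x \<in> space M" if "k \<in> carrier (Aut M)" "x \<in> space M" for k x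
    using mp_transformationsD(1)[OF mp[OF that(1)]] that(2) by (rule measurable_space)
  define A where "A q = {x\<in>space M. f x < of_rat q}" for q
  have A: "A q \<in> sets M" for q using f(2) unfolding A_def by measurable
  have mem: "x \<in> act k (A q) \<longleftrightarrow> f (?S k x) < of_rat q" if "k \<in> carrier (Aut M)" "x \<in> space M" for k x q
    unfolding act_altdef[OF that(1) A] using sp[OF that] that(2) by (simp add: A_def)
  have "AE x in M. x \<in> act g (A q) \<longleftrightarrow> x \<in> act h (A q)" for q
  proof -
    have "(act g (A q) - act h (A q)) \<union> (act h (A q) - act g (A q)) \<in> null_sets M"
    proof (rule null_setsI)
      show "(act g (A q) - act h (A q)) \<union> (act h (A q) - act g (A q)) \<in> sets M"
        by (intro sets.Un sets.Diff act_sets A g h)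
      show "emeasure M ((act g (A q) - act h (A q)) \<union> (act h (A q) - act g (A q))) = 0"
        using eq[OF A[of q]] by (simp add: emeasure_eq_measure set_dist_def)
    qed
    then have "AE x in M. x \<notin> (act g (A q) - act h (A q)) \<union> (act h (A q) - act g (A q))"
      by (rule AE_not_in)
    then show ?thesis by eventually_elim auto
  qed
  then have "AE x in M. \<forall>q. x \<in> act g (A q) \<longleftrightarrow> x \<in> act h (A q)"
    by (simp add: AE_all_countable)
  then have "AE x in M. ?S g x = ?S h x"
    using AE_space
  proof eventually_elim
    case (elim x)
    then have "f (?S g x) < of_rat q \<longleftrightarrow> f (?S h x) < of_rat q" for q
      using mem[OF g, of x q] mem[OF h, of x q] by simp
    then have "f (?S g x) = f (?S h x)"
      by (metis linorder_neqE_linordered_idom of_rat_dense less_asym)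
    then show ?case using f(1) sp elim g h by (meson inj_onD)
  qed
  then have "aut_class M (?S g) = aut_class M (?S h)"
    by (intro aut_class_eqI mp g h)
  then have "inv\<^bsub>Aut M\<^esub> g = inv\<^bsub>Aut M\<^esub> h"
    using inv_Aut[OF rep_Aut(1)[OF g]] inv_Aut[OF rep_Aut(1)[OF h]] rep_Aut(2)[OF g] rep_Aut(2)[OF h] by simp
  then show ?thesis using g h group.inv_inv[OF group_Aut] by metis
qed

lemma hausdorff_group_weak: "hausdorff_group (Aut M) (weak_topology M)"
  unfolding hausdorff_group_def Hausdorff_space_def topspace_weak
proof (intro conjI allI impI topological_group_weak)
  fix g h assume "g \<in> carrier (Aut M) \<and> h \<in> carrier (Aut M) \<and> g \<noteq> h"
  then have gh: "g \<in> carrier (Aut M)" "h \<in> carrier (Aut M)" "g \<noteq> h" by auto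
  then obtain A where A: "A \<in> sets M" "dd (act g A) (act h A) \<noteq> 0" using Aut_eqI by blast
  define e where "e = dd (act g A) (act h A) / 2"
  have e: "0 < e" using A(2) dd_nonneg[of "act g A" "act h A"] unfolding e_def by linarith
  have "disjnt (nbhd g {A} e) (nbhd h {A} e)"
  proof -
    have False if "k \<in> nbhd g {A} e" "k \<in> nbhd h {A} e" for k
    proof -
      have k: "k \<in> carrier (Aut M)" "dd (act k A) (act g A) < e" "dd (act k A) (act h A) < e"
        using that by (auto simp: nbhd_def)
      then have "dd (act g A) (act h A) < e + e"
        using dd_triangle[of "act g A" "act k A" "act h A"] A gh by (simp add: dd_commute)
      then show False by (simp add: e_def)
    qed
    then show ?thesis by (auto simp: disjnt_def)
  qed
  moreover have "openin (weak_topology M) (nbhd g {A} e)" "openin (weak_topology M) (nbhd h {A} e)"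
    using A gh by (auto intro!: openin_nbhd)
  moreover have "g \<in> nbhd g {A} e" "h \<in> nbhd h {A} e" using gh e by (auto simp: nbhd_def)
  ultimately show "\<exists>U V. openin (weak_topology M) U \<and> openin (weak_topology M) V \<and> g \<in> U \<and> h \<in> V \<and> disjnt U V"
    by blast
qed

end

section \<open>Energy of rearrangements\<close>

lemma ex_permutes_image:
  assumes "finite S" "J \<subseteq> S" "I \<subseteq> S" "card I = card J"
  shows "\<exists>\<sigma>. \<sigma> permutes S \<and> \<sigma> ` J = I"
proof -
  have fin: "finite J" "finite I" using assms finite_subset by auto
  obtain b where b: "bij_betw b J I" using finite_same_card_bij[OF fin] assms(4) by metis
  have "card (S - J) = card (S - I)" using assms fin by (simp add: card_Diff_subset)
  then obtain c where c: "bij_betw c (S - J) (S - I)"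
    using finite_same_card_bij[of "S - J" "S - I"] assms(1) by auto
  define \<sigma> where "\<sigma> k = (if k \<in> J then b k else if k \<in> S then c k else k)" for k
  have bJ: "bij_betw \<sigma> J I" using b by (subst bij_betw_cong[of J \<sigma> b]) (auto simp: \<sigma>_def)
  have cJ: "bij_betw \<sigma> (S - J) (S - I)" using c by (subst bij_betw_cong[of "S - J" \<sigma> c]) (auto simp: \<sigma>_def)
  have "bij_betw \<sigma> (J \<union> (S - J)) (I \<union> (S - I))" by (rule bij_betw_combine[OF bJ cJ]) auto
  moreover have "J \<union> (S - J) = S" "I \<union> (S - I) = S" using assms by auto
  ultimately have "bij_betw \<sigma> S S" by simp
  then have "\<sigma> permutes S" by (rule bij_imp_permutes) (use assms(2) in \<open>auto simp: \<sigma>_def\<close>)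
  then show ?thesis using bJ by (auto simp: bij_betw_def)
qed

text \<open>For a bistochastic weight \<open>m\<close> this is the squared norm of the part of the step function \<open>w\<close>
  that is lost by conditional expectation along \<open>m\<close>.\<close>

definition energy_loss :: "nat \<Rightarrow> nat \<Rightarrow> (nat \<Rightarrow> nat \<Rightarrow> real) \<Rightarrow> (nat \<Rightarrow> real) \<Rightarrow> real" where
  "energy_loss N L m w = (\<Sum>k<N. (w k)\<^sup>2) / N - L * (\<Sum>l<L. (\<Sum>k<N. w k * m k l)\<^sup>2)"

text \<open>A joint distribution of two uniform indices. In the application \<open>m k l\<close> is
  the measure of the intersection of a cell of one equipartition with a cell of another.\<close>

locale bistochastic =
  fixes N L :: nat and m :: "nat \<Rightarrow> nat \<Rightarrow> real"
  assumes pos: "0 < N" "0 < L"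
    and nonneg: "\<And>k l. k < N \<Longrightarrow> l < L \<Longrightarrow> 0 \<le> m k l"
    and rows: "\<And>k. k < N \<Longrightarrow> (\<Sum>l<L. m k l) = 1 / N"
    and cols: "\<And>l. l < L \<Longrightarrow> (\<Sum>k<N. m k l) = 1 / L"
begin

abbreviation "Q \<equiv> energy_loss N L m"

text \<open>The conditional expectation of \<open>w\<close> given the second index, which takes each
  value with probability \<open>1 / L\<close>.\<close>

definition expect :: "(nat \<Rightarrow> real) \<Rightarrow> nat \<Rightarrow> real" where
  "expect w l = L * (\<Sum>k<N. w k * m k l)"

text \<open>Variance decomposition: the loss is the mean squared distance from \<open>w\<close> to
  its conditional expectation. This exhibits it as a nonnegative quadratic form that vanishes on
  constants.\<close>

lemma Q_altdef: "Q w = (\<Sum>k<N. \<Sum>l<L. m k l * (w k - expect w l)\<^sup>2)"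
proof -
  have sq: "(\<Sum>k<N. \<Sum>l<L. m k l * (w k)\<^sup>2) = (\<Sum>k<N. (w k)\<^sup>2) / N"
  proof -
    have "(\<Sum>k<N. \<Sum>l<L. m k l * (w k)\<^sup>2) = (\<Sum>k<N. (\<Sum>l<L. m k l) * (w k)\<^sup>2)"
      by (simp add: sum_distrib_right)
    also have "\<dots> = (\<Sum>k<N. 1 / N * (w k)\<^sup>2)" by (intro sum.cong) (auto simp: rows)
    finally show ?thesis by (simp add: sum_divide_distrib)
  qed
  have cross: "(\<Sum>k<N. \<Sum>l<L. m k l * (w k * expect w l)) = (\<Sum>l<L. (expect w l)\<^sup>2) / L"
  proof -
    have "(\<Sum>k<N. \<Sum>l<L. m k l * (w k * expect w l)) = (\<Sum>l<L. \<Sum>k<N. m k l * (w k * expect w l))"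
      by (rule sum.swap)
    also have "\<dots> = (\<Sum>l<L. (\<Sum>k<N. w k * m k l) * expect w l)"
      by (simp add: sum_distrib_left sum_distrib_right mult_ac)
    also have "\<dots> = (\<Sum>l<L. (expect w l)\<^sup>2 / L)"
      using pos by (intro sum.cong) (auto simp: expect_def power2_eq_square)
    finally show ?thesis by (simp add: sum_divide_distrib)
  qed
  have last: "(\<Sum>k<N. \<Sum>l<L. m k l * (expect w l)\<^sup>2) = (\<Sum>l<L. (expect w l)\<^sup>2) / L"
  proof -
    have "(\<Sum>k<N. \<Sum>l<L. m k l * (expect w l)\<^sup>2) = (\<Sum>l<L. \<Sum>k<N. m k l * (expect w l)\<^sup>2)"
      by (rule sum.swap)
    also have "\<dots> = (\<Sum>l<L. (\<Sum>k<N. m k l) * (expect w l)\<^sup>2)" by (simp add: sum_distrib_right)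
    also have "\<dots> = (\<Sum>l<L. 1 / L * (expect w l)\<^sup>2)" by (intro sum.cong) (auto simp: cols)
    finally show ?thesis by (simp add: sum_divide_distrib)
  qed
  have "(\<Sum>k<N. \<Sum>l<L. m k l * (w k - expect w l)\<^sup>2) =
      (\<Sum>k<N. \<Sum>l<L. m k l * (w k)\<^sup>2) - 2 * (\<Sum>k<N. \<Sum>l<L. m k l * (w k * expect w l)) +
      (\<Sum>k<N. \<Sum>l<L. m k l * (expect w l)\<^sup>2)"
    by (simp add: power2_diff algebra_simps sum.distrib sum_subtractf sum_distrib_left)
  also have "\<dots> = (\<Sum>k<N. (w k)\<^sup>2) / N - (\<Sum>l<L. (expect w l)\<^sup>2) / L"
    unfolding sq cross last by simp
  also have "(\<Sum>l<L. (expect w l)\<^sup>2) / L = L * (\<Sum>l<L. (\<Sum>k<N. w k * m k l)\<^sup>2)"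
  proof -
    have "(\<Sum>l<L. (expect w l)\<^sup>2) = (\<Sum>l<L. (real L)\<^sup>2 * (\<Sum>k<N. w k * m k l)\<^sup>2)"
      by (simp add: expect_def power_mult_distrib)
    then show ?thesis using pos by (simp add: sum_distrib_left[symmetric] power2_eq_square)
  qed
  finally show ?thesis by (simp add: energy_loss_def)
qed

lemma Q_nonneg: "0 \<le> Q w"
  unfolding Q_altdef by (intro sum_nonneg mult_nonneg_nonneg) (auto simp: nonneg)

lemma Q_cong: "(\<And>k. k < N \<Longrightarrow> w k = w' k) \<Longrightarrow> Q w = Q w'"
  unfolding energy_loss_def by simp

lemma Q_affine: "Q (\<lambda>k. a + b * w k) = b\<^sup>2 * Q w"
proof -
  have "expect (\<lambda>k. a + b * w k) l = a + b * expect w l" if "l < L" for l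
  proof -
    have "(\<Sum>k<N. (a + b * w k) * m k l) = a * (\<Sum>k<N. m k l) + b * (\<Sum>k<N. w k * m k l)"
      by (simp add: algebra_simps sum.distrib sum_distrib_left)
    then show ?thesis using cols[OF that] pos by (simp add: expect_def field_simps)
  qed
  then have "Q (\<lambda>k. a + b * w k) = (\<Sum>k<N. \<Sum>l<L. m k l * (b * (w k - expect w l))\<^sup>2)"
    unfolding Q_altdef by (intro sum.cong refl) (simp add: algebra_simps)
  also have "\<dots> = b\<^sup>2 * Q w"
    unfolding Q_altdef by (simp add: power_mult_distrib sum_distrib_left mult_ac)
  finally show ?thesis .
qed

text \<open>Cauchy-Schwarz for the sum over \<open>F\<close>, applied inside every square of the
  variance decomposition.\<close>

lemma Q_sum:
  assumes "finite F"
  shows "Q (\<lambda>k. \<Sum>\<sigma>\<in>F. w \<sigma> k) \<le> card F * (\<Sum>\<sigma>\<in>F. Q (w \<sigma>))"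
proof -
  have ex: "expect (\<lambda>k. \<Sum>\<sigma>\<in>F. w \<sigma> k) l = (\<Sum>\<sigma>\<in>F. expect (w \<sigma>) l)" for l
  proof -
    have "(\<Sum>k<N. (\<Sum>\<sigma>\<in>F. w \<sigma> k) * m k l) = (\<Sum>\<sigma>\<in>F. \<Sum>k<N. w \<sigma> k * m k l)"
      unfolding sum_distrib_right by (rule sum.swap)
    then show ?thesis by (simp add: expect_def sum_distrib_left)
  qed
  have "Q (\<lambda>k. \<Sum>\<sigma>\<in>F. w \<sigma> k) = (\<Sum>k<N. \<Sum>l<L. m k l * (\<Sum>\<sigma>\<in>F. w \<sigma> k - expect (w \<sigma>) l)\<^sup>2)"
    unfolding Q_altdef ex by (simp add: sum_subtractf)
  also have "\<dots> \<le> (\<Sum>k<N. \<Sum>l<L. m k l * ((\<Sum>\<sigma>\<in>F. (w \<sigma> k - expect (w \<sigma>) l)\<^sup>2) * card F))"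
    by (intro sum_mono mult_left_mono sum_squared_le_sum_of_squares) (auto simp: nonneg assms)
  also have "\<dots> = card F * (\<Sum>k<N. \<Sum>l<L. \<Sum>\<sigma>\<in>F. m k l * (w \<sigma> k - expect (w \<sigma>) l)\<^sup>2)"
    by (simp add: sum_distrib_left sum_distrib_right mult_ac)
  also have "(\<Sum>k<N. \<Sum>l<L. \<Sum>\<sigma>\<in>F. m k l * (w \<sigma> k - expect (w \<sigma>) l)\<^sup>2) = (\<Sum>\<sigma>\<in>F. Q (w \<sigma>))"
  proof -
    have "(\<Sum>k<N. \<Sum>l<L. \<Sum>\<sigma>\<in>F. m k l * (w \<sigma> k - expect (w \<sigma>) l)\<^sup>2) =
       (\<Sum>k<N. \<Sum>\<sigma>\<in>F. \<Sum>l<L. m k l * (w \<sigma> k - expect (w \<sigma>) l)\<^sup>2)"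
      by (intro sum.cong refl sum.swap)
    also have "\<dots> = (\<Sum>\<sigma>\<in>F. Q (w \<sigma>))" unfolding Q_altdef by (rule sum.swap)
    finally show ?thesis .
  qed
  finally show ?thesis .
qed

text \<open>Averaging over all permutations that carry \<open>J\<close> to the top values of \<open>v\<close> produces a function
  that is constant on \<open>J\<close> and off \<open>J\<close>, with a gap controlled by the variance of \<open>v\<close>.\<close>

lemma rearrangement_energy:
  fixes v :: "nat \<Rightarrow> real"
  assumes v: "\<And>k. k < N \<Longrightarrow> 0 \<le> v k" "\<And>k. k < N \<Longrightarrow> v k \<le> 1"
    and J: "J \<subseteq> {..<N}" and mean: "(\<Sum>k<N. v k) = card J"
    and var: "(card J / N)\<^sup>2 + \<kappa> < (\<Sum>k<N. (v k)\<^sup>2) / N" and \<kappa>: "0 < \<kappa>"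
    and perm: "\<And>\<sigma>. \<sigma> permutes {..<N} \<Longrightarrow> Q (\<lambda>k. v (\<sigma> k)) \<le> c"
  shows "\<kappa>\<^sup>2 * Q (\<lambda>k. of_bool (k \<in> J)) \<le> c"
proof -
  define r where "r = card J"
  have finJ: "finite J" using J finite_subset by blast
  have rN: "r \<le> N" using card_mono[OF _ J] by (simp add: r_def)
  have sq_le: "(\<Sum>k<N. (v k)\<^sup>2) \<le> r"
  proof -
    have "(\<Sum>k<N. (v k)\<^sup>2) \<le> (\<Sum>k<N. v k)"
      using v by (intro sum_mono) (auto simp: power2_eq_square intro: mult_left_le)
    then show ?thesis using mean by (simp add: r_def)
  qed
  have Nvar: "real r * real r / N + N * \<kappa> < (\<Sum>k<N. (v k)\<^sup>2)"
  proof -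
    have "((real r / N)\<^sup>2 + \<kappa>) * N < (\<Sum>k<N. (v k)\<^sup>2)"
      using var pos by (simp add: r_def pos_less_divide_eq)
    moreover have "((real r / N)\<^sup>2 + \<kappa>) * N = real r * real r / N + N * \<kappa>"
      using pos by (simp add: field_simps power2_eq_square)
    ultimately show ?thesis by simp
  qed
  have r0: "0 < r"
  proof (rule ccontr)
    assume "\<not> 0 < r"
    then have "real r = 0" "real r * real r / N = 0" by simp_all
    moreover have "0 < real N * \<kappa>" using \<kappa> pos by simp
    ultimately show False using Nvar sq_le by linarith
  qed
  have rltN: "r < N"
  proof (rule ccontr)
    assume "\<not> r < N"
    then have "real r * real r / N = r" using rN by simp
    moreover have "0 < real N * \<kappa>" using \<kappa> pos by simp
    ultimately show False using Nvar sq_le by linarith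
  qed
  define \<I> where "\<I> = {I. I \<subseteq> {..<N} \<and> card I = r}"
  have "finite \<I>" by (rule finite_subset[of _ "Pow {..<N}"]) (auto simp: \<I>_def)
  moreover have "J \<in> \<I>" using J by (simp add: \<I>_def r_def)
  \<comment> \<open>A set of \<open>r\<close> indices carrying the largest values of
    \<open>v\<close>. Maximality of the sum under the exchange of a single index gives the
    comparison with every index outside.\<close>
  ultimately obtain I where I: "I \<in> \<I>" "\<And>I'. I' \<in> \<I> \<Longrightarrow> sum v I' \<le> sum v I"
    using obtains_MAX[of \<I> "sum v"] by (metis Max_ge empty_iff finite_imageI imageI)
  have Is: "I \<subseteq> {..<N}" "card I = r" "finite I" using I(1) finite_subset by (auto simp: \<I>_def)
  have top: "v j \<le> v i" if ij: "i \<in> I" "j \<in> {..<N} - I" for i j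
  proof -
    have fin': "finite (I - {i})" using Is by simp
    have "insert j (I - {i}) \<in> \<I>" using Is ij r0 by (auto simp: \<I>_def card_insert_if)
    then have "sum v (insert j (I - {i})) \<le> sum v I" by (rule I(2))
    moreover have "sum v (insert j (I - {i})) = v j + sum v (I - {i})" using ij fin' by simp
    moreover have "sum v I = v i + sum v (I - {i})" using ij Is by (simp add: sum.remove)
    ultimately show ?thesis by simp
  qed
  have Ine: "I \<noteq> {}" using Is r0 by auto
  define \<theta> where "\<theta> = Min (v ` I)"
  have \<theta>: "\<And>i. i \<in> I \<Longrightarrow> \<theta> \<le> v i" using Is by (simp add: \<theta>_def)
  have "\<theta> \<in> v ` I" unfolding \<theta>_def using Is Ine by (intro Min_in) auto
  then have \<theta>': "\<And>j. j \<in> {..<N} - I \<Longrightarrow> v j \<le> \<theta>" using top by auto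
  have split: "(\<Sum>k<N. f k) = sum f I + sum f ({..<N} - I)" for f :: "nat \<Rightarrow> real"
    using sum.subset_diff[OF Is(1), of f] by simp
  define s where "s = sum v I / r"
  define t where "t = sum v ({..<N} - I) / (N - r)"
  have sI: "sum v I = r * s" and tI: "sum v ({..<N} - I) = (real N - real r) * t"
    using r0 rltN by (auto simp: s_def t_def of_nat_diff)
  have cI: "card ({..<N} - I) = N - r" using Is by (simp add: card_Diff_subset)
  have s\<theta>: "\<theta> \<le> s"
  proof -
    have "(\<Sum>i\<in>I. \<theta>) \<le> sum v I" by (rule sum_mono) (rule \<theta>)
    then show ?thesis using Is r0 sI by simp
  qed
  have t\<theta>: "t \<le> \<theta>"
  proof -
    have "sum v ({..<N} - I) \<le> (\<Sum>i\<in>{..<N} - I. \<theta>)" by (rule sum_mono) (rule \<theta>')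
    then have "(real N - real r) * t \<le> (real N - real r) * \<theta>" using cI rltN tI by (simp add: of_nat_diff)
    then show ?thesis using rltN by simp
  qed
  \<comment> \<open>On \<open>I\<close> one has \<open>\<theta> \<le> v k \<le> 1\<close> and off
    \<open>I\<close> one has \<open>v k \<le> \<theta>\<close>, so the sum of
    \<open>v k * (v k - \<theta>)\<close> is at most \<open>r * (s - \<theta>)\<close>, that is, the
    sum of squares is at most \<open>r * s\<close>. Since the total is \<open>r\<close>, the excess
    of \<open>r * s\<close> over \<open>r * r / N\<close> equals
    \<open>r * (s - t) * (1 - r / N)\<close>, and the variance hypothesis bounds it below by
    \<open>N * \<kappa>\<close>.\<close>
  have gap: "\<kappa> \<le> s - t"
  proof -
    have "(\<Sum>k<N. v k * (v k - \<theta>)) \<le> r * (s - \<theta>)"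
    proof -
      have "(\<Sum>k\<in>I. v k * (v k - \<theta>)) \<le> (\<Sum>k\<in>I. v k - \<theta>)"
        using v \<theta> Is by (intro sum_mono mult_left_le_one_le) auto
      also have "\<dots> = r * (s - \<theta>)" using Is sI by (simp add: sum_subtractf algebra_simps)
      finally have "(\<Sum>k\<in>I. v k * (v k - \<theta>)) \<le> r * (s - \<theta>)" .
      moreover have "(\<Sum>k\<in>{..<N} - I. v k * (v k - \<theta>)) \<le> 0"
        using v \<theta>' by (intro sum_nonpos mult_nonneg_nonpos) auto
      ultimately show ?thesis unfolding split[of "\<lambda>k. v k * (v k - \<theta>)"] by simp
    qed
    moreover have "(\<Sum>k<N. v k * (v k - \<theta>)) = (\<Sum>k<N. (v k)\<^sup>2) - \<theta> * r"
    proof -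
      have "(\<Sum>k<N. v k * (v k - \<theta>)) = (\<Sum>k<N. (v k)\<^sup>2) - \<theta> * (\<Sum>k<N. v k)"
        by (simp add: algebra_simps power2_eq_square sum_subtractf sum_distrib_left)
      then show ?thesis using mean by (simp add: r_def)
    qed
    ultimately have 1: "(\<Sum>k<N. (v k)\<^sup>2) \<le> r * s" by (simp add: algebra_simps)
    have "r * s + (real N - real r) * t = r" using split[of v] mean sI tI by (simp add: r_def)
    then have "real r * (real r * s + (real N - real r) * t) = real r * real r" by simp
    then have "real r * real r / N = r * (s - t) * (real r / N) + r * t"
      using pos by (simp add: field_simps)
    then have "r * s - real r * real r / N = r * (s - t) * (1 - real r / N)"
      using pos by (simp add: field_simps)
    also have "\<dots> \<le> r * (s - t)"
      using s\<theta> t\<theta> pos by (intro mult_left_le) auto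
    finally have "N * \<kappa> < r * (s - t)" using 1 Nvar by simp
    also have "\<dots> \<le> N * (s - t)" using rN s\<theta> t\<theta> by (intro mult_right_mono) auto
    finally show ?thesis using pos by simp
  qed
  define F where "F = {\<sigma>. \<sigma> permutes {..<N} \<and> \<sigma> ` J = I}"
  have F: "finite F" by (rule finite_subset[OF _ finite_permutations[of "{..<N}"]]) (auto simp: F_def)
  have "F \<noteq> {}" using ex_permutes_image[of "{..<N}" J I] J Is by (auto simp: F_def r_def)
  then have cF: "0 < card F" using F by (simp add: card_gt_0_iff)
  define w where "w k = (\<Sum>\<sigma>\<in>F. v (\<sigma> k))" for k
  \<comment> \<open>Composition with a transposition of two indices on the same side of
    \<open>J\<close> permutes \<open>F\<close>, so the sum over \<open>F\<close> cannot tell these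
    indices apart.\<close>
  have w_const: "w k = w k'" if kk: "k < N" "k' < N" "k \<in> J \<longleftrightarrow> k' \<in> J" for k k'
  proof -
    let ?\<tau> = "Transposition.transpose k k'"
    have \<tau>: "?\<tau> permutes {..<N}" using kk by (intro permutes_swap_id) auto
    have \<tau>J: "?\<tau> ` J = J"
      using kk(3) by (auto simp: Transposition.transpose_def image_iff split: if_splits)
    have inF: "\<sigma> \<circ> ?\<tau> \<in> F" if "\<sigma> \<in> F" for \<sigma>
    proof -
      have "(\<sigma> \<circ> ?\<tau>) ` J = \<sigma> ` J" using \<tau>J by (metis image_comp)
      then show ?thesis using that permutes_compose[OF \<tau>] by (simp add: F_def)
    qed
    have "w k = (\<Sum>\<sigma>\<in>F. v ((\<sigma> \<circ> ?\<tau>) k))"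
      unfolding w_def
    proof (rule sum.reindex_bij_witness[where i = "\<lambda>\<sigma>. \<sigma> \<circ> ?\<tau>" and j = "\<lambda>\<sigma>. \<sigma> \<circ> ?\<tau>"])
    qed (auto simp: inF comp_assoc)
    then show ?thesis by (simp add: w_def)
  qed
  have w_in: "w k = card F * s" if k: "k \<in> J" for k
  proof -
    have "(\<Sum>k'\<in>J. w k') = (\<Sum>\<sigma>\<in>F. \<Sum>k'\<in>J. v (\<sigma> k'))" unfolding w_def by (rule sum.swap)
    also have "\<dots> = (\<Sum>\<sigma>\<in>F. sum v I)"
    proof (rule sum.cong)
      fix \<sigma> assume "\<sigma> \<in> F"
      then have "inj_on \<sigma> J" "\<sigma> ` J = I" by (auto simp: F_def intro: permutes_inj_on)
      then show "(\<Sum>k'\<in>J. v (\<sigma> k')) = sum v I" using sum.reindex[of \<sigma> J v] by simp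
    qed simp
    also have "\<dots> = card F * (r * s)" using sI by simp
    finally have "(\<Sum>k'\<in>J. w k') = card F * (r * s)" .
    moreover have "(\<Sum>k'\<in>J. w k') = (\<Sum>k'\<in>J. w k)"
      using k J by (intro sum.cong w_const) auto
    ultimately show ?thesis using r0 by (simp add: r_def)
  qed
  have w_out: "w k = card F * t" if k: "k \<in> {..<N} - J" for k
  proof -
    have "(\<Sum>k'\<in>{..<N} - J. w k') = (\<Sum>\<sigma>\<in>F. \<Sum>k'\<in>{..<N} - J. v (\<sigma> k'))" unfolding w_def by (rule sum.swap)
    also have "\<dots> = (\<Sum>\<sigma>\<in>F. sum v ({..<N} - I))"
    proof (rule sum.cong)
      fix \<sigma> assume \<sigma>: "\<sigma> \<in> F"
      then have p: "\<sigma> permutes {..<N}" "\<sigma> ` J = I" by (auto simp: F_def)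
      have "inj_on \<sigma> ({..<N} - J)" using p(1) by (rule permutes_inj_on)
      moreover have "\<sigma> ` ({..<N} - J) = {..<N} - I"
        using image_set_diff[OF permutes_inj[OF p(1)], of "{..<N}" J] permutes_image[OF p(1)] p(2) by simp
      ultimately show "(\<Sum>k'\<in>{..<N} - J. v (\<sigma> k')) = sum v ({..<N} - I)"
        using sum.reindex[of \<sigma> "{..<N} - J" v] by simp
    qed simp
    also have "\<dots> = card F * ((real N - real r) * t)" using tI by simp
    finally have "(\<Sum>k'\<in>{..<N} - J. w k') = card F * ((real N - real r) * t)" .
    moreover have "(\<Sum>k'\<in>{..<N} - J. w k') = (\<Sum>k'\<in>{..<N} - J. w k)"
      using k by (intro sum.cong w_const) auto
    moreover have "card ({..<N} - J) = N - r" using J finJ by (simp add: card_Diff_subset r_def)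
    ultimately have "(real N - real r) * w k = (real N - real r) * (card F * t)"
      using rltN by (simp add: of_nat_diff)
    then show ?thesis using rltN by simp
  qed
  \<comment> \<open>\<open>w\<close> is an affine function of the indicator of \<open>J\<close> with
    slope \<open>card F * (s - t)\<close>. So the loss of the indicator is controlled by that of
    \<open>w\<close>, which in turn is controlled by the losses of the single
    rearrangements.\<close>
  have "(card F * (s - t))\<^sup>2 * Q (\<lambda>k. of_bool (k \<in> J)) = Q (\<lambda>k. card F * t + card F * (s - t) * of_bool (k \<in> J))"
    by (rule Q_affine[symmetric])
  also have "\<dots> = Q w"
    by (rule Q_cong) (use w_in w_out in \<open>auto simp: algebra_simps\<close>)
  also have "\<dots> \<le> card F * (\<Sum>\<sigma>\<in>F. Q (\<lambda>k. v (\<sigma> k)))"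
    unfolding w_def by (rule Q_sum[OF F])
  also have "\<dots> \<le> card F * (\<Sum>\<sigma>\<in>F. c)"
    using perm by (intro mult_left_mono sum_mono) (auto simp: F_def)
  also have "\<dots> = (card F)\<^sup>2 * c" by (simp add: power2_eq_square)
  finally have "(card F)\<^sup>2 * ((s - t)\<^sup>2 * Q (\<lambda>k. of_bool (k \<in> J))) \<le> (card F)\<^sup>2 * c"
    by (simp add: power_mult_distrib mult_ac)
  then have "(s - t)\<^sup>2 * Q (\<lambda>k. of_bool (k \<in> J)) \<le> c" using cF by simp
  moreover have "\<kappa>\<^sup>2 * Q (\<lambda>k. of_bool (k \<in> J)) \<le> (s - t)\<^sup>2 * Q (\<lambda>k. of_bool (k \<in> J))"
    using gap \<kappa> Q_nonneg by (intro mult_right_mono power_mono) auto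
  ultimately show ?thesis by linarith
qed

end

section \<open>Defect with respect to a partition\<close>

text \<open>For an equipartition this is the squared L2 distance from the indicator of
  \<open>B\<close> to its conditional expectation along \<open>Q\<close>. It vanishes exactly when
  \<open>B\<close> is a union of cells up to a null set.\<close>

definition defect :: "'a measure \<Rightarrow> nat \<Rightarrow> (nat \<Rightarrow> 'a set) \<Rightarrow> 'a set \<Rightarrow> real" where
  "defect M N Q B = measure M B - N * (\<Sum>k<N. (measure M (B \<inter> Q k))\<^sup>2)"

text \<open>Each cell is preserved as a set, modulo null sets; inside the cells an element may act
  arbitrarily.\<close>

definition stab :: "'a measure \<Rightarrow> nat \<Rightarrow> (nat \<Rightarrow> 'a set) \<Rightarrow> ('a \<Rightarrow> 'a) set set" where
  "stab M n P = {g\<in>carrier (Aut M). \<forall>i<n. set_dist M (act g (P i)) (P i) = 0}"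

context prob_space
begin

lemma dd_partition:
  assumes P: "finite_partition M n P" and B: "B \<in> sets M" "C \<in> sets M"
  shows "dd B C = (\<Sum>k<n. dd (B \<inter> P k) (C \<inter> P k))"
proof -
  have "(\<Sum>k<n. measure M (((B - C) \<union> (C - B)) \<inter> P k)) = dd B C"
    unfolding set_dist_def by (rule sum_measure_Int_partition[OF P]) (use B in auto)
  moreover have "((B - C) \<union> (C - B)) \<inter> P k = (B \<inter> P k - C \<inter> P k) \<union> (C \<inter> P k - B \<inter> P k)" for k by auto
  ultimately show ?thesis by (simp add: set_dist_def)
qed

text \<open>On each cell the difference of squares has the factor a + b, which is at most 2/N. So
  the energy term contributes twice the distance, and the measure contributes it once more.\<close>

lemma defect_lipschitz:
  assumes Q: "equipartition M N Q" and B: "B \<in> sets M" "C \<in> sets M"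
  shows "\<bar>defect M N Q B - defect M N Q C\<bar> \<le> 3 * dd B C"
proof -
  note Qs = equipartitionD[OF Q]
  have le: "measure M (E \<inter> Q k) \<le> 1 / N" if "k < N" "E \<in> sets M" for k E
    using finite_measure_mono[of "E \<inter> Q k" "Q k"] Qs(2,3) that by simp
  have N0: "0 < N" using Qs(1) by (rule finite_partition_pos)
  have "\<bar>(\<Sum>k<N. (measure M (B \<inter> Q k))\<^sup>2) - (\<Sum>k<N. (measure M (C \<inter> Q k))\<^sup>2)\<bar> \<le>
      (\<Sum>k<N. \<bar>(measure M (B \<inter> Q k))\<^sup>2 - (measure M (C \<inter> Q k))\<^sup>2\<bar>)"
    unfolding sum_subtractf[symmetric] by (rule sum_abs)
  also have "\<dots> \<le> (\<Sum>k<N. dd (B \<inter> Q k) (C \<inter> Q k) * (2 / N))"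
  proof (rule sum_mono)
    fix k assume "k \<in> {..<N}"
    then have k: "k < N" by simp
    have "\<bar>(measure M (B \<inter> Q k))\<^sup>2 - (measure M (C \<inter> Q k))\<^sup>2\<bar> =
        \<bar>measure M (B \<inter> Q k) - measure M (C \<inter> Q k)\<bar> * (measure M (B \<inter> Q k) + measure M (C \<inter> Q k))"
      by (simp add: power2_eq_square square_diff_square_factored abs_mult)
    also have "\<dots> \<le> dd (B \<inter> Q k) (C \<inter> Q k) * (2 / N)"
      using dd_measure_le[of "B \<inter> Q k" "C \<inter> Q k"] le[OF k B(1)] le[OF k B(2)] Qs(2)[OF k] B
      by (intro mult_mono) auto
    finally show "\<bar>(measure M (B \<inter> Q k))\<^sup>2 - (measure M (C \<inter> Q k))\<^sup>2\<bar> \<le> dd (B \<inter> Q k) (C \<inter> Q k) * (2 / N)" .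
  qed
  also have "\<dots> = dd B C * (2 / N)" by (simp only: dd_partition[OF Qs(1) B] sum_distrib_right)
  finally have "N * \<bar>(\<Sum>k<N. (measure M (B \<inter> Q k))\<^sup>2) - (\<Sum>k<N. (measure M (C \<inter> Q k))\<^sup>2)\<bar> \<le> 2 * dd B C"
    using N0 by (simp add: field_simps)
  then have "\<bar>N * (\<Sum>k<N. (measure M (B \<inter> Q k))\<^sup>2) - N * (\<Sum>k<N. (measure M (C \<inter> Q k))\<^sup>2)\<bar> \<le> 2 * dd B C"
    by (simp add: right_diff_distrib[symmetric] abs_mult)
  then show ?thesis unfolding defect_def using dd_measure_le[OF B] by linarith
qed

lemma defect_nonneg:
  assumes Q: "equipartition M N Q" and B: "B \<in> sets M"
  shows "0 \<le> defect M N Q B"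
proof -
  note Qs = equipartitionD[OF Q]
  have N0: "0 < N" using Qs(1) by (rule finite_partition_pos)
  have "N * (\<Sum>k<N. (measure M (B \<inter> Q k))\<^sup>2) \<le> (\<Sum>k<N. measure M (B \<inter> Q k))"
    unfolding sum_distrib_left
  proof (rule sum_mono)
    fix k assume "k \<in> {..<N}"
    then have "measure M (B \<inter> Q k) \<le> 1 / N"
      using finite_measure_mono[of "B \<inter> Q k" "Q k"] Qs(2,3) by simp
    then have "N * measure M (B \<inter> Q k) * measure M (B \<inter> Q k) \<le> 1 * measure M (B \<inter> Q k)"
      using N0 by (intro mult_right_mono) (auto simp: field_simps)
    then show "N * (measure M (B \<inter> Q k))\<^sup>2 \<le> measure M (B \<inter> Q k)" by (simp add: power2_eq_square mult_ac)
  qed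
  then show ?thesis unfolding defect_def sum_measure_Int_partition[OF Qs(1) B] by simp
qed

text \<open>The density x of \<open>B\<close> on each cell is rounded to 0 or 1. The rounding error
  min(x, 1 - x) is at most 2x(1 - x), and the average of x(1 - x) over the cells is the
  defect.\<close>

lemma small_defect_approx:
  assumes Q: "equipartition M N Q" and B: "B \<in> sets M"
  shows "\<exists>K\<subseteq>{..<N}. dd B (\<Union>k\<in>K. Q k) \<le> 2 * defect M N Q B"
proof -
  note Qs = equipartitionD[OF Q]
  have N0: "0 < N" using Qs(1) by (rule finite_partition_pos)
  define x where "x k = measure M (B \<inter> Q k)" for k
  define K where "K = {k\<in>{..<N}. 1 / 2 \<le> N * x k}"
  define C where "C = (\<Union>k\<in>K. Q k)"
  have K: "K \<subseteq> {..<N}" "finite K" by (auto simp: K_def)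
  have Cs: "C \<in> sets M" using K Qs(2) by (auto simp: C_def)
  have x: "0 \<le> x k" "N * x k \<le> 1" if "k < N" for k
    using finite_measure_mono[of "B \<inter> Q k" "Q k"] Qs(2,3)[OF that] N0 by (auto simp: x_def field_simps)
  have "dd (B \<inter> Q k) (C \<inter> Q k) \<le> 2 * (x k - N * (x k)\<^sup>2)" if k: "k < N" for k
  proof (cases "k \<in> K")
    case True
    then have "C \<inter> Q k = Q k" by (auto simp: C_def)
    then have "((B \<inter> Q k) - (C \<inter> Q k)) \<union> ((C \<inter> Q k) - (B \<inter> Q k)) = Q k - (B \<inter> Q k)" by auto
    then have "dd (B \<inter> Q k) (C \<inter> Q k) = 1 / N - x k"
      using finite_measure_Diff[of "Q k" "B \<inter> Q k"] Qs(2,3)[OF k] B by (simp add: set_dist_def x_def)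
    also have "\<dots> \<le> 2 * (x k - N * (x k)\<^sup>2)"
    proof -
      have "(1 - N * x k) * 1 \<le> (1 - N * x k) * (2 * (N * x k))"
        using True x[OF k] by (intro mult_left_mono) (auto simp: K_def)
      then show ?thesis using N0 by (simp add: field_simps power2_eq_square)
    qed
    finally show ?thesis .
  next
    case False
    have "C \<inter> Q k = {}"
      using finite_partitionD(4)[OF Qs(1)] K(1) k False unfolding C_def by blast
    then have "dd (B \<inter> Q k) (C \<inter> Q k) = x k" by (simp add: set_dist_def x_def)
    also have "\<dots> \<le> 2 * (x k - N * (x k)\<^sup>2)"
    proof -
      have "x k * (N * x k) \<le> x k * (1 / 2)"
        using False x[OF k] k by (intro mult_left_mono) (auto simp: K_def)
      then show ?thesis by (simp add: power2_eq_square mult_ac)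
    qed
    finally show ?thesis .
  qed
  then have "dd B C \<le> (\<Sum>k<N. 2 * (x k - N * (x k)\<^sup>2))"
    unfolding dd_partition[OF Qs(1) B Cs] by (intro sum_mono) auto
  also have "\<dots> = 2 * defect M N Q B"
    unfolding defect_def sum_measure_Int_partition[OF Qs(1) B, symmetric]
    by (simp add: x_def sum_distrib_left sum_subtractf algebra_simps)
  finally show ?thesis using K(1) unfolding C_def by blast
qed

lemma dd_equal_measure:
  assumes "A \<in> sets M" "B \<in> sets M" "measure M A = measure M B"
  shows "dd A B = 2 * measure M (A - B)"
proof -
  have "measure M (A - B) = measure M A - measure M (A \<inter> B)" "measure M (B - A) = measure M B - measure M (A \<inter> B)"
    using assms by (simp_all add: finite_measure_Diff' Int_commute)
  moreover have "dd A B = measure M (A - B) + measure M (B - A)"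
    unfolding set_dist_def by (rule finite_measure_Union) (use assms in auto)
  ultimately show ?thesis using assms(3) by simp
qed

text \<open>The inverse of \<open>h\<close> fixes \<open>A\<close> as well, so the conjugate acts on
  \<open>A\<close> as \<open>g\<close> followed by \<open>h\<close>.\<close>

lemma act_stab_conj:
  assumes g: "g \<in> carrier (Aut M)" and h: "h \<in> carrier (Aut M)" and A: "A \<in> sets M"
    and hA: "dd (act h A) A = 0"
  shows "dd (act (h \<otimes>\<^bsub>Aut M\<^esub> g \<otimes>\<^bsub>Aut M\<^esub> inv\<^bsub>Aut M\<^esub> h) A) (act h (act g A)) = 0"
proof -
  interpret group "Aut M" by (rule group_Aut)
  have ih: "inv\<^bsub>Aut M\<^esub> h \<in> carrier (Aut M)" and hg: "h \<otimes>\<^bsub>Aut M\<^esub> g \<in> carrier (Aut M)" using g h by auto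
  have ihA: "act (inv\<^bsub>Aut M\<^esub> h) A \<in> sets M" "act g A \<in> sets M" using ih g A by auto
  have "dd A (act (inv\<^bsub>Aut M\<^esub> h) A) = 0" using hA dd_act_left[OF h A A] by simp
  then have "dd (act (inv\<^bsub>Aut M\<^esub> h) A) A = 0" by (simp add: dd_commute)
  then have 1: "dd (act (h \<otimes>\<^bsub>Aut M\<^esub> g) (act (inv\<^bsub>Aut M\<^esub> h) A)) (act (h \<otimes>\<^bsub>Aut M\<^esub> g) A) = 0"
    by (simp only: dd_act[OF hg ihA(1) A])
  have "dd (act (h \<otimes>\<^bsub>Aut M\<^esub> g \<otimes>\<^bsub>Aut M\<^esub> inv\<^bsub>Aut M\<^esub> h) A) (act (h \<otimes>\<^bsub>Aut M\<^esub> g) A) = 0"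
    by (rule dd_trans_0[OF dd_act_mult[OF hg ih A] 1])
      (use hg ih A act_sets[OF hg ihA(1)] in \<open>simp_all add: m_closed\<close>)
  then show ?thesis
    by (rule dd_trans_0[OF _ dd_act_mult[OF h g A]])
      (use hg ih A act_sets[OF h ihA(2)] in \<open>simp_all add: m_closed\<close>)
qed

end

context atomless_standard_space
begin

text \<open>This is \<open>spread\<close> along the partition into \<open>A\<close> and its
  complement, with \<open>Q\<close> in both other roles: inside \<open>A\<close> and outside, the
  image of \<open>Q\<close> becomes independent of \<open>Q\<close>.\<close>

lemma mixing_automorphism:
  assumes Q: "equipartition M N Q" and A: "A \<in> sets M"
  shows "\<exists>h\<in>carrier (Aut M). dd (act h A) A = 0 \<and> (\<forall>k<N. \<forall>l<N. measure M (act h (Q k) \<inter> Q l) =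
     measure M (Q k \<inter> A) * measure M (Q l \<inter> A) / measure M A +
     measure M (Q k - A) * measure M (Q l - A) / measure M (space M - A))"
proof -
  note Qs = equipartitionD[OF Q]
  define R where "R = (\<lambda>k::nat. if k = 0 then A else space M - A)"
  have two: "{..<2::nat} = {0, 1}" by auto
  have R: "finite_partition M 2 R"
    unfolding finite_partition_def two using A sets.sets_into_space[OF A]
    by (auto simp: R_def disjoint_family_on_def)
  obtain h where h: "h \<in> carrier (Aut M)" "\<And>k. k < 2 \<Longrightarrow> dd (act h (R k)) (R k) = 0"
    "\<And>k l. k < N \<Longrightarrow> l < N \<Longrightarrow> measure M (act h (Q k) \<inter> Q l) =
       (\<Sum>a<2. measure M (Q k \<inter> R a) * measure M (Q l \<inter> R a) / measure M (R a))"
    using spread[OF R Qs(1) Qs(1)] by blast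
  have diff: "Q k \<inter> (space M - A) = Q k - A" if "k < N" for k
    using sets.sets_into_space[OF Qs(2)[OF that]] by auto
  have "dd (act h A) A = 0" using h(2)[of 0] by (simp add: R_def)
  moreover have "measure M (act h (Q k) \<inter> Q l) =
     measure M (Q k \<inter> A) * measure M (Q l \<inter> A) / measure M A +
     measure M (Q k - A) * measure M (Q l - A) / measure M (space M - A)" if "k < N" "l < N" for k l
    unfolding h(3)[OF that] two using that by (simp add: R_def diff)
  ultimately show ?thesis using h(1) by blast
qed

lemma measure_Int_UN_cells:
  assumes Q: "equipartition M N Q" and K: "K \<subseteq> {..<N}" and A: "A \<in> sets M"
  shows "measure M ((\<Union>k\<in>K. Q k) \<inter> A) = (\<Sum>k\<in>K. measure M (Q k \<inter> A))"
proof -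
  note Qs = equipartitionD[OF Q]
  have "measure M (\<Union>k\<in>K. Q k \<inter> A) = (\<Sum>k\<in>K. measure M (Q k \<inter> A))"
  proof (rule finite_measure_finite_Union)
    show "finite K" using K finite_subset by blast
    show "disjoint_family_on (\<lambda>k. Q k \<inter> A) K"
      using finite_partitionD(4)[OF Qs(1)] K unfolding disjoint_family_on_def by blast
  qed (use Qs(2) K A in auto)
  moreover have "(\<Union>k\<in>K. Q k) \<inter> A = (\<Union>k\<in>K. Q k \<inter> A)" by auto
  ultimately show ?thesis by (simp only:)
qed

text \<open>As far as the cells of \<open>Q\<close> can see, the mixed set has constant density
  \<open>x\<close> on \<open>A\<close> and \<open>y\<close> off \<open>A\<close>. By convexity its
  energy is at most \<open>x\<^sup>2 * \<beta> + y\<^sup>2 * (1 - \<beta>)\<close>, while its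
  measure is \<open>x * \<beta> + \<eta>\<close>. The part over \<open>A\<close> contributes a
  nonnegative amount to the difference, and the part off \<open>A\<close> contributes the stated
  bound.\<close>

lemma defect_mixed:
  assumes Q: "equipartition M N Q" and K: "K \<subseteq> {..<N}" and A: "A \<in> sets M"
    and b: "measure M A = \<beta>" "0 < \<beta>" "\<beta> < 1"
    and h: "h \<in> carrier (Aut M)" "\<And>k l. k < N \<Longrightarrow> l < N \<Longrightarrow> measure M (act h (Q k) \<inter> Q l) =
     measure M (Q k \<inter> A) * measure M (Q l \<inter> A) / measure M A +
     measure M (Q k - A) * measure M (Q l - A) / measure M (space M - A)"
    and \<eta>: "\<eta> = measure M ((\<Union>k\<in>K. Q k) - A)"
  shows "\<eta> * (1 - \<eta> / (1 - \<beta>)) \<le> defect M N Q (act h (\<Union>k\<in>K. Q k))"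
proof -
  note Qs = equipartitionD[OF Q]
  have N0: "0 < N" using Qs(1) by (rule finite_partition_pos)
  define C where "C = (\<Union>k\<in>K. Q k)"
  have Cs: "C \<in> sets M" using K Qs(2) finite_subset[OF K] by (auto simp: C_def)
  have cA: "measure M (space M - A) = 1 - \<beta>" using A b by (simp add: prob_compl)
  define x where "x = measure M (C \<inter> A) / \<beta>"
  define y where "y = \<eta> / (1 - \<beta>)"
  have E: "measure M E = measure M (E \<inter> A) + measure M (E - A)" if "E \<in> sets M" for E
  proof -
    have "measure M ((E \<inter> A) \<union> (E - A)) = measure M (E \<inter> A) + measure M (E - A)"
      by (rule finite_measure_Union) (use that A in auto)
    moreover have "(E \<inter> A) \<union> (E - A) = E" by auto
    ultimately show ?thesis by simp
  qed
  have x01: "0 \<le> x" "x \<le> 1"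
    using finite_measure_mono[of "C \<inter> A" A] A b by (auto simp: x_def)
  have hC: "measure M (act h C \<inter> Q l) = x * measure M (Q l \<inter> A) + y * measure M (Q l - A)" if l: "l < N" for l
  proof -
    have "measure M (act h C \<inter> Q l) = (\<Sum>k\<in>K. measure M (act h (Q k) \<inter> Q l))"
      using measure_Int_UN_cells[OF equipartition_act[OF Q h(1)] K Qs(2)[OF l]]
      by (simp add: C_def act_UN[OF h(1)])
    also have "\<dots> = (\<Sum>k\<in>K. measure M (Q k \<inter> A)) * measure M (Q l \<inter> A) / \<beta> +
        (\<Sum>k\<in>K. measure M (Q k - A)) * measure M (Q l - A) / (1 - \<beta>)"
      using K l b cA by (simp add: h(2) subset_iff sum.distrib sum_distrib_right sum_divide_distrib)
    also have "(\<Sum>k\<in>K. measure M (Q k \<inter> A)) = measure M (C \<inter> A)"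
      using measure_Int_UN_cells[OF Q K A] by (simp add: C_def)
    also have "(\<Sum>k\<in>K. measure M (Q k - A)) = \<eta>"
    proof -
      have sp: "Q k \<inter> (space M - A) = Q k - A" if "k \<in> K" for k
        using sets.sets_into_space[OF Qs(2)] K that by blast
      have "C \<inter> (space M - A) = C - A" using sets.sets_into_space[OF Cs] by auto
      then show ?thesis
        using measure_Int_UN_cells[OF Q K, of "space M - A"] A sp by (simp add: C_def \<eta>)
    qed
    finally show ?thesis by (simp add: x_def y_def)
  qed
  \<comment> \<open>Convexity of the square with the weights \<open>N * ?a\<close> and
    \<open>N * ?b\<close>, whose sum is 1.\<close>
  have sqle: "N * (measure M (act h C \<inter> Q l))\<^sup>2 \<le> x\<^sup>2 * measure M (Q l \<inter> A) + y\<^sup>2 * measure M (Q l - A)" if l: "l < N" for l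
  proof -
    let ?a = "measure M (Q l \<inter> A)" and ?b = "measure M (Q l - A)"
    have ab: "?a + ?b = 1 / N" "0 \<le> ?a" "0 \<le> ?b" using E[OF Qs(2)[OF l]] Qs(3)[OF l] by auto
    have "(?a + ?b) * (x\<^sup>2 * ?a + y\<^sup>2 * ?b) - (x * ?a + y * ?b)\<^sup>2 = ?a * ?b * (x - y)\<^sup>2"
      by (simp add: algebra_simps power2_eq_square)
    moreover have "0 \<le> ?a * ?b * (x - y)\<^sup>2" using ab by simp
    ultimately have "(x * ?a + y * ?b)\<^sup>2 \<le> (?a + ?b) * (x\<^sup>2 * ?a + y\<^sup>2 * ?b)" by linarith
    then have "(measure M (act h C \<inter> Q l))\<^sup>2 \<le> (1 / N) * (x\<^sup>2 * ?a + y\<^sup>2 * ?b)"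
      unfolding ab(1) hC[OF l] .
    moreover have "N * u \<le> z" if "u \<le> 1 / N * z" for u z :: real using that N0 by (simp add: field_simps)
    ultimately show ?thesis by blast
  qed
  have "N * (\<Sum>l<N. (measure M (act h C \<inter> Q l))\<^sup>2) \<le> (\<Sum>l<N. x\<^sup>2 * measure M (Q l \<inter> A) + y\<^sup>2 * measure M (Q l - A))"
    unfolding sum_distrib_left using sqle by (intro sum_mono) auto
  also have "\<dots> = x\<^sup>2 * (\<Sum>l<N. measure M (A \<inter> Q l)) + y\<^sup>2 * (\<Sum>l<N. measure M ((space M - A) \<inter> Q l))"
  proof -
    have "Q l - A = (space M - A) \<inter> Q l" if "l < N" for l
      using sets.sets_into_space[OF Qs(2)[OF that]] by auto
    then show ?thesis by (simp add: sum.distrib sum_distrib_left Int_commute)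
  qed
  also have "\<dots> = x\<^sup>2 * \<beta> + y\<^sup>2 * (1 - \<beta>)"
    using sum_measure_Int_partition[OF Qs(1) A] sum_measure_Int_partition[OF Qs(1), of "space M - A"] A b cA by simp
  finally have 1: "N * (\<Sum>l<N. (measure M (act h C \<inter> Q l))\<^sup>2) \<le> x\<^sup>2 * \<beta> + y\<^sup>2 * (1 - \<beta>)" .
  have mC: "measure M (act h C) = x * \<beta> + \<eta>"
    using E[OF Cs] h(1) Cs b by (simp add: x_def C_def \<eta>)
  have "x\<^sup>2 * \<beta> \<le> x * \<beta>" 
    using x01 b by (intro mult_right_mono) (auto simp: power2_eq_square intro: mult_left_le)
  moreover have "y\<^sup>2 * (1 - \<beta>) = \<eta> * (\<eta> / (1 - \<beta>))" using b by (simp add: y_def power2_eq_square)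
  ultimately show ?thesis using 1 mC unfolding defect_def C_def[symmetric] by (simp add: algebra_simps)
qed

end

section \<open>Group topologies coarser than the weak topology\<close>

text \<open>Coarser includes equal, so that the case \<open>S = weak_topology M\<close> is one side
  of the dichotomy. Pullbacks of topologies on quotient groups have to be instances.\<close>

locale coarser_group_topology = atomless_standard_space M for M :: "'a measure" +
  fixes S :: "('a \<Rightarrow> 'a) set topology"
  assumes S_group: "topological_group (Aut M) S"
    and S_coarser: "\<And>U. openin S U \<Longrightarrow> openin (weak_topology M) U"
begin

sublocale G: group "Aut M"
  by (rule group_Aut)

abbreviation mult_Aut (infixl "\<star>" 70) where "g \<star> h \<equiv> g \<otimes>\<^bsub>Aut M\<^esub> h"
abbreviation inv_Aut' ("\<iota>") where "\<iota> g \<equiv> inv\<^bsub>Aut M\<^esub> g"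
abbreviation "carr \<equiv> carrier (Aut M)"

definition unit_nbhds :: "('a \<Rightarrow> 'a) set set set" where
  "unit_nbhds = {W. openin S W \<and> \<one>\<^bsub>Aut M\<^esub> \<in> W}"

lemma unit_nbhds_carr: "W \<in> unit_nbhds \<Longrightarrow> W \<subseteq> carr"
  using openin_subset[of S] topological_groupD(2)[OF S_group] by (auto simp: unit_nbhds_def)

lemma unit_nbhds_Int: "V \<in> unit_nbhds \<Longrightarrow> W \<in> unit_nbhds \<Longrightarrow> V \<inter> W \<in> unit_nbhds"
  by (auto simp: unit_nbhds_def)

lemma unit_nbhds_INT:
  assumes "finite I" "W \<in> unit_nbhds" "\<And>i. i \<in> I \<Longrightarrow> V i \<in> unit_nbhds"
  shows "W \<inter> (\<Inter>i\<in>I. V i) \<in> unit_nbhds"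
  using assms
proof (induction I)
  case (insert i I)
  have "W \<inter> (\<Inter>i\<in>insert i I. V i) = V i \<inter> (W \<inter> (\<Inter>i\<in>I. V i))" by auto
  then show ?case using insert unit_nbhds_Int by auto
qed simp

lemma unit_nbhds_square:
  assumes W: "W \<in> unit_nbhds"
  obtains V where "V \<in> unit_nbhds" "V \<subseteq> W" "\<And>x. x \<in> V \<Longrightarrow> \<iota> x \<in> V" "\<And>x y. x \<in> V \<Longrightarrow> y \<in> V \<Longrightarrow> x \<star> y \<in> W"
proof -
  note D = topological_groupD[OF S_group]
  have WS: "openin S W" "\<one>\<^bsub>Aut M\<^esub> \<star> \<one>\<^bsub>Aut M\<^esub> \<in> W" using W by (auto simp: unit_nbhds_def)
  from D(3)[OF WS(1) G.one_closed G.one_closed WS(2)]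
  obtain V1 V2 where V12: "openin S V1" "openin S V2" "\<one>\<^bsub>Aut M\<^esub> \<in> V1" "\<one>\<^bsub>Aut M\<^esub> \<in> V2"
    "\<forall>x\<in>V1. \<forall>y\<in>V2. x \<star> y \<in> W" by (elim exE conjE)
  define V3 where "V3 = V1 \<inter> V2"
  have V3: "openin S V3" "\<one>\<^bsub>Aut M\<^esub> \<in> V3" using V12 by (auto simp: V3_def)
  have V3c: "V3 \<subseteq> carr" using openin_subset[OF V3(1)] D(2) by simp
  define V where "V = V3 \<inter> {x \<in> topspace S. \<iota> x \<in> V3}"
  have "continuous_map S S (\<lambda>x. \<iota> x)" using S_group by (simp add: topological_group_def)
  then have "openin S {x \<in> topspace S. \<iota> x \<in> V3}" using V3(1) by (rule openin_continuous_map_preimage)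
  then have "V \<in> unit_nbhds" using V3 D(2) by (auto simp: V_def unit_nbhds_def)
  moreover have "\<iota> x \<in> V" if "x \<in> V" for x
    using that V3c D(2) by (auto simp: V_def)
  moreover have mul: "x \<star> y \<in> W" if "x \<in> V" "y \<in> V" for x y
    using that V12(5) by (auto simp: V_def V3_def)
  moreover have "V \<subseteq> W"
  proof
    fix x assume x: "x \<in> V"
    then have "x \<star> \<one>\<^bsub>Aut M\<^esub> \<in> W" using V12 by (auto simp: V_def V3_def)
    then show "x \<in> W" using x V3c by (auto simp: V_def)
  qed
  ultimately show thesis using that by blast
qed

lemma unit_nbhds_conj:
  assumes W: "W \<in> unit_nbhds" and h: "h \<in> carr"
  shows "{g\<in>carr. h \<star> g \<star> \<iota> h \<in> W} \<in> unit_nbhds"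
proof -
  have "openin S W" using W by (simp add: unit_nbhds_def)
  then have "openin S {x\<in>carr. x \<star> \<iota> h \<in> W}" by (rule openin_translate(2)[OF S_group]) (use h in simp)
  then have "openin S {x\<in>carr. h \<star> x \<in> {x\<in>carr. x \<star> \<iota> h \<in> W}}" by (rule openin_translate(1)[OF S_group]) (rule h)
  moreover have "{x\<in>carr. h \<star> x \<in> {x\<in>carr. x \<star> \<iota> h \<in> W}} = {g\<in>carr. h \<star> g \<star> \<iota> h \<in> W}"
    using h by auto
  ultimately show ?thesis using W h by (simp add: unit_nbhds_def)
qed

text \<open>A weak neighbourhood tests finitely many sets, each within \<open>e / 4\<close> of a
  union of cells of a fine equipartition. An element that moves every cell by less than
  \<open>e / (4 * n)\<close> moves such a set by at most three quarters of \<open>e\<close>. Since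
  every large \<open>n\<close> works, \<open>k\<close> can be made a divisor and \<open>A0\<close>
  can be approximated by the same partition.\<close>

lemma unit_nbhds_partition:
  assumes W: "W \<in> unit_nbhds" and k: "0 < k" and A0: "A0 \<in> sets M" and d: "0 < d"
  obtains n P e where "k dvd n" "equipartition M n P" "0 < e"
    "\<And>g. g \<in> carr \<Longrightarrow> (\<And>i. i < n \<Longrightarrow> dd (act g (P i)) (P i) < e) \<Longrightarrow> g \<in> W"
    "\<exists>I\<subseteq>{..<n}. dd A0 (\<Union>i\<in>I. P i) \<le> d"
proof -
  have "openin (weak_topology M) W" "\<one>\<^bsub>Aut M\<^esub> \<in> W" using W S_coarser by (auto simp: unit_nbhds_def)
  from openin_weak_imp_nbhd[OF this] obtain \<A> e
    where A: "finite \<A>" "\<A> \<subseteq> sets M" "0 < e" "nbhd \<one>\<^bsub>Aut M\<^esub> \<A> e \<subseteq> W" by (elim exE conjE)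
  obtain P where P: "\<And>n. 0 < n \<Longrightarrow> equipartition M n (P n)"
    "\<And>A e. A \<in> sets M \<Longrightarrow> 0 < e \<Longrightarrow> \<exists>n0. \<forall>n\<ge>n0. \<exists>I\<subseteq>{..<n}. dd A (\<Union>i\<in>I. P n i) \<le> e"
    by (rule approximating_equipartitions, rule that)
  define e' where "e' = min (e / 4) d"
  have e': "0 < e'" "e' \<le> e / 4" "e' \<le> d" using A(3) d by (auto simp: e'_def)
  have "\<exists>n0. \<forall>n\<ge>n0. \<exists>I\<subseteq>{..<n}. dd A (\<Union>i\<in>I. P n i) \<le> e'" if "A \<in> insert A0 \<A>" for A
    by (rule P(2)) (use that A A0 e' in auto)
  then obtain n0 where n0: "\<And>A n. A \<in> insert A0 \<A> \<Longrightarrow> n \<ge> n0 A \<Longrightarrow> \<exists>I\<subseteq>{..<n}. dd A (\<Union>i\<in>I. P n i) \<le> e'"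
    by metis
  define n where "n = k * Suc (Max (n0 ` insert A0 \<A>))"
  have n: "0 < n" "k dvd n" using k by (auto simp: n_def)
  have nge: "n \<ge> n0 A" if "A \<in> insert A0 \<A>" for A
  proof -
    have "n0 A \<le> Max (n0 ` insert A0 \<A>)" using that A(1) by (intro Max_ge) auto
    also have "\<dots> \<le> Suc (Max (n0 ` insert A0 \<A>))" by simp
    also have "\<dots> \<le> n" 
    proof -
      have "X \<le> k * X" for X :: nat using k by (cases k) auto
      then show ?thesis unfolding n_def .
    qed
    finally show ?thesis .
  qed
  note Ps = equipartitionD[OF P(1)[OF n(1)]]
  have "g \<in> W" if g: "g \<in> carr" and close: "\<And>i. i < n \<Longrightarrow> dd (act g (P n i)) (P n i) < e / (4 * n)" for g
  proof -
    have "dd (act g A) (act \<one>\<^bsub>Aut M\<^esub> A) < e" if AA: "A \<in> \<A>" for A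
    proof -
      have As: "A \<in> sets M" using A(2) AA by auto
      obtain I where I: "I \<subseteq> {..<n}" "dd A (\<Union>i\<in>I. P n i) \<le> e'" using n0[of A n] nge[of A] AA by auto
      have Ifin: "finite I" using I(1) finite_subset by blast
      define C where "C = (\<Union>i\<in>I. P n i)"
      have Cs: "C \<in> sets M" unfolding C_def by (rule sets.finite_UN[OF Ifin]) (use Ps(2) I in auto)
      have "dd (act g C) C \<le> (\<Sum>i\<in>I. dd (act g (P n i)) (P n i))"
        unfolding C_def act_UN[OF g] by (rule dd_UN[OF Ifin]) (use Ps(2) I g in auto)
      also have "\<dots> \<le> (\<Sum>i\<in>I. e / (4 * n))"
        using close I(1) by (intro sum_mono less_imp_le) auto
      also have "\<dots> = card I * (e / (4 * n))" by simp
      also have "\<dots> \<le> n * (e / (4 * n))"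
        by (rule mult_right_mono) (use card_mono[OF _ I(1)] A(3) in auto)
      also have "\<dots> = e / 4" using n by simp
      finally have gC: "dd (act g C) C \<le> e / 4" .
      have "dd (act g A) (act \<one>\<^bsub>Aut M\<^esub> A) = dd (act g A) A"
        by (rule dd_cong) (use dd_act_one[OF As] g As in auto)
      also have "\<dots> \<le> dd (act g A) (act g C) + dd (act g C) A"
        by (rule dd_triangle) (use g As Cs in auto)
      also have "dd (act g C) A \<le> dd (act g C) C + dd C A"
        by (rule dd_triangle) (use g As Cs in auto)
      also have "dd (act g A) (act g C) = dd A C" by (rule dd_act[OF g As Cs])
      finally have "dd (act g A) (act \<one>\<^bsub>Aut M\<^esub> A) \<le> dd A C + (e / 4 + dd A C)" using gC by (simp add: dd_commute)
      then show ?thesis using I(2) e'(2) A(3) unfolding C_def by linarith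
    qed
    then show ?thesis using A(4) g by (auto simp: nbhd_def)
  qed
  moreover have "\<exists>I\<subseteq>{..<n}. dd A0 (\<Union>i\<in>I. P n i) \<le> d"
    using n0[of A0 n] nge[of A0] e'(3) by (meson insertI1 order_trans)
  moreover have "0 < e / (4 * n)" using A(3) n by simp
  ultimately show thesis using that[OF n(2) P(1)[OF n(1)]] by blast
qed

lemma unit_nbhds_stab:
  assumes W: "W \<in> unit_nbhds" and k: "0 < k"
  obtains N Q where "k dvd N" "equipartition M N Q" "stab M N Q \<subseteq> W"
proof -
  obtain n P e where P: "k dvd n" "equipartition M n P" "0 < e"
    "\<And>g. g \<in> carr \<Longrightarrow> (\<And>i. i < n \<Longrightarrow> dd (act g (P i)) (P i) < e) \<Longrightarrow> g \<in> W"
    "\<exists>I\<subseteq>{..<n}. dd {} (\<Union>i\<in>I. P i) \<le> 1"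
    by (rule unit_nbhds_partition[OF W k, of "{}" 1]) (auto intro: that)
  have "stab M n P \<subseteq> W" using P(3,4) by (auto simp: stab_def)
  then show thesis using that P(1,2) by blast
qed

text \<open>If a small \<open>g\<close> sends \<open>P j\<close> close to a union of cells of \<open>Q\<close>, then its conjugate by an
  automorphism that mixes \<open>Q\<close> inside and outside \<open>P j\<close> sends \<open>P j\<close> to a set that is spread evenly
  over the complement of \<open>P j\<close>, hence far from every union of cells. This needs \<open>P j\<close> to be too small
  to fill its complement.\<close>

lemma defect_bounded_below:
  assumes P: "equipartition M n P" and n3: "3 \<le> n" and \<epsilon>: "0 < \<epsilon>"
    and moved: "\<And>W. W \<in> unit_nbhds \<Longrightarrow> \<exists>g\<in>W. \<exists>j<n. \<epsilon> \<le> dd (act g (P j)) (P j)"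
  obtains \<gamma> where "0 < \<gamma>"
    "\<And>W N Q. W \<in> unit_nbhds \<Longrightarrow> equipartition M N Q \<Longrightarrow> \<exists>g\<in>W. \<exists>j<n. \<gamma> \<le> defect M N Q (act g (P j))"
proof -
  note Ps = equipartitionD[OF P]
  \<comment> \<open>If all defects are below \<open>\<gamma>\<close>, then \<open>C\<close> is
    within \<open>2 * \<gamma>\<close> of \<open>B\<close>, and the mixed set has defect below
    \<open>7 * \<gamma>\<close> by the Lipschitz bound. As \<open>B\<close> has measure at least
    \<open>\<epsilon> / 2 \<ge> 30 * \<gamma>\<close> outside \<open>A\<close>, one gets
    \<open>\<eta> \<ge> 28 * \<gamma>\<close>. The bound 1/12 keeps \<open>\<eta>\<close> at most
    1/3 + 1/6, so that at least the quarter of \<open>\<eta>\<close> survives in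
    \<open>defect_mixed\<close>, which is the contradictory \<open>7 * \<gamma>\<close>.\<close>
  define \<gamma> where "\<gamma> = min (\<epsilon> / 60) (1 / 12)"
  have \<gamma>: "0 < \<gamma>" "60 * \<gamma> \<le> \<epsilon>" "\<gamma> \<le> 1 / 12" using \<epsilon> by (auto simp: \<gamma>_def)
  have "\<exists>g\<in>W. \<exists>j<n. \<gamma> \<le> defect M N Q (act g (P j))"
    if W: "W \<in> unit_nbhds" and Q: "equipartition M N Q" for W N Q
  proof (rule ccontr)
    assume neg: "\<not> (\<exists>g\<in>W. \<exists>j<n. \<gamma> \<le> defect M N Q (act g (P j)))"
    define Phi where "Phi A h \<longleftrightarrow> h \<in> carr \<and> dd (act h A) A = 0 \<and>
      (\<forall>k<N. \<forall>l<N. measure M (act h (Q k) \<inter> Q l) =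
        measure M (Q k \<inter> A) * measure M (Q l \<inter> A) / measure M A +
        measure M (Q k - A) * measure M (Q l - A) / measure M (space M - A))" for A h
    have "\<exists>h. Phi (P j) h" if "j < n" for j
      using mixing_automorphism[OF Q Ps(2)[OF that]] unfolding Phi_def by blast
    then obtain h where h: "\<And>j. j < n \<Longrightarrow> Phi (P j) (h j)" by metis
    have hc: "h j \<in> carr" if "j < n" for j using h[OF that] by (simp add: Phi_def)
    \<comment> \<open>Shrunk so that not only \<open>g\<close> but also its conjugates by the
      finitely many mixing automorphisms lie in \<open>W\<close>.\<close>
    define W' where "W' = W \<inter> (\<Inter>j\<in>{..<n}. {g\<in>carr. h j \<star> g \<star> \<iota> (h j) \<in> W})"
    have "W' \<in> unit_nbhds"
      unfolding W'_def using W hc by (intro unit_nbhds_INT unit_nbhds_conj) auto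
    then obtain g j where gj: "g \<in> W'" "j < n" "\<epsilon> \<le> dd (act g (P j)) (P j)" using moved by blast
    define A where "A = P j"
    define B where "B = act g A"
    define g' where "g' = h j \<star> g \<star> \<iota> (h j)"
    have gW: "g \<in> W" "g' \<in> W" using gj by (auto simp: W'_def g'_def)
    have gc: "g \<in> carr" "g' \<in> carr" using gW unit_nbhds_carr[OF W] by auto
    have As: "A \<in> sets M" "B \<in> sets M" using gj Ps(2) gc by (auto simp: A_def B_def)
    have dB: "defect M N Q B < \<gamma>" "defect M N Q (act g' A) < \<gamma>"
      using neg gW gj by (auto simp: B_def A_def not_le)
    obtain K where K: "K \<subseteq> {..<N}" "dd B (\<Union>k\<in>K. Q k) \<le> 2 * defect M N Q B"
      using small_defect_approx[OF Q As(2)] by blast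
    define C where "C = (\<Union>k\<in>K. Q k)"
    have Cs: "C \<in> sets M"
      unfolding C_def by (rule sets.finite_UN[OF finite_subset[OF K(1)]]) (use K equipartitionD(2)[OF Q] in auto)
    have BC: "dd B C \<le> 2 * \<gamma>" using K(2) dB by (simp add: C_def)
    define \<beta> where "\<beta> = 1 / real n"
    have \<beta>: "measure M A = \<beta>" "0 < \<beta>" "\<beta> \<le> 1 / 3"
      using Ps(3)[OF gj(2)] n3 by (auto simp: A_def \<beta>_def field_simps)
    define \<eta> where "\<eta> = measure M (C - A)"
    have hP: "dd (act (h j) A) A = 0"
      "\<And>k l. k < N \<Longrightarrow> l < N \<Longrightarrow> measure M (act (h j) (Q k) \<inter> Q l) =
        measure M (Q k \<inter> A) * measure M (Q l \<inter> A) / measure M A +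
        measure M (Q k - A) * measure M (Q l - A) / measure M (space M - A)"
      using h[OF gj(2)] by (auto simp: Phi_def A_def)
    have hmix: "\<eta> * (1 - \<eta> / (1 - \<beta>)) \<le> defect M N Q (act (h j) C)"
      unfolding C_def
      by (rule defect_mixed[OF Q K(1) As(1) \<beta>(1,2) _ hc[OF gj(2)] hP(2)]) (use \<beta> in \<open>auto simp: \<eta>_def C_def\<close>)
    have "dd (act g' A) (act (h j) B) = 0"
      unfolding g'_def B_def by (rule act_stab_conj[OF gc(1) hc[OF gj(2)] As(1) hP(1)])
    then have "dd (act g' A) (act (h j) C) \<le> 2 * \<gamma>"
      using dd_triangle[of "act g' A" "act (h j) B" "act (h j) C"] BC gc hc[OF gj(2)] As Cs by simp
    then have def_close: "defect M N Q (act (h j) C) < \<gamma> + 6 * \<gamma>"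
      using defect_lipschitz[OF Q, of "act g' A" "act (h j) C"] dB(2) gc hc[OF gj(2)] As Cs by simp
    have "2 * measure M (B - A) = dd B A"
      by (rule dd_equal_measure[symmetric]) (use As gc in \<open>auto simp: B_def\<close>)
    then have BA: "\<epsilon> / 2 \<le> measure M (B - A)" using gj(3) by (simp add: B_def A_def)
    have "\<bar>measure M (B \<inter> (space M - A)) - measure M (C \<inter> (space M - A))\<bar> \<le> dd B C"
      by (rule measure_Int_le_dd) (use As Cs in auto)
    moreover have "B \<inter> (space M - A) = B - A" "C \<inter> (space M - A) = C - A"
      using sets.sets_into_space[OF As(2)] sets.sets_into_space[OF Cs] by auto
    ultimately have \<eta>_ge: "28 * \<gamma> \<le> \<eta>" using BC BA \<gamma>(2) unfolding \<eta>_def by simp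
    have "\<eta> \<le> measure M C" unfolding \<eta>_def by (rule finite_measure_mono) (use Cs in auto)
    also have "\<dots> \<le> measure M B + 2 * \<gamma>" using dd_measure_le[OF As(2) Cs] BC by linarith
    also have "measure M B = \<beta>" using \<beta>(1) gc As by (simp add: B_def)
    finally have "\<eta> \<le> 1 / 2" using \<beta>(3) \<gamma>(3) by linarith
    then have "\<eta> / (1 - \<beta>) \<le> (1 / 2) / (2 / 3)" using \<beta> \<eta>_ge \<gamma>(1) by (intro frac_le) auto
    then have "\<eta> * (1 / 4) \<le> \<eta> * (1 - \<eta> / (1 - \<beta>))" using \<eta>_ge \<gamma>(1) by (intro mult_left_mono) auto
    then show False using hmix def_close \<eta>_ge by linarith
  qed
  then show thesis using that[OF \<gamma>(1)] by blast
qed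

end

section \<open>The energy argument\<close>

context atomless_standard_space
begin

text \<open>The factor \<open>N\<close> is the reciprocal of the measure of a cell and turns the sum
  of squares into the squared norm of a conditional expectation. For equipartitions the value lies
  between \<open>1 / n\<close>, reached when all the sets are independent of \<open>Q\<close>, and
  1.\<close>

definition potential :: "nat \<Rightarrow> (nat \<Rightarrow> 'a set) \<Rightarrow> ('a \<Rightarrow> 'a) set \<Rightarrow> nat \<Rightarrow> (nat \<Rightarrow> 'a set) \<Rightarrow> real" where
  "potential n P g N Q = (\<Sum>i<n. N * (\<Sum>k<N. (measure M (act g (P i) \<inter> Q k))\<^sup>2))"

text \<open>Each summand is \<open>1 / n\<close> minus a defect, and defects are
  nonnegative.\<close>

lemma potential_le_1:
  assumes P: "equipartition M n P" and Q: "equipartition M N Q" and g: "g \<in> carrier (Aut M)"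
  shows "potential n P g N Q \<le> 1"
proof -
  note Ps = equipartitionD[OF P]
  have n: "0 < n" using Ps(1) by (rule finite_partition_pos)
  have "potential n P g N Q \<le> (\<Sum>i<n. 1 / n)"
    unfolding potential_def
  proof (rule sum_mono)
    fix i assume "i \<in> {..<n}"
    then have i: "i < n" by simp
    show "N * (\<Sum>k<N. (measure M (act g (P i) \<inter> Q k))\<^sup>2) \<le> 1 / n"
      using defect_nonneg[OF Q act_sets[OF g Ps(2)[OF i]]] act_measure[OF g Ps(2)[OF i]] Ps(3)[OF i]
      by (simp add: defect_def)
  qed
  then show ?thesis using n by simp
qed

end

context coarser_group_topology
begin

text \<open>Conjugation by \<open>h\<close> carries the stabilizer of \<open>Q\<close> onto the
  stabilizer of the translated partition.\<close>

lemma stab_translate: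
  assumes Q: "equipartition M N Q" and h: "h \<in> carr" and V: "V \<subseteq> carr"
    and sub: "stab M N Q \<subseteq> {x\<in>carr. h \<star> x \<star> \<iota> h \<in> V}"
  shows "stab M N (\<lambda>l. act h (Q l)) \<subseteq> V"
proof
  fix y assume y: "y \<in> stab M N (\<lambda>l. act h (Q l))"
  then have yc: "y \<in> carr" by (simp add: stab_def)
  define x where "x = \<iota> h \<star> y \<star> h"
  have ih: "\<iota> h \<in> carr" and xc: "x \<in> carr" using h yc by (auto simp: x_def)
  have "dd (act x (Q l)) (Q l) = 0" if l: "l < N" for l
  proof -
    have Ql: "Q l \<in> sets M" using equipartitionD(2)[OF Q l] .
    have hQ: "act h (Q l) \<in> sets M" using h Ql by simp
    have yh: "y \<star> h \<in> carr" using yc h by simp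
    have "dd (act (\<iota> h \<star> (y \<star> h)) (Q l)) (act (\<iota> h) (act (y \<star> h) (Q l))) = 0"
      by (rule dd_act_mult[OF ih yh Ql])
    moreover have "dd (act (\<iota> h) (act (y \<star> h) (Q l))) (act (\<iota> h) (act y (act h (Q l)))) = 0"
      using dd_act_mult[OF yc h Ql] dd_act[OF ih act_sets[OF yh Ql] act_sets[OF yc hQ]] by simp
    moreover have "dd (act (\<iota> h) (act y (act h (Q l)))) (act (\<iota> h) (act h (Q l))) = 0"
      using y l dd_act[OF ih act_sets[OF yc hQ] hQ] by (simp add: stab_def)
    moreover have "dd (act (\<iota> h) (act h (Q l))) (Q l) = 0" by (rule dd_act_inv(1)[OF h Ql])
    moreover have "x = \<iota> h \<star> (y \<star> h)" using h yc by (simp add: x_def G.m_assoc)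
    ultimately show ?thesis
      using dd_trans_0[OF dd_trans_0[OF dd_trans_0]] ih yh yc hQ Ql xc
        act_sets[OF xc Ql] act_sets[OF ih act_sets[OF yh Ql]] act_sets[OF ih act_sets[OF yc hQ]] act_sets[OF ih hQ]
      by (metis (no_types, lifting))
  qed
  then have "x \<in> stab M N Q" using xc by (simp add: stab_def)
  then have "h \<star> x \<star> \<iota> h \<in> V" using sub by blast
  moreover have "h \<star> x \<star> \<iota> h = y"
  proof -
    have "h \<star> (\<iota> h \<star> y) = y" using h yc ih G.m_assoc[of h "\<iota> h" y] by simp
    then show ?thesis using h yc ih by (simp add: x_def G.m_assoc)
  qed
  ultimately show "y \<in> V" by simp
qed

text \<open>The factor \<open>p\<close> makes the cells \<open>h (Q2 l)\<close>, pulled back by the conjugate of \<open>g2\<close>, independent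
  of the sets \<open>g (P i)\<close> inside each cell of \<open>Q\<close>.\<close>

lemma product_energy:
  assumes P: "equipartition M n P" and Q: "equipartition M N Q" and R: "equipartition M N R"
    and Q2: "equipartition M N2 Q2"
    and g: "g \<in> carr" and g2: "g2 \<in> carr" and h: "h \<in> carr"
    and \<sigma>: "\<sigma> permutes {..<N}" and hR: "\<And>k. k < N \<Longrightarrow> dd (act h (R k)) (Q (\<sigma> k)) = 0"
  obtains p where "p \<in> stab M N Q"
    "potential n P ((h \<star> g2 \<star> \<iota> h) \<star> (p \<star> g)) N2 (\<lambda>l. act h (Q2 l)) =
     (\<Sum>i<n. N2 * (\<Sum>l<N2. (\<Sum>k<N. (N * measure M (act g (P i) \<inter> Q (\<sigma> k))) * measure M (act g2 (R k) \<inter> Q2 l))\<^sup>2))"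
proof -
  note Ps = equipartitionD[OF P] and Qs = equipartitionD[OF Q] and Rs = equipartitionD[OF R]
    and Q2s = equipartitionD[OF Q2]
  define f where "f = h \<star> g2 \<star> \<iota> h"
  have c: "f \<in> carr" "\<iota> h \<in> carr" "h \<star> g2 \<in> carr" "\<iota> f \<in> carr" using h g2 by (auto simp: f_def)
  \<comment> \<open>The target cells pulled back by \<open>f\<close>. Intersecting the image under
    \<open>f \<star> (p \<star> g)\<close> with a target cell then amounts to intersecting the image
    under \<open>p \<star> g\<close> with \<open>C l\<close>, to which \<open>spread\<close>
    applies.\<close>
  define C where "C l = act (\<iota> f) (act h (Q2 l))" for l
  have C: "finite_partition M N2 C"
    unfolding C_def by (intro finite_partition_act Q2s(1) h c)
  have B: "finite_partition M n (\<lambda>i. act g (P i))" by (rule finite_partition_act[OF Ps(1) g])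
  obtain p where p: "p \<in> carr" "\<And>k. k < N \<Longrightarrow> dd (act p (Q k)) (Q k) = 0"
    "\<And>i l. i < n \<Longrightarrow> l < N2 \<Longrightarrow> measure M (act p (act g (P i)) \<inter> C l) =
       (\<Sum>k<N. measure M (act g (P i) \<inter> Q k) * measure M (C l \<inter> Q k) / measure M (Q k))"
    using spread[OF Qs(1) B C] by blast
  have pg: "p \<star> g \<in> carr" using p g by simp
  \<comment> \<open>The inverse of \<open>h\<close> takes \<open>Q (\<sigma> k)\<close> to
    \<open>R k\<close>, so \<open>f\<close> takes it to the \<open>h\<close>-image of
    \<open>act g2 (R k)\<close>. Then \<open>h\<close> cancels against the \<open>h\<close> in the
    target cell.\<close>
  have CQ: "measure M (C l \<inter> Q (\<sigma> k)) = measure M (act g2 (R k) \<inter> Q2 l)" if l: "l < N2" and k: "k < N" for l k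
  proof -
    have \<sigma>k: "\<sigma> k < N" using permutes_in_image[OF \<sigma>, of k] k by simp
    note sets = Q2s(2)[OF l] Rs(2)[OF k] Qs(2)[OF \<sigma>k]
    have fQ: "dd (act f (Q (\<sigma> k))) (act h (act g2 (R k))) = 0"
    proof (rule dd_trans_0)
      have "dd (act (\<iota> h) (Q (\<sigma> k))) (R k) = 0"
        using hR[OF k] dd_act_left[OF h sets(2,3)] by (simp add: dd_commute)
      then show "dd (act (h \<star> g2) (act (\<iota> h) (Q (\<sigma> k)))) (act h (act g2 (R k))) = 0"
        using dd_trans_0[of "act (h \<star> g2) (act (\<iota> h) (Q (\<sigma> k)))" "act (h \<star> g2) (R k)" "act h (act g2 (R k))"]
          dd_act_mult[OF h g2 sets(2)] dd_act[OF c(3) act_sets[OF c(2) sets(3)] sets(2)]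
          act_sets[OF c(3) act_sets[OF c(2) sets(3)]] act_sets[OF c(3) sets(2)] act_sets[OF h act_sets[OF g2 sets(2)]]
        by simp
      show "dd (act f (Q (\<sigma> k))) (act (h \<star> g2) (act (\<iota> h) (Q (\<sigma> k)))) = 0"
        unfolding f_def by (rule dd_act_mult[OF c(3,2) sets(3)])
    qed (use sets c h g2 in simp_all)
    have "measure M (C l \<inter> Q (\<sigma> k)) = measure M (act f (Q (\<sigma> k)) \<inter> act h (Q2 l))"
      using measure_act_Int[OF c(1) sets(3) act_sets[OF h sets(1)]] by (simp add: C_def Int_commute)
    also have "\<dots> = measure M (act h (act g2 (R k)) \<inter> act h (Q2 l))"
      by (rule measure_Int_cong[OF _ _ _ fQ]) (use sets c h g2 in simp_all)
    also have "\<dots> = measure M (act h (act g2 (R k) \<inter> Q2 l))"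
      by (simp only: act_Int[OF h act_sets[OF g2 sets(2)] sets(1)])
    also have "\<dots> = measure M (act g2 (R k) \<inter> Q2 l)"
      by (rule act_measure[OF h]) (intro sets.Int act_sets[OF g2] sets)
    finally show ?thesis .
  qed
  have "measure M (act (f \<star> (p \<star> g)) (P i) \<inter> act h (Q2 l)) =
      (\<Sum>k<N. (N * measure M (act g (P i) \<inter> Q (\<sigma> k))) * measure M (act g2 (R k) \<inter> Q2 l))"
    if i: "i < n" and l: "l < N2" for i l
  proof -
    note Pi = Ps(2)[OF i]
    have hQ: "act h (Q2 l) \<in> sets M" using h Q2s(2)[OF l] by simp
    have "measure M (act (f \<star> (p \<star> g)) (P i) \<inter> act h (Q2 l)) = measure M (act f (act (p \<star> g) (P i)) \<inter> act h (Q2 l))"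
      by (rule measure_Int_cong[OF _ _ hQ dd_act_mult[OF c(1) pg Pi]]) (use c pg Pi in simp_all)
    also have "\<dots> = measure M (act (p \<star> g) (P i) \<inter> C l)"
      unfolding C_def by (rule measure_act_Int[OF c(1) act_sets[OF pg Pi] hQ])
    also have "\<dots> = measure M (act p (act g (P i)) \<inter> C l)"
      by (rule measure_Int_cong[OF _ _ _ dd_act_mult[OF p(1) g Pi]])
        (use p(1) g pg Pi finite_partitionD(1)[OF C l] in simp_all)
    also have "\<dots> = (\<Sum>k<N. (N * measure M (act g (P i) \<inter> Q k)) * measure M (C l \<inter> Q k))"
      unfolding p(3)[OF i l] by (intro sum.cong refl) (simp add: Qs(3))
    also have "\<dots> = (\<Sum>k<N. (N * measure M (act g (P i) \<inter> Q (\<sigma> k))) * measure M (C l \<inter> Q (\<sigma> k)))"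
      using sum.permute[OF \<sigma>, of "\<lambda>k. (N * measure M (act g (P i) \<inter> Q k)) * measure M (C l \<inter> Q k)"]
      by (simp add: comp_def)
    also have "\<dots> = (\<Sum>k<N. (N * measure M (act g (P i) \<inter> Q (\<sigma> k))) * measure M (act g2 (R k) \<inter> Q2 l))"
      using CQ[OF l] by (intro sum.cong) auto
    finally show ?thesis .
  qed
  then have "potential n P (f \<star> (p \<star> g)) N2 (\<lambda>l. act h (Q2 l)) =
     (\<Sum>i<n. N2 * (\<Sum>l<N2. (\<Sum>k<N. (N * measure M (act g (P i) \<inter> Q (\<sigma> k))) * measure M (act g2 (R k) \<inter> Q2 l))\<^sup>2))"
    unfolding potential_def by simp
  then show thesis using that[of p] p(1,2) by (auto simp: stab_def f_def)
qed

text \<open>The element and the stabilizer of the partition have to be small simultaneously, since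
  elements of the stabilizer are used as further factors. Divisibility leaves room for a refinement
  of \<open>P\<close> with exactly \<open>N\<close> cells, which can be matched with the cells of
  \<open>Q\<close>.\<close>

definition admissible :: "nat \<Rightarrow> ('a \<Rightarrow> 'a) set set \<Rightarrow> ('a \<Rightarrow> 'a) set \<Rightarrow> nat \<Rightarrow> (nat \<Rightarrow> 'a set) \<Rightarrow> bool" where
  "admissible n W g N Q \<longleftrightarrow> g \<in> W \<and> equipartition M N Q \<and> n dvd N \<and> stab M N Q \<subseteq> W"

text \<open>If the energy were almost minimal on \<open>W'\<close>, then multiplication with every conjugate of \<open>g2\<close> by
  a permutation of the cells would lose little energy, and by averaging over permutations
  \<open>g2\<close> would send each \<open>P j\<close> close to a union of cells.\<close>

lemma potential_increment:
  assumes P: "equipartition M n P" and \<gamma>: "0 < \<gamma>" and \<kappa>: "0 < \<kappa>"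
    and def: "\<And>W N Q. W \<in> unit_nbhds \<Longrightarrow> equipartition M N Q \<Longrightarrow> \<exists>g\<in>W. \<exists>j<n. \<gamma> \<le> defect M N Q (act g (P j))"
    and W0: "W0 \<in> unit_nbhds"
    and spreadless: "\<And>g N Q. admissible n W0 g N Q \<Longrightarrow>
       \<exists>i<n. (1 / n)\<^sup>2 + \<kappa> < N * (\<Sum>k<N. (measure M (act g (P i) \<inter> Q k))\<^sup>2)"
    and W: "W \<in> unit_nbhds" and a: "\<And>g N Q. admissible n W g N Q \<Longrightarrow> a \<le> potential n P g N Q"
  shows "\<exists>W'\<in>unit_nbhds. \<forall>g N Q. admissible n W' g N Q \<longrightarrow> a + \<kappa>\<^sup>2 * \<gamma> / 2 \<le> potential n P g N Q"
proof -
  \<comment> \<open>Half of the loss that the rearrangements would force, so that the final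
    comparison is strict.\<close>
  define c where "c = \<kappa>\<^sup>2 * \<gamma> / 2"
  note Ps = equipartitionD[OF P]
  have n: "0 < n" using Ps(1) by (rule finite_partition_pos)
  \<comment> \<open>Two successive neighbourhoods are needed because a product of three elements of
    \<open>W'\<close> has to stay in \<open>W\<close>: the conjugate of \<open>g2\<close>, the
    generic \<open>p\<close>, and \<open>g\<close>.\<close>
  obtain V where V: "V \<in> unit_nbhds" "V \<subseteq> W \<inter> W0" "\<And>x. x \<in> V \<Longrightarrow> \<iota> x \<in> V"
      "\<And>x y. x \<in> V \<Longrightarrow> y \<in> V \<Longrightarrow> x \<star> y \<in> W \<inter> W0"
    by (rule unit_nbhds_square[OF unit_nbhds_Int[OF W W0]]) (auto intro: that)
  obtain W' where W': "W' \<in> unit_nbhds" "W' \<subseteq> V" "\<And>x. x \<in> W' \<Longrightarrow> \<iota> x \<in> W'"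
      "\<And>x y. x \<in> W' \<Longrightarrow> y \<in> W' \<Longrightarrow> x \<star> y \<in> V"
    by (rule unit_nbhds_square[OF V(1)]) (auto intro: that)
  have W'c: "W' \<subseteq> carr" using unit_nbhds_carr[OF W'(1)] .
  have "a + c \<le> potential n P g N Q" if adm: "admissible n W' g N Q" for g N Q
  proof (rule ccontr)
    assume less: "\<not> a + c \<le> potential n P g N Q"
    have g: "g \<in> W'" "g \<in> carr" and Q: "equipartition M N Q" and nN: "n dvd N" and sQ: "stab M N Q \<subseteq> W'"
      using adm W'c by (auto simp: admissible_def)
    note Qs = equipartitionD[OF Q]
    have N: "0 < N" using Qs(1) by (rule finite_partition_pos)
    obtain r where r: "N = n * r" "0 < r" using nN N by (metis dvdE gr0I mult_0_right)
    \<comment> \<open>\<open>R\<close> refines \<open>P\<close> and has as many cells as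
      \<open>Q\<close>, so every permutation of the indices is realized by an automorphism from the
      cells of \<open>R\<close> to those of \<open>Q\<close>.\<close>
    obtain R where R: "equipartition M N R" "\<And>j. j < n \<Longrightarrow> P j = (\<Union>k\<in>{j*r..<Suc j * r}. R k)"
      using refine_equipartition[OF P r(2)] r(1) by blast
    note Rs = equipartitionD[OF R(1)]
    define Phi where "Phi \<sigma> h \<longleftrightarrow> h \<in> carr \<and> (\<forall>k<N. dd (act h (R k)) (Q (\<sigma> k)) = 0)" for \<sigma> h
    have "\<exists>h. Phi \<sigma> h" if \<sigma>: "\<sigma> permutes {..<N}" for \<sigma>
    proof -
      have \<sigma>N: "\<sigma> k < N" if "k < N" for k using permutes_in_image[OF \<sigma>, of k] that by simp
      have "\<exists>h\<in>carr. \<forall>k\<in>{..<N}. dd (act h (R k)) (Q (\<sigma> k)) = 0"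
      proof (rule move_family)
        show "disjoint_family_on (\<lambda>k. Q (\<sigma> k)) {..<N}"
          unfolding disjoint_family_on_def
        proof (intro ballI impI)
          fix k k' assume "k \<in> {..<N}" "k' \<in> {..<N}" "k \<noteq> k'"
          then show "Q (\<sigma> k) \<inter> Q (\<sigma> k') = {}"
            using finite_partitionD(4)[OF Qs(1), of "\<sigma> k" "\<sigma> k'"] \<sigma>N permutes_inj[OF \<sigma>] by (auto dest: injD)
        qed
      qed (use Rs Qs \<sigma>N finite_partitionD(2)[OF Rs(1)] in auto)
      then show ?thesis by (auto simp: Phi_def)
    qed
    then obtain h where h: "\<And>\<sigma>. \<sigma> permutes {..<N} \<Longrightarrow> Phi \<sigma> (h \<sigma>)" by metis
    define \<P> where "\<P> = {\<sigma>. \<sigma> permutes {..<N}}"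
    have fP: "finite \<P>" by (simp add: \<P>_def finite_permutations)
    \<comment> \<open>So small that \<open>g2\<close>, and likewise the stabilizer of the partition
      \<open>Q2\<close> chosen next, remain in \<open>W'\<close> after conjugation with the
      automorphism of any permutation.\<close>
    define W2 where "W2 = W' \<inter> (\<Inter>\<sigma>\<in>\<P>. {x\<in>carr. h \<sigma> \<star> x \<star> \<iota> (h \<sigma>) \<in> W'})"
    have W2: "W2 \<in> unit_nbhds"
      unfolding W2_def
      by (intro unit_nbhds_INT[OF fP W'(1)] unit_nbhds_conj[OF W'(1)]) (use h in \<open>auto simp: \<P>_def Phi_def\<close>)
    obtain N2 Q2 where Q2: "n dvd N2" "equipartition M N2 Q2" "stab M N2 Q2 \<subseteq> W2"
      by (rule unit_nbhds_stab[OF W2 n])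
    note Q2s = equipartitionD[OF Q2(2)]
    have N2: "0 < N2" using Q2s(1) by (rule finite_partition_pos)
    obtain g2 j where g2: "g2 \<in> W2" "j < n" "\<gamma> \<le> defect M N2 Q2 (act g2 (P j))" using def[OF W2 Q2(2)] by blast
    have g2c: "g2 \<in> carr" using g2 unit_nbhds_carr[OF W2] by blast
    \<comment> \<open>Both the images of the cells of \<open>R\<close> and the cells of
      \<open>Q2\<close> are equipartitions, so their intersections have uniform marginals.\<close>
    define m where "m k l = measure M (act g2 (R k) \<inter> Q2 l)" for k l
    have g2R: "equipartition M N (\<lambda>k. act g2 (R k))" by (rule equipartition_act[OF R(1) g2c])
    interpret B: bistochastic N N2 m
    proof
      show "(\<Sum>l<N2. m k l) = 1 / N" if "k < N" for k
        unfolding m_def using sum_measure_Int_partition[OF Q2s(1), of "act g2 (R k)"] equipartitionD(2,3)[OF g2R that]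
        by simp
      show "(\<Sum>k<N. m k l) = 1 / N2" if "l < N2" for l
        using sum_measure_Int_partition[OF equipartitionD(1)[OF g2R] Q2s(2)[OF that]] Q2s(3)[OF that]
        by (simp add: m_def Int_commute)
    qed (auto simp: N N2 m_def)
    define v where "v i k = N * measure M (act g (P i) \<inter> Q k)" for i k
    \<comment> \<open>Multiplication by the conjugate of \<open>g2\<close> replaces the densities
      \<open>v i\<close>, rearranged by \<open>\<sigma>\<close>, by their conditional expectations
      with respect to \<open>m\<close>. The product is admissible for \<open>W\<close>, so its
      energy is at least \<open>a\<close>, whereas that of \<open>g\<close> is below
      \<open>a + c\<close>. The losses therefore add up to at most \<open>c\<close>, for every
      permutation.\<close>
    have energy: "(\<Sum>i<n. energy_loss N N2 m (\<lambda>k. v i (\<sigma> k))) \<le> c" if \<sigma>: "\<sigma> permutes {..<N}" for \<sigma>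
    proof -
      have hc: "h \<sigma> \<in> carr" "\<And>k. k < N \<Longrightarrow> dd (act (h \<sigma>) (R k)) (Q (\<sigma> k)) = 0"
        using h[OF \<sigma>] by (auto simp: Phi_def)
      obtain p where p: "p \<in> stab M N Q"
        "potential n P ((h \<sigma> \<star> g2 \<star> \<iota> (h \<sigma>)) \<star> (p \<star> g)) N2 (\<lambda>l. act (h \<sigma>) (Q2 l)) =
         (\<Sum>i<n. N2 * (\<Sum>l<N2. (\<Sum>k<N. (N * measure M (act g (P i) \<inter> Q (\<sigma> k))) * measure M (act g2 (R k) \<inter> Q2 l))\<^sup>2))"
        by (rule product_energy[OF P Q R(1) Q2(2) g(2) g2c hc(1) \<sigma> hc(2)])
      have hg: "h \<sigma> \<star> g2 \<star> \<iota> (h \<sigma>) \<in> W'" using g2(1) \<sigma> by (auto simp: W2_def \<P>_def)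
      have "p \<star> g \<in> V" using p(1) sQ g W'(4) by blast
      then have "(h \<sigma> \<star> g2 \<star> \<iota> (h \<sigma>)) \<star> (p \<star> g) \<in> W" using hg V(4) W'(2) by blast
      moreover have "stab M N2 (\<lambda>l. act (h \<sigma>) (Q2 l)) \<subseteq> W"
      proof -
        have "stab M N2 (\<lambda>l. act (h \<sigma>) (Q2 l)) \<subseteq> W'"
          by (rule stab_translate[OF Q2(2) hc(1) W'c]) (use Q2(3) \<sigma> in \<open>auto simp: W2_def \<P>_def\<close>)
        then show ?thesis using W'(2) V(2) by blast
      qed
      ultimately have "admissible n W ((h \<sigma> \<star> g2 \<star> \<iota> (h \<sigma>)) \<star> (p \<star> g)) N2 (\<lambda>l. act (h \<sigma>) (Q2 l))"
        using Q2(1) equipartition_act[OF Q2(2) hc(1)] by (simp add: admissible_def)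
      from a[OF this] have "a \<le> (\<Sum>i<n. N2 * (\<Sum>l<N2. (\<Sum>k<N. v i (\<sigma> k) * m k l)\<^sup>2))"
        unfolding p(2) v_def m_def .
      moreover have "potential n P g N Q = (\<Sum>i<n. (\<Sum>k<N. (v i (\<sigma> k))\<^sup>2) / N)"
        unfolding potential_def
      proof (rule sum.cong)
        fix i
        have "(\<Sum>k<N. (v i (\<sigma> k))\<^sup>2) = (\<Sum>k<N. (v i k)\<^sup>2)"
          using sum.permute[OF \<sigma>, of "\<lambda>k. (v i k)\<^sup>2"] by (simp add: comp_def)
        also have "\<dots> = (real N)\<^sup>2 * (\<Sum>k<N. (measure M (act g (P i) \<inter> Q k))\<^sup>2)"
          by (simp add: v_def power_mult_distrib sum_distrib_left)
        finally show "N * (\<Sum>k<N. (measure M (act g (P i) \<inter> Q k))\<^sup>2) = (\<Sum>k<N. (v i (\<sigma> k))\<^sup>2) / N"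
          using N by (simp add: power2_eq_square)
      qed simp
      ultimately show ?thesis
        using less unfolding energy_loss_def by (simp add: sum_subtractf)
    qed
    have "admissible n W0 g N Q" using adm W'(2) V(2) unfolding admissible_def by blast
    from spreadless[OF this] obtain i where i: "i < n"
      "(1 / n)\<^sup>2 + \<kappa> < N * (\<Sum>k<N. (measure M (act g (P i) \<inter> Q k))\<^sup>2)" by blast
    have gPi: "act g (P i) \<in> sets M" "measure M (act g (P i)) = 1 / n" using g(2) Ps(2,3)[OF i(1)] by auto
    \<comment> \<open>The block of the cells of \<open>R\<close> that make up \<open>P j\<close>.
      Its proportion among all cells is \<open>1 / n\<close>, which is also the mean of the density
      \<open>v i\<close>, as \<open>rearrangement_energy\<close> requires.\<close>
    define J where "J = {j*r..<Suc j * r}"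
    have J: "J \<subseteq> {..<N}" "card J = r"
    proof -
      have "Suc j * r \<le> n * r" using g2(2) by (intro mult_le_mono1) simp
      then show "J \<subseteq> {..<N}" by (auto simp: J_def r(1))
      show "card J = r" by (simp add: J_def)
    qed
    have rN: "card J / N = 1 / n" using J r n by simp
    have "\<kappa>\<^sup>2 * energy_loss N N2 m (\<lambda>k. of_bool (k \<in> J)) \<le> c"
    proof (rule B.rearrangement_energy[where v = "v i"])
      show "0 \<le> v i k" for k by (simp add: v_def)
      show "v i k \<le> 1" if k: "k < N" for k
        using finite_measure_mono[of "act g (P i) \<inter> Q k" "Q k"] Qs(2,3)[OF k] N by (simp add: v_def field_simps)
      show "(\<Sum>k<N. v i k) = card J"
        using sum_measure_Int_partition[OF Qs(1) gPi(1)] gPi(2) J(2) r n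
        by (simp add: v_def sum_distrib_left[symmetric])
      show "(card J / N)\<^sup>2 + \<kappa> < (\<Sum>k<N. (v i k)\<^sup>2) / N"
      proof -
        have "(\<Sum>k<N. (v i k)\<^sup>2) = (real N)\<^sup>2 * (\<Sum>k<N. (measure M (act g (P i) \<inter> Q k))\<^sup>2)"
          by (simp add: v_def power_mult_distrib sum_distrib_left)
        then show ?thesis using i(2) N unfolding rN by (simp add: power2_eq_square)
      qed
      show "energy_loss N N2 m (\<lambda>k. v i (\<sigma> k)) \<le> c" if "\<sigma> permutes {..<N}" for \<sigma>
      proof -
        have "energy_loss N N2 m (\<lambda>k. v i (\<sigma> k)) \<le> (\<Sum>i<n. energy_loss N N2 m (\<lambda>k. v i (\<sigma> k)))"
          by (rule member_le_sum) (use i(1) B.Q_nonneg in auto)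
        then show ?thesis using energy[OF that] by simp
      qed
    qed (use J \<kappa> in auto)
    \<comment> \<open>Summing \<open>m\<close> over the block gives the intersections of
      \<open>act g2 (P j)\<close> with the cells of \<open>Q2\<close>, so here the loss is literally
      a defect, and that defect is at least \<open>\<gamma>\<close>.\<close>
    moreover have "energy_loss N N2 m (\<lambda>k. of_bool (k \<in> J)) = defect M N2 Q2 (act g2 (P j))"
    proof -
      have "(\<Sum>k<N. (of_bool (k \<in> J) :: real)\<^sup>2) = (\<Sum>k\<in>J. 1)"
        using J(1) by (intro sum.mono_neutral_cong_right) auto
      moreover have "(\<Sum>k<N. of_bool (k \<in> J) * m k l) = measure M (act g2 (P j) \<inter> Q2 l)" if l: "l < N2" for l
      proof -
        have "(\<Sum>k<N. of_bool (k \<in> J) * m k l) = (\<Sum>k\<in>J. m k l)"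
          using J(1) by (intro sum.mono_neutral_cong_right) auto
        also have "\<dots> = measure M ((\<Union>k\<in>J. act g2 (R k)) \<inter> Q2 l)"
          unfolding m_def by (rule measure_Int_UN_cells[OF g2R J(1) Q2s(2)[OF l], symmetric])
        also have "(\<Union>k\<in>J. act g2 (R k)) = act g2 (P j)"
          unfolding R(2)[OF g2(2)] J_def by (rule act_UN[OF g2c, symmetric])
        finally show ?thesis .
      qed
      moreover have "measure M (act g2 (P j)) = card J / N"
        using g2c Ps(2,3)[OF g2(2)] rN by simp
      ultimately show ?thesis unfolding energy_loss_def defect_def by simp
    qed
    ultimately have "\<kappa>\<^sup>2 * defect M N2 Q2 (act g2 (P j)) \<le> c" by simp
    moreover have "\<kappa>\<^sup>2 * \<gamma> \<le> \<kappa>\<^sup>2 * defect M N2 Q2 (act g2 (P j))" using g2(3) by (intro mult_left_mono) auto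
    moreover have "0 < \<kappa>\<^sup>2 * \<gamma>" using \<kappa> \<gamma> by simp
    ultimately show False unfolding c_def by linarith
  qed
  then show ?thesis using W'(1) unfolding c_def by blast
qed

text \<open>Otherwise the increment applies over and over, and on suitable neighbourhoods the lower
  bound for the energy exceeds 1. But the identity lies in every neighbourhood, is admissible with a
  suitable partition, and has energy at most 1.\<close>

lemma mixing_element:
  assumes P: "equipartition M n P" and \<gamma>: "0 < \<gamma>" and \<kappa>: "0 < \<kappa>"
    and def: "\<And>W N Q. W \<in> unit_nbhds \<Longrightarrow> equipartition M N Q \<Longrightarrow> \<exists>g\<in>W. \<exists>j<n. \<gamma> \<le> defect M N Q (act g (P j))"
    and W0: "W0 \<in> unit_nbhds"
  shows "\<exists>g N Q. admissible n W0 g N Q \<and>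
     (\<forall>i<n. N * (\<Sum>k<N. (measure M (act g (P i) \<inter> Q k))\<^sup>2) \<le> (1 / n)\<^sup>2 + \<kappa>)"
proof (rule ccontr)
  assume "\<not> ?thesis"
  then have neg: "\<exists>i<n. (1 / n)\<^sup>2 + \<kappa> < N * (\<Sum>k<N. (measure M (act g (P i) \<inter> Q k))\<^sup>2)"
    if "admissible n W0 g N Q" for g N Q using that by (meson not_le)
  have n: "0 < n" using equipartitionD(1)[OF P] by (rule finite_partition_pos)
  define c where "c = \<kappa>\<^sup>2 * \<gamma> / 2"
  have c: "0 < c" using \<kappa> \<gamma> by (simp add: c_def)
  have "\<exists>W\<in>unit_nbhds. \<forall>g N Q. admissible n W g N Q \<longrightarrow> real t * c \<le> potential n P g N Q" for t
  proof (induction t)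
    case 0
    have "0 \<le> potential n P g N Q" for g N Q
      unfolding potential_def by (intro sum_nonneg mult_nonneg_nonneg) auto
    then show ?case using W0 by auto
  next
    case (Suc t)
    then obtain W where W: "W \<in> unit_nbhds" "\<And>g N Q. admissible n W g N Q \<Longrightarrow> real t * c \<le> potential n P g N Q"
      by blast
    have "real (Suc t) * c = real t * c + \<kappa>\<^sup>2 * \<gamma> / 2" by (simp add: c_def algebra_simps)
    then show ?case
      using potential_increment[OF P \<gamma> \<kappa> def W0 neg W] by simp
  qed
  moreover obtain t :: nat where t: "1 / c < t" using reals_Archimedean2 by blast
  ultimately obtain W where W: "W \<in> unit_nbhds" "\<And>g N Q. admissible n W g N Q \<Longrightarrow> real t * c \<le> potential n P g N Q"
    by blast
  obtain N Q where Q: "n dvd N" "equipartition M N Q" "stab M N Q \<subseteq> W" by (rule unit_nbhds_stab[OF W(1) n])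
  have one: "\<one>\<^bsub>Aut M\<^esub> \<in> W" using W(1) by (simp add: unit_nbhds_def)
  have "real t * c \<le> potential n P \<one>\<^bsub>Aut M\<^esub> N Q" by (rule W(2)) (use Q one in \<open>simp add: admissible_def\<close>)
  also have "\<dots> \<le> 1" by (rule potential_le_1[OF P Q(2)]) simp
  finally show False using t c by (simp add: field_simps)
qed

end

text \<open>Cauchy-Schwarz for the deviation \<open>d\<close> of \<open>x\<close> from its mean. The
  energy bound makes the sum of \<open>(d k)\<^sup>2\<close> at most
  \<open>\<tau>\<^sup>2 / N\<close>, and the bounds on \<open>y\<close> make the sum of
  \<open>(y k)\<^sup>2\<close> at most \<open>1 / N\<close>. The factor \<open>N\<close> cancels, so
  the estimate does not depend on the partition.\<close>

lemma correlation_bound: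
  fixes x y :: "nat \<Rightarrow> real"
  assumes N: "0 < N" and n: "0 < n" and \<tau>: "0 \<le> \<tau>"
    and x: "(\<Sum>k<N. x k) = 1 / real n" "real N * (\<Sum>k<N. (x k)\<^sup>2) \<le> (1 / real n)\<^sup>2 + \<tau>\<^sup>2"
    and y: "(\<Sum>k<N. y k) = 1 / real n" "\<And>k. k < N \<Longrightarrow> 0 \<le> y k" "\<And>k. k < N \<Longrightarrow> y k \<le> 1 / real N"
  shows "\<bar>real N * (\<Sum>k<N. x k * y k) - (1 / real n)\<^sup>2\<bar> \<le> \<tau>"
proof -
  define d where "d k = x k - 1 / (real n * real N)" for k
  have 1: "real N * (\<Sum>k<N. x k * y k) - (1 / real n)\<^sup>2 = real N * (\<Sum>k<N. d k * y k)"
  proof -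
    have "(\<Sum>k<N. d k * y k) = (\<Sum>k<N. x k * y k) - 1 / (real n * real N) * (\<Sum>k<N. y k)"
      by (simp add: d_def left_diff_distrib sum_subtractf sum_distrib_left)
    then have "real N * (\<Sum>k<N. d k * y k) =
        real N * (\<Sum>k<N. x k * y k) - real N * (1 / (real n * real N) * (1 / real n))"
      by (simp only: y(1) right_diff_distrib)
    also have "real N * (1 / (real n * real N) * (1 / real n)) = (1 / real n)\<^sup>2"
      using N by (simp add: power2_eq_square)
    finally show ?thesis by simp
  qed
  have "(\<Sum>k<N. (d k)\<^sup>2) = (\<Sum>k<N. (x k)\<^sup>2) - 2 / (real n * real N) * (\<Sum>k<N. x k) + (\<Sum>k<N. (1 / (real n * real N))\<^sup>2)"
  proof -
    have "(d k)\<^sup>2 = (x k)\<^sup>2 - 2 / (real n * real N) * x k + (1 / (real n * real N))\<^sup>2" for k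
      by (simp add: d_def power2_diff)
    then show ?thesis by (simp only: sum.distrib sum_subtractf sum_distrib_left)
  qed
  also have "(\<Sum>k<N. (1 / (real n * real N))\<^sup>2) = (1 / real n)\<^sup>2 / N"
    using N by (simp add: power2_eq_square)
  also have "2 / (real n * real N) * (\<Sum>k<N. x k) = 2 * ((1 / real n)\<^sup>2 / N)"
    unfolding x(1) by (simp add: power2_eq_square)
  also have "(\<Sum>k<N. (x k)\<^sup>2) - 2 * ((1 / real n)\<^sup>2 / N) + (1 / real n)\<^sup>2 / N \<le> \<tau>\<^sup>2 / N"
  proof -
    have "(\<Sum>k<N. (x k)\<^sup>2) \<le> ((1 / real n)\<^sup>2 + \<tau>\<^sup>2) / N"
      using x(2) N by (subst pos_le_divide_eq) (simp_all add: mult.commute)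
    then show ?thesis unfolding add_divide_distrib by linarith
  qed
  finally have d2: "(\<Sum>k<N. (d k)\<^sup>2) \<le> \<tau>\<^sup>2 / N" .
  have "(\<Sum>k<N. (y k)\<^sup>2) \<le> (\<Sum>k<N. 1 / real N * y k)"
    unfolding power2_eq_square by (intro sum_mono mult_right_mono) (use y(2,3) in auto)
  also have "\<dots> = 1 / real N * (1 / real n)" by (simp only: sum_distrib_left[symmetric] y(1))
  also have "\<dots> \<le> 1 / real N * 1" using n by (intro mult_left_mono) auto
  finally have y2: "(\<Sum>k<N. (y k)\<^sup>2) \<le> 1 / N" by simp
  have "(real N * (\<Sum>k<N. d k * y k))\<^sup>2 \<le> (real N)\<^sup>2 * ((\<Sum>k<N. (d k)\<^sup>2) * (\<Sum>k<N. (y k)\<^sup>2))"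
    unfolding power_mult_distrib by (intro mult_left_mono Cauchy_Schwarz_ineq_sum) simp
  also have "\<dots> \<le> (real N)\<^sup>2 * (\<tau>\<^sup>2 / N * (1 / N))"
    using d2 y2 by (intro mult_left_mono mult_mono) (auto intro: sum_nonneg)
  also have "\<dots> = \<tau>\<^sup>2" using N by (simp add: power2_eq_square)
  finally have "\<bar>real N * (\<Sum>k<N. d k * y k)\<bar> \<le> \<tau>"
    using \<tau> by (metis abs_le_square_iff abs_of_nonneg)
  then show ?thesis using 1 by simp
qed

section \<open>Matching two partitions inside the cells of a third\<close>

context atomless_standard_space
begin

text \<open>Inside each \<open>P j\<close> the common amount, the minimum of the two measures, is
  moved exactly, and what is left of \<open>P j\<close> goes to what is left. Both
  \<open>X i\<close> and \<open>Y i\<close> lose at most \<open>\<tau>\<close> in each of the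
  \<open>n\<close> cells, whence the factor \<open>2 * real n\<close>.\<close>

lemma realign:
  assumes P: "equipartition M n P" and X: "finite_partition M n X" and Y: "finite_partition M n Y"
    and \<tau>: "\<And>i j. i < n \<Longrightarrow> j < n \<Longrightarrow> \<bar>measure M (X i \<inter> P j) - measure M (Y i \<inter> P j)\<bar> \<le> \<tau>"
  shows "\<exists>q\<in>stab M n P. \<forall>i<n. dd (act q (X i)) (Y i) \<le> 2 * real n * \<tau>"
proof -
  note Ps = equipartitionD[OF P] and Xs = finite_partitionD[OF X] and Ys = finite_partitionD[OF Y]
  note Pd = finite_partitionD(4)[OF Ps(1)]
  define a where "a i j = min (measure M (X i \<inter> P j)) (measure M (Y i \<inter> P j))" for i j
  have "\<exists>B. B \<in> sets M \<and> B \<subseteq> X i \<inter> P j \<and> measure M B = a i j" if "i < n" "j < n" for i j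
    by (rule subset_of_measure[of "X i \<inter> P j" "a i j"]) (use that Xs Ps in \<open>auto simp: a_def\<close>)
  then obtain B where B: "\<And>i j. i < n \<Longrightarrow> j < n \<Longrightarrow> B i j \<in> sets M"
     "\<And>i j. i < n \<Longrightarrow> j < n \<Longrightarrow> B i j \<subseteq> X i \<inter> P j"
     "\<And>i j. i < n \<Longrightarrow> j < n \<Longrightarrow> measure M (B i j) = a i j" by metis
  have "\<exists>B. B \<in> sets M \<and> B \<subseteq> Y i \<inter> P j \<and> measure M B = a i j" if "i < n" "j < n" for i j
    by (rule subset_of_measure[of "Y i \<inter> P j" "a i j"]) (use that Ys Ps in \<open>auto simp: a_def\<close>)
  then obtain B' where B': "\<And>i j. i < n \<Longrightarrow> j < n \<Longrightarrow> B' i j \<in> sets M"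
     "\<And>i j. i < n \<Longrightarrow> j < n \<Longrightarrow> B' i j \<subseteq> Y i \<inter> P j"
     "\<And>i j. i < n \<Longrightarrow> j < n \<Longrightarrow> measure M (B' i j) = a i j" by metis
  \<comment> \<open>The extra index \<open>n\<close> collects the rest of \<open>P j\<close>. With
    it the pieces exhaust \<open>P j\<close> on both sides, so the automorphism preserves
    \<open>P j\<close>.\<close>
  define S where "S B = (\<lambda>(i, j). if i < n then B i j else P j - (\<Union>i<n. B i j))" for B :: "nat \<Rightarrow> nat \<Rightarrow> 'a set"
  define J where "J = {..n} \<times> {..<n}"
  have facts: "(\<forall>x\<in>J. S B x \<in> sets M) \<and> disjoint_family_on (S B) J \<and>
     (\<forall>i\<le>n. \<forall>j<n. measure M (S B (i, j)) = (if i < n then a i j else 1 / n - (\<Sum>i<n. a i j))) \<and>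
     (\<forall>j<n. (\<Union>i\<le>n. S B (i, j)) = P j)"
    if B: "\<And>i j. i < n \<Longrightarrow> j < n \<Longrightarrow> B i j \<in> sets M"
     "\<And>i j. i < n \<Longrightarrow> j < n \<Longrightarrow> B i j \<subseteq> X i \<inter> P j"
     "\<And>i j. i < n \<Longrightarrow> j < n \<Longrightarrow> measure M (B i j) = a i j"
     and Xd: "\<And>i j. i < n \<Longrightarrow> j < n \<Longrightarrow> i \<noteq> j \<Longrightarrow> X i \<inter> X j = {}" for B X
  proof -
    have sets: "S B (i, j) \<in> sets M" if "j < n" for i j
      using that B(1) Ps(2)[OF that] by (auto simp: S_def)
    have subP: "S B (i, j) \<subseteq> P j" if "j < n" for i j using B(2)[of i j] that by (auto simp: S_def)
    have Bd: "B i j \<inter> B i' j = {}" if "i < n" "i' < n" "j < n" "i \<noteq> i'" for i i' j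
      using B(2)[of i j] B(2)[of i' j] Xd[of i i'] that by blast
    have same: "S B (i, j) \<inter> S B (i', j) = {}" if ii: "i \<le> n" "i' \<le> n" "i \<noteq> i'" "j < n" for i i' j
    proof -
      consider "i < n" "i' < n" | "i < n" "i' = n" | "i = n" "i' < n" using ii by linarith
      then show ?thesis using Bd[of i i' j] ii by cases (auto simp: S_def)
    qed
    have "disjoint_family_on (S B) J"
      unfolding disjoint_family_on_def
    proof (intro ballI impI)
      fix x x' assume x: "x \<in> J" "x' \<in> J" "x \<noteq> x'"
      obtain i j i' j' where ij: "x = (i, j)" "x' = (i', j')" by (cases x, cases x')
      then have le: "i \<le> n" "i' \<le> n" "j < n" "j' < n" using x by (auto simp: J_def)
      show "S B x \<inter> S B x' = {}"
      proof (cases "j = j'")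
        case True
        then show ?thesis using same[of i i' j] le x(3) ij by auto
      next
        case False
        then show ?thesis using subP[of j i] subP[of j' i'] Pd[of j j'] le unfolding ij by blast
      qed
    qed
    moreover have "measure M (S B (i, j)) = (if i < n then a i j else 1 / n - (\<Sum>i<n. a i j))"
      if "i \<le> n" "j < n" for i j
    proof (cases "i < n")
      case False
      have "measure M (\<Union>i<n. B i j) = (\<Sum>i<n. measure M (B i j))"
        by (rule finite_measure_finite_Union) (use B(1) Bd that in \<open>auto simp: disjoint_family_on_def\<close>)
      then have U: "measure M (\<Union>i<n. B i j) = (\<Sum>i<n. a i j)" using B(3) that by simp
      have "measure M (P j - (\<Union>i<n. B i j)) = measure M (P j) - measure M (\<Union>i<n. B i j)"
      proof (rule finite_measure_Diff)
        show "(\<Union>i<n. B i j) \<subseteq> P j" using B(2) that(2) by blast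
      qed (use B(1) that Ps(2) in auto)
      then show ?thesis using U False Ps(3) that by (simp add: S_def)
    qed (use B(3) that in \<open>simp add: S_def\<close>)
    moreover have "(\<Union>i\<le>n. S B (i, j)) = P j" if j: "j < n" for j
    proof (intro equalityI subsetI)
      fix x assume x: "x \<in> P j"
      show "x \<in> (\<Union>i\<le>n. S B (i, j))"
      proof (cases "\<exists>i<n. x \<in> B i j")
        case True
        then obtain i where "i < n" "x \<in> B i j" by blast
        then show ?thesis by (intro UN_I[of i]) (auto simp: S_def)
      next
        case False
        then show ?thesis using x by (intro UN_I[of n]) (auto simp: S_def)
      qed
    qed (use subP j in blast)
    ultimately show ?thesis using sets by (auto simp: J_def)
  qed
  have fB: "\<And>x. x \<in> J \<Longrightarrow> S B x \<in> sets M" "disjoint_family_on (S B) J"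
     "\<And>i j. i \<le> n \<Longrightarrow> j < n \<Longrightarrow> measure M (S B (i, j)) = (if i < n then a i j else 1 / n - (\<Sum>i<n. a i j))"
     "\<And>j. j < n \<Longrightarrow> (\<Union>i\<le>n. S B (i, j)) = P j"
    using facts[OF B Xs(4)] by blast+
  have fB': "\<And>x. x \<in> J \<Longrightarrow> S B' x \<in> sets M" "disjoint_family_on (S B') J"
     "\<And>i j. i \<le> n \<Longrightarrow> j < n \<Longrightarrow> measure M (S B' (i, j)) = (if i < n then a i j else 1 / n - (\<Sum>i<n. a i j))"
     "\<And>j. j < n \<Longrightarrow> (\<Union>i\<le>n. S B' (i, j)) = P j"
    using facts[OF B' Ys(4)] by blast+
  have "\<exists>q\<in>carrier (Aut M). \<forall>x\<in>J. dd (act q (S B x)) (S B' x) = 0"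
  proof (rule move_family)
    show "finite J" by (simp add: J_def)
    show "measure M (S B x) = measure M (S B' x)" if "x \<in> J" for x
      using that fB(3) fB'(3) by (auto simp: J_def)
  qed (use fB fB' in auto)
  then obtain q where q: "q \<in> carrier (Aut M)" "\<And>x. x \<in> J \<Longrightarrow> dd (act q (S B x)) (S B' x) = 0" by blast
  have "dd (act q (P j)) (P j) = 0" if j: "j < n" for j
  proof -
    have "dd (\<Union>i\<le>n. act q (S B (i, j))) (\<Union>i\<le>n. S B' (i, j)) \<le> (\<Sum>i\<le>n. dd (act q (S B (i, j))) (S B' (i, j)))"
      by (rule dd_UN) (use fB(1) fB'(1) q(1) j in \<open>auto simp: J_def\<close>)
    also have "\<dots> = 0" using q(2) j by (simp add: J_def)
    finally have "dd (act q (\<Union>i\<le>n. S B (i, j))) (\<Union>i\<le>n. S B' (i, j)) \<le> 0"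
      by (simp only: act_UN[OF q(1)])
    then show ?thesis unfolding fB(4)[OF j] fB'(4)[OF j] by (intro antisym) auto
  qed
  then have "q \<in> stab M n P" using q(1) by (simp add: stab_def)
  moreover have "dd (act q (X i)) (Y i) \<le> 2 * real n * \<tau>" if i: "i < n" for i
  proof -
    have loss: "dd (Z i) (\<Union>j<n. E i j) \<le> n * \<tau>"
      if Z: "Z i \<in> sets M" and E: "\<And>j. j < n \<Longrightarrow> E i j \<in> sets M" "\<And>j. j < n \<Longrightarrow> E i j \<subseteq> Z i \<inter> P j"
        "\<And>j. j < n \<Longrightarrow> measure M (E i j) = a i j" and le: "\<And>j. j < n \<Longrightarrow> measure M (Z i \<inter> P j) - a i j \<le> \<tau>" for Z E
    proof -
      have "measure M (\<Union>j<n. E i j) = (\<Sum>j<n. measure M (E i j))"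
      proof (rule finite_measure_finite_Union)
        show "disjoint_family_on (E i) {..<n}"
          unfolding disjoint_family_on_def using E(2) Pd by blast
      qed (use E(1) in auto)
      then have mU: "measure M (\<Union>j<n. E i j) = (\<Sum>j<n. a i j)" using E(3) by simp
      have sub: "(\<Union>j<n. E i j) \<subseteq> Z i" using E(2) by blast
      then have "(Z i - (\<Union>j<n. E i j)) \<union> ((\<Union>j<n. E i j) - Z i) = Z i - (\<Union>j<n. E i j)" by auto
      then have "dd (Z i) (\<Union>j<n. E i j) = measure M (Z i) - measure M (\<Union>j<n. E i j)"
        using sub Z E(1) by (simp add: set_dist_def finite_measure_Diff sets.finite_UN)
      also have "\<dots> = (\<Sum>j<n. measure M (Z i \<inter> P j) - a i j)"
        using sum_measure_Int_partition[OF Ps(1) Z] mU by (simp add: sum_subtractf)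
      also have "\<dots> \<le> (\<Sum>j<n. \<tau>)" using le by (intro sum_mono) auto
      finally show ?thesis by simp
    qed
    define E where "E = (\<Union>j<n. B i j)"
    define E' where "E' = (\<Union>j<n. B' i j)"
    have Es: "E \<in> sets M" "E' \<in> sets M" using B(1) B'(1) i by (auto simp: E_def E'_def)
    have XE: "dd (X i) E \<le> n * \<tau>"
      unfolding E_def
    proof (rule loss[of X B, OF Xs(1)[OF i] B[OF i]])
      show "measure M (X i \<inter> P j) - a i j \<le> \<tau>" if "j < n" for j
        using \<tau>[OF i that] unfolding a_def by linarith
    qed
    have YE: "dd (Y i) E' \<le> n * \<tau>"
      unfolding E'_def
    proof (rule loss[of Y B', OF Ys(1)[OF i] B'[OF i]])
      show "measure M (Y i \<inter> P j) - a i j \<le> \<tau>" if "j < n" for j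
        using \<tau>[OF i that] unfolding a_def by linarith
    qed
    have "dd (\<Union>j<n. act q (B i j)) (\<Union>j<n. B' i j) \<le> (\<Sum>j<n. dd (act q (B i j)) (B' i j))"
      by (rule dd_UN) (use B(1) B'(1) q(1) i in auto)
    also have "\<dots> = 0"
    proof (rule sum.neutral, rule ballI)
      fix j assume "j \<in> {..<n}"
      then show "dd (act q (B i j)) (B' i j) = 0" using q(2)[of "(i, j)"] i by (simp add: J_def S_def)
    qed
    finally have EE: "dd (act q E) E' \<le> 0" unfolding E_def E'_def act_UN[OF q(1)] .
    have "dd (act q (X i)) (Y i) \<le> dd (act q (X i)) (act q E) + dd (act q E) (Y i)"
      by (rule dd_triangle) (use q(1) Xs Ys Es i in auto)
    also have "dd (act q E) (Y i) \<le> dd (act q E) E' + dd E' (Y i)"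
      by (rule dd_triangle) (use q(1) Xs Ys Es i in auto)
    also have "dd (act q (X i)) (act q E) = dd (X i) E" by (rule dd_act[OF q(1) Xs(1)[OF i] Es(1)])
    finally show ?thesis using XE YE EE by (simp add: dd_commute)
  qed
  ultimately show ?thesis by (intro bexI[of _ q]) auto
qed

end

section \<open>The dichotomy for coarser group topologies\<close>

context coarser_group_topology
begin

text \<open>The factorization is h = n1 g1 n2^-1 g1^-1 p'^-1, where \<open>n1\<close> and
  \<open>n2\<close> arise from comparing \<open>g1\<close> with \<open>g2\<close>, the product of
  \<open>h\<close>, \<open>p'\<close> and \<open>g1\<close>. As \<open>g1\<close> is itself a
  product of two elements of \<open>V\<close>, there are seven factors from \<open>V\<close>, and
  the chain \<open>V\<close>, \<open>V2\<close>, \<open>V1\<close>, \<open>V0\<close>,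
  \<open>U\<close> absorbs them.\<close>

lemma unit_nbhd_full:
  assumes A0: "A0 \<in> sets M" and \<epsilon>0: "0 < \<epsilon>0"
    and moved: "\<And>W. W \<in> unit_nbhds \<Longrightarrow> \<exists>g\<in>W. \<epsilon>0 \<le> dd (act g A0) A0"
    and U: "U \<in> unit_nbhds"
  shows "U = carr"
proof
  show "U \<subseteq> carr" using unit_nbhds_carr[OF U] .
  obtain V0 where V0: "V0 \<in> unit_nbhds" "V0 \<subseteq> U" "\<And>x. x \<in> V0 \<Longrightarrow> \<iota> x \<in> V0"
    "\<And>x y. x \<in> V0 \<Longrightarrow> y \<in> V0 \<Longrightarrow> x \<star> y \<in> U" by (rule unit_nbhds_square[OF U]) (auto intro: that)
  obtain V1 where V1: "V1 \<in> unit_nbhds" "V1 \<subseteq> V0" "\<And>x. x \<in> V1 \<Longrightarrow> \<iota> x \<in> V1"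
    "\<And>x y. x \<in> V1 \<Longrightarrow> y \<in> V1 \<Longrightarrow> x \<star> y \<in> V0" by (rule unit_nbhds_square[OF V0(1)]) (auto intro: that)
  obtain V2 where V2: "V2 \<in> unit_nbhds" "V2 \<subseteq> V1" "\<And>x. x \<in> V2 \<Longrightarrow> \<iota> x \<in> V2"
    "\<And>x y. x \<in> V2 \<Longrightarrow> y \<in> V2 \<Longrightarrow> x \<star> y \<in> V1" by (rule unit_nbhds_square[OF V1(1)]) (auto intro: that)
  obtain V where V: "V \<in> unit_nbhds" "V \<subseteq> V2" "\<And>x. x \<in> V \<Longrightarrow> \<iota> x \<in> V"
    "\<And>x y. x \<in> V \<Longrightarrow> y \<in> V \<Longrightarrow> x \<star> y \<in> V2" by (rule unit_nbhds_square[OF V2(1)]) (auto intro: that)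
  \<comment> \<open>Divisibility by 3 secures \<open>3 \<le> n\<close>, which keeps a single cell
    well below half of the space. The approximation of \<open>A0\<close> transfers its movement to a
    cell.\<close>
  obtain n P e where P: "3 dvd n" "equipartition M n P" "0 < e"
    "\<And>g. g \<in> carr \<Longrightarrow> (\<And>i. i < n \<Longrightarrow> dd (act g (P i)) (P i) < e) \<Longrightarrow> g \<in> V"
    "\<exists>I\<subseteq>{..<n}. dd A0 (\<Union>i\<in>I. P i) \<le> \<epsilon>0 / 4"
    by (rule unit_nbhds_partition[OF V(1), of 3 A0 "\<epsilon>0 / 4"]) (use A0 \<epsilon>0 in \<open>auto intro: that\<close>)
  note Ps = equipartitionD[OF P(2)]
  have n: "0 < n" using Ps(1) by (rule finite_partition_pos)
  have n3: "3 \<le> n" using P(1) n by (rule dvd_imp_le)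
  have stabV: "stab M n P \<subseteq> V" using P(3,4) by (auto simp: stab_def)
  obtain I where I: "I \<subseteq> {..<n}" "dd A0 (\<Union>i\<in>I. P i) \<le> \<epsilon>0 / 4" using P(5) by blast
  have finI: "finite I" using I(1) finite_subset by blast
  \<comment> \<open>If every cell moved by at most \<open>\<epsilon>0 / (4 * n)\<close>, then
    \<open>A0\<close> would move by at most three quarters of \<open>\<epsilon>0\<close>: two
    approximation errors and the movement of the union of cells.\<close>
  have moved': "\<exists>g\<in>W. \<exists>j<n. \<epsilon>0 / (4 * n) \<le> dd (act g (P j)) (P j)" if W: "W \<in> unit_nbhds" for W
  proof -
    obtain g where g: "g \<in> W" "\<epsilon>0 \<le> dd (act g A0) A0" using moved[OF W] by blast
    have gc: "g \<in> carr" using g unit_nbhds_carr[OF W] by blast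
    define C where "C = (\<Union>i\<in>I. P i)"
    have Cs: "C \<in> sets M" unfolding C_def by (rule sets.finite_UN[OF finI]) (use Ps(2) I in auto)
    have "\<exists>j<n. \<epsilon>0 / (4 * n) \<le> dd (act g (P j)) (P j)"
    proof (rule ccontr)
      assume "\<not> ?thesis"
      then have less: "\<And>j. j < n \<Longrightarrow> dd (act g (P j)) (P j) \<le> \<epsilon>0 / (4 * n)" by force
      have "dd (act g C) C \<le> (\<Sum>i\<in>I. dd (act g (P i)) (P i))"
        unfolding C_def act_UN[OF gc] by (rule dd_UN[OF finI]) (use Ps(2) I gc in auto)
      also have "\<dots> \<le> (\<Sum>i\<in>I. \<epsilon>0 / (4 * n))" using less I(1) by (intro sum_mono) auto
      also have "\<dots> = card I * (\<epsilon>0 / (4 * n))" by simp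
      also have "\<dots> \<le> n * (\<epsilon>0 / (4 * n))"
        by (rule mult_right_mono) (use card_mono[OF _ I(1)] \<epsilon>0 in auto)
      also have "\<dots> = \<epsilon>0 / 4" using n by simp
      finally have gC: "dd (act g C) C \<le> \<epsilon>0 / 4" .
      have "dd (act g A0) A0 \<le> dd (act g A0) (act g C) + dd (act g C) A0"
        by (rule dd_triangle) (use gc A0 Cs in auto)
      also have "dd (act g C) A0 \<le> dd (act g C) C + dd C A0"
        by (rule dd_triangle) (use gc A0 Cs in auto)
      also have "dd (act g A0) (act g C) = dd A0 C" by (rule dd_act[OF gc A0 Cs])
      finally have "dd (act g A0) A0 \<le> dd A0 C + (\<epsilon>0 / 4 + dd A0 C)" using gC by (simp add: dd_commute)
      then show False using g(2) I(2) \<epsilon>0 unfolding C_def by linarith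
    qed
    then show ?thesis using g(1) by blast
  qed
  have "0 < \<epsilon>0 / (4 * n)" using \<epsilon>0 n by simp
  then obtain \<gamma> where \<gamma>: "0 < \<gamma>"
    "\<And>W N Q. W \<in> unit_nbhds \<Longrightarrow> equipartition M N Q \<Longrightarrow> \<exists>g\<in>W. \<exists>j<n. \<gamma> \<le> defect M N Q (act g (P j))"
    using defect_bounded_below[OF P(2) n3 _ moved'] by blast
  \<comment> \<open>Adjusted to \<open>realign\<close>, which is applied with
    \<open>2 * \<tau>\<close>: its error \<open>2 * real n * (2 * \<tau>)\<close> becomes
    \<open>e / 2\<close>.\<close>
  define \<tau> where "\<tau> = e / (8 * n)"
  have \<tau>: "0 < \<tau>" using P(3) n by (simp add: \<tau>_def)
  obtain g N Q where g: "admissible n V g N Q"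
    "\<And>i. i < n \<Longrightarrow> N * (\<Sum>k<N. (measure M (act g (P i) \<inter> Q k))\<^sup>2) \<le> (1 / n)\<^sup>2 + \<tau>\<^sup>2"
    using mixing_element[OF P(2) \<gamma>(1) _ \<gamma>(2) V(1), of "\<tau>\<^sup>2"] \<tau> by auto
  have gV: "g \<in> V" and Q: "equipartition M N Q" and sQ: "stab M N Q \<subseteq> V" using g(1) by (auto simp: admissible_def)
  have gc: "g \<in> carr" using gV unit_nbhds_carr[OF V(1)] by blast
  note Qs = equipartitionD[OF Q]
  have N: "0 < N" using Qs(1) by (rule finite_partition_pos)
  \<comment> \<open>The bound for \<open>g\<close> only says that its images of cells have almost
    constant density along \<open>Q\<close>. The factor \<open>p\<close>, generic inside the cells
    of \<open>Q\<close>, converts this into near independence from \<open>P\<close>.\<close>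
  obtain p where p: "p \<in> carr" "\<And>k. k < N \<Longrightarrow> dd (act p (Q k)) (Q k) = 0"
    "\<And>i l. i < n \<Longrightarrow> l < n \<Longrightarrow> measure M (act p (act g (P i)) \<inter> P l) =
       (\<Sum>k<N. measure M (act g (P i) \<inter> Q k) * measure M (P l \<inter> Q k) / measure M (Q k))"
    using spread[OF Qs(1) finite_partition_act[OF Ps(1) gc] Ps(1)] by blast
  have pV: "p \<in> V" using p(1,2) sQ by (auto simp: stab_def)
  define g1 where "g1 = p \<star> g"
  have g1: "g1 \<in> V2" "g1 \<in> carr" using V(4)[OF pV gV] p(1) gc by (auto simp: g1_def)
  have mix1: "\<bar>measure M (act g1 (P i) \<inter> P l) - (1 / n)\<^sup>2\<bar> \<le> \<tau>" if i: "i < n" and l: "l < n" for i l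
  proof -
    have gP: "act g (P i) \<in> sets M" "measure M (act g (P i)) = 1 / n" using gc Ps(2,3)[OF i] by auto
    have "measure M (act g1 (P i) \<inter> P l) = measure M (act p (act g (P i)) \<inter> P l)"
      unfolding g1_def
      by (rule measure_Int_cong[OF _ _ _ dd_act_mult[OF p(1) gc Ps(2)[OF i]]])
        (use p(1) gc gP Ps(2)[OF i] Ps(2)[OF l] in simp_all)
    also have "\<dots> = (\<Sum>k<N. N * (measure M (act g (P i) \<inter> Q k) * measure M (P l \<inter> Q k)))"
      unfolding p(3)[OF i l] by (intro sum.cong refl) (simp add: Qs(3))
    also have "\<dots> = N * (\<Sum>k<N. measure M (act g (P i) \<inter> Q k) * measure M (P l \<inter> Q k))"
      by (simp add: sum_distrib_left)
    finally have eq: "measure M (act g1 (P i) \<inter> P l) = N * (\<Sum>k<N. measure M (act g (P i) \<inter> Q k) * measure M (P l \<inter> Q k))" .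
    show ?thesis
      unfolding eq
    proof (rule correlation_bound[OF N n _ _ g(2)[OF i]])
      show "(\<Sum>k<N. measure M (act g (P i) \<inter> Q k)) = 1 / n"
        using sum_measure_Int_partition[OF Qs(1) gP(1)] gP(2) by simp
      show "(\<Sum>k<N. measure M (P l \<inter> Q k)) = 1 / n"
        using sum_measure_Int_partition[OF Qs(1) Ps(2)[OF l]] Ps(3)[OF l] by simp
      show "measure M (P l \<inter> Q k) \<le> 1 / N" if "k < N" for k
        using finite_measure_mono[of "P l \<inter> Q k" "Q k"] Qs(2,3)[OF that] by simp
    qed (use \<tau> in auto)
  qed
  show "carr \<subseteq> U"
  proof
    fix h assume h: "h \<in> carr"
    have ih: "\<iota> h \<in> carr" using h by simp
    have hP: "equipartition M n (\<lambda>l. act (\<iota> h) (P l))" by (rule equipartition_act[OF P(2) ih])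
    note hPs = equipartitionD[OF hP]
    \<comment> \<open>Generic mixing inside the cells of \<open>P\<close> makes each intersection
      with the pulled back \<open>P l\<close> a weighted mean of the intersections of
      \<open>act g1 (P i)\<close> with the \<open>P k\<close>. The weights sum to 1, so the error
      \<open>\<tau>\<close> is inherited whatever \<open>h\<close> is.\<close>
    obtain p' where p': "p' \<in> carr" "\<And>k. k < n \<Longrightarrow> dd (act p' (P k)) (P k) = 0"
      "\<And>i l. i < n \<Longrightarrow> l < n \<Longrightarrow> measure M (act p' (act g1 (P i)) \<inter> act (\<iota> h) (P l)) =
         (\<Sum>k<n. measure M (act g1 (P i) \<inter> P k) * measure M (act (\<iota> h) (P l) \<inter> P k) / measure M (P k))"
      using spread[OF Ps(1) finite_partition_act[OF Ps(1) g1(2)] hPs(1)] by blast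
    have p'V: "p' \<in> V" using p'(1,2) stabV by (auto simp: stab_def)
    define g2 where "g2 = h \<star> (p' \<star> g1)"
    have pg: "p' \<star> g1 \<in> carr" and g2: "g2 \<in> carr" using p'(1) g1 h by (auto simp: g2_def)
    have mix2: "\<bar>measure M (act g2 (P i) \<inter> P l) - (1 / n)\<^sup>2\<bar> \<le> \<tau>" if i: "i < n" and l: "l < n" for i l
    proof -
      note Pi = Ps(2)[OF i] and Pl = Ps(2)[OF l]
      have "measure M (act g2 (P i) \<inter> P l) = measure M (act h (act (p' \<star> g1) (P i)) \<inter> P l)"
        unfolding g2_def by (rule measure_Int_cong[OF _ _ Pl dd_act_mult[OF h pg Pi]]) (use h pg Pi in simp_all)
      also have "\<dots> = measure M (act (p' \<star> g1) (P i) \<inter> act (\<iota> h) (P l))"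
        by (rule measure_act_Int[OF h act_sets[OF pg Pi] Pl])
      also have "\<dots> = measure M (act p' (act g1 (P i)) \<inter> act (\<iota> h) (P l))"
        by (rule measure_Int_cong[OF _ _ act_sets[OF ih Pl] dd_act_mult[OF p'(1) g1(2) Pi]])
          (use p'(1) g1 pg Pi in simp_all)
      also have "\<dots> = (\<Sum>k<n. measure M (act g1 (P i) \<inter> P k) * (n * measure M (act (\<iota> h) (P l) \<inter> P k)))"
        unfolding p'(3)[OF i l] by (intro sum.cong refl) (simp add: Ps(3))
      finally have eq: "measure M (act g2 (P i) \<inter> P l) =
         (\<Sum>k<n. measure M (act g1 (P i) \<inter> P k) * (n * measure M (act (\<iota> h) (P l) \<inter> P k)))" .
      have total: "(\<Sum>k<n. n * measure M (act (\<iota> h) (P l) \<inter> P k)) = 1"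
        using sum_measure_Int_partition[OF Ps(1) hPs(2)[OF l]] hPs(3)[OF l] n
        by (simp add: sum_distrib_left[symmetric])
      have "measure M (act g2 (P i) \<inter> P l) - (1 / n)\<^sup>2 =
         (\<Sum>k<n. measure M (act g1 (P i) \<inter> P k) * (n * measure M (act (\<iota> h) (P l) \<inter> P k))) -
         (1 / n)\<^sup>2 * (\<Sum>k<n. n * measure M (act (\<iota> h) (P l) \<inter> P k))"
        unfolding eq total by simp
      also have "\<dots> = (\<Sum>k<n. (measure M (act g1 (P i) \<inter> P k) - (1 / n)\<^sup>2) * (n * measure M (act (\<iota> h) (P l) \<inter> P k)))"
        unfolding sum_distrib_left sum_subtractf[symmetric] left_diff_distrib ..
      also have "\<bar>\<dots>\<bar> \<le> (\<Sum>k<n. \<bar>(measure M (act g1 (P i) \<inter> P k) - (1 / n)\<^sup>2) * (n * measure M (act (\<iota> h) (P l) \<inter> P k))\<bar>)"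
        by (rule sum_abs)
      also have "\<dots> \<le> (\<Sum>k<n. \<tau> * (n * measure M (act (\<iota> h) (P l) \<inter> P k)))"
        unfolding abs_mult using mix1[OF i] \<tau> by (intro sum_mono mult_mono) auto
      also have "\<dots> = \<tau> * (\<Sum>k<n. n * measure M (act (\<iota> h) (P l) \<inter> P k))"
        by (rule sum_distrib_left[symmetric])
      also have "\<dots> = \<tau>" by (simp only: total mult_1_right)
      finally show ?thesis .
    qed
    obtain n1 where n1: "n1 \<in> stab M n P" "\<And>i. i < n \<Longrightarrow> dd (act n1 (act g1 (P i))) (act g2 (P i)) \<le> 2 * real n * (2 * \<tau>)"
    proof -
      have "\<exists>q\<in>stab M n P. \<forall>i<n. dd (act q (act g1 (P i))) (act g2 (P i)) \<le> 2 * real n * (2 * \<tau>)"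
      proof (rule realign[OF P(2) finite_partition_act[OF Ps(1) g1(2)] finite_partition_act[OF Ps(1) g2]])
        fix i j assume "i < n" "j < n"
        then show "\<bar>measure M (act g1 (P i) \<inter> P j) - measure M (act g2 (P i) \<inter> P j)\<bar> \<le> 2 * \<tau>"
          using mix1[of i j] mix2[of i j] by linarith
      qed
      then show thesis using that by blast
    qed
    have n1c: "n1 \<in> carr" using n1(1) by (simp add: stab_def)
    have n1g1: "n1 \<star> g1 \<in> carr" using n1c g1 by simp
    have ig2: "\<iota> g2 \<in> carr" using g2 by simp
    \<comment> \<open>What separates \<open>g2\<close> from \<open>n1 \<star> g1\<close>. It moves
      each cell of \<open>P\<close> by at most \<open>e / 2\<close>, hence lies in \<open>V\<close>
      although it need not stabilize \<open>P\<close>.\<close>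
    define n2 where "n2 = \<iota> g2 \<star> (n1 \<star> g1)"
    have n2c: "n2 \<in> carr" using n1g1 ig2 by (simp add: n2_def)
    have n2V: "n2 \<in> V"
    proof (rule P(4)[OF n2c])
      fix i assume i: "i < n"
      note Pi = Ps(2)[OF i]
      have s: "act (n1 \<star> g1) (P i) \<in> sets M" "act g1 (P i) \<in> sets M" "act n1 (act g1 (P i)) \<in> sets M" "act g2 (P i) \<in> sets M"
        using n1g1 n1c g1 g2 Pi by auto
      have "dd (act n2 (P i)) (P i) = dd (act (\<iota> g2) (act (n1 \<star> g1) (P i))) (act (\<iota> g2) (act g2 (P i)))"
        unfolding n2_def
        using dd_cong[OF _ _ _ _ dd_act_mult[OF ig2 n1g1 Pi], of "P i" "act (\<iota> g2) (act g2 (P i))"]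
          dd_act_inv(1)[OF g2 Pi] n2c[unfolded n2_def] act_sets[OF ig2 s(1)] act_sets[OF ig2 s(4)] Pi
        by (simp add: dd_commute)
      also have "\<dots> = dd (act (n1 \<star> g1) (P i)) (act g2 (P i))" by (rule dd_act[OF ig2 s(1,4)])
      also have "\<dots> = dd (act n1 (act g1 (P i))) (act g2 (P i))"
        by (rule dd_cong[OF s(1,3,4,4) dd_act_mult[OF n1c g1(2) Pi]]) simp
      also have "\<dots> \<le> 2 * real n * (2 * \<tau>)" by (rule n1(2)[OF i])
      also have "\<dots> = e / 2" using n by (simp add: \<tau>_def)
      finally show "dd (act n2 (P i)) (P i) < e" using P(3) by simp
    qed
    have n1V: "n1 \<in> V" using n1(1) stabV by blast
    have "n1 \<star> g1 \<in> V1" using n1V V(2) g1(1) V2(4) by blast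
    moreover have "\<iota> n2 \<star> \<iota> g1 \<in> V1" using n2V V(2,3) g1(1) V2(3,4) by blast
    ultimately have "(n1 \<star> g1) \<star> (\<iota> n2 \<star> \<iota> g1) \<in> V0" by (rule V1(4))
    moreover have "\<iota> p' \<in> V0" using p'V V(2,3) V2(2) V1(2) by blast
    ultimately have "((n1 \<star> g1) \<star> (\<iota> n2 \<star> \<iota> g1)) \<star> \<iota> p' \<in> U" by (rule V0(4))
    moreover have "((n1 \<star> g1) \<star> (\<iota> n2 \<star> \<iota> g1)) \<star> \<iota> p' = h"
    proof -
      have "n1 \<star> g1 = g2 \<star> n2"
        using G.m_assoc[of g2 "\<iota> g2" "n1 \<star> g1"] g2 ig2 n1g1 by (simp add: n2_def)
      moreover have "n2 \<star> (\<iota> n2 \<star> \<iota> g1) = \<iota> g1"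
        using G.m_assoc[of n2 "\<iota> n2" "\<iota> g1"] n2c g1(2) by simp
      ultimately have "(n1 \<star> g1) \<star> (\<iota> n2 \<star> \<iota> g1) = g2 \<star> \<iota> g1"
        using g2 n2c g1(2) by (simp add: G.m_assoc)
      also have "g2 \<star> \<iota> g1 = h \<star> p'"
        using h p'(1) g1(2) by (simp add: g2_def G.m_assoc)
      finally have "((n1 \<star> g1) \<star> (\<iota> n2 \<star> \<iota> g1)) \<star> \<iota> p' = h \<star> p' \<star> \<iota> p'" by simp
      then show ?thesis using h p'(1) by (simp add: G.m_assoc)
    qed
    ultimately show "h \<in> U" by simp
  qed
qed

text \<open>The dividing line is whether small elements move every measurable set arbitrarily
  little. If they do, the sets \<open>nbhd\<close> are neighbourhoods for \<open>S\<close>, which is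
  then as fine as the weak topology. If not, some \<open>A0\<close> is moved by a fixed amount
  inside every neighbourhood, and \<open>unit_nbhd_full\<close> applies.\<close>

theorem coarser_dichotomy: "S = weak_topology M \<or> (\<forall>U. openin S U \<longrightarrow> \<one>\<^bsub>Aut M\<^esub> \<in> U \<longrightarrow> U = carr)"
proof (rule disjCI)
  assume "\<not> (\<forall>U. openin S U \<longrightarrow> \<one>\<^bsub>Aut M\<^esub> \<in> U \<longrightarrow> U = carr)"
  then obtain U0 where U0: "U0 \<in> unit_nbhds" "U0 \<noteq> carr" by (auto simp: unit_nbhds_def)
  have near: "\<exists>W\<in>unit_nbhds. \<forall>g\<in>W. dd (act g A) A < e" if A: "A \<in> sets M" "0 < e" for A e
  proof (rule ccontr)
    assume "\<not> ?thesis"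
    then have "\<And>W. W \<in> unit_nbhds \<Longrightarrow> \<exists>g\<in>W. e \<le> dd (act g A) A" by (meson not_le)
    from unit_nbhd_full[OF A this U0(1)] show False using U0(2) by simp
  qed
  have top: "topspace S = carr" by (rule topological_groupD(2)[OF S_group])
  have "openin S U" if U: "openin (weak_topology M) U" for U
    unfolding openin_subopen[of S U]
  proof
    fix g assume gU: "g \<in> U"
    have g: "g \<in> carr" using openin_subset[OF U] gU by (auto simp: topspace_weak)
    have o1: "openin (weak_topology M) {x\<in>carr. g \<star> x \<in> U}"
      by (rule openin_translate(1)[OF topological_group_weak U g])
    have o2: "\<one>\<^bsub>Aut M\<^esub> \<in> {x\<in>carr. g \<star> x \<in> U}" using g gU by simp
    from openin_weak_imp_nbhd[OF o1 o2] obtain \<A> e where A: "finite \<A>" "\<A> \<subseteq> sets M" "0 < e" "nbhd \<one>\<^bsub>Aut M\<^esub> \<A> e \<subseteq> {x\<in>carr. g \<star> x \<in> U}"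
      by (elim exE conjE)
    have "\<exists>W. W \<in> unit_nbhds \<and> (\<forall>g\<in>W. dd (act g A) A < e)" if "A \<in> \<A>" for A
      using near[of A e] that A(2,3) by auto
    then obtain W where W: "\<And>A. A \<in> \<A> \<Longrightarrow> W A \<in> unit_nbhds" "\<And>A g. A \<in> \<A> \<Longrightarrow> g \<in> W A \<Longrightarrow> dd (act g A) A < e"
      by metis
    have "carr \<in> unit_nbhds" using openin_topspace[of S] top by (simp add: unit_nbhds_def)
    then have W': "carr \<inter> (\<Inter>A\<in>\<A>. W A) \<in> unit_nbhds" by (intro unit_nbhds_INT A(1) W(1))
    have "carr \<inter> (\<Inter>A\<in>\<A>. W A) \<subseteq> nbhd \<one>\<^bsub>Aut M\<^esub> \<A> e"
    proof
      fix x assume x: "x \<in> carr \<inter> (\<Inter>A\<in>\<A>. W A)"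
      have "dd (act x E) (act \<one>\<^bsub>Aut M\<^esub> E) < e" if E: "E \<in> \<A>" for E
      proof -
        have Es: "E \<in> sets M" using E A(2) by blast
        have "dd (act x E) (act \<one>\<^bsub>Aut M\<^esub> E) = dd (act x E) E"
          by (rule dd_cong) (use dd_act_one[OF Es] x Es in auto)
        then show ?thesis using W(2)[OF E] x E by auto
      qed
      then show "x \<in> nbhd \<one>\<^bsub>Aut M\<^esub> \<A> e" using x by (simp add: nbhd_def)
    qed
    then have sub: "carr \<inter> (\<Inter>A\<in>\<A>. W A) \<subseteq> {x\<in>carr. g \<star> x \<in> U}" using A(4) by blast
    have ig: "\<iota> g \<in> carr" using g by simp
    have "openin S {y\<in>carr. \<iota> g \<star> y \<in> carr \<inter> (\<Inter>A\<in>\<A>. W A)}"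
      by (rule openin_translate(1)[OF S_group _ ig]) (use W' in \<open>simp add: unit_nbhds_def\<close>)
    moreover have "g \<in> {y\<in>carr. \<iota> g \<star> y \<in> carr \<inter> (\<Inter>A\<in>\<A>. W A)}"
      using g W' by (auto simp: unit_nbhds_def)
    moreover have "{y\<in>carr. \<iota> g \<star> y \<in> carr \<inter> (\<Inter>A\<in>\<A>. W A)} \<subseteq> U"
    proof
      fix y assume y: "y \<in> {y\<in>carr. \<iota> g \<star> y \<in> carr \<inter> (\<Inter>A\<in>\<A>. W A)}"
      then have "g \<star> (\<iota> g \<star> y) \<in> U" using sub by blast
      then show "y \<in> U" using y g G.m_assoc[of g "\<iota> g" y] by simp
    qed
    ultimately show "\<exists>T. openin S T \<and> g \<in> T \<and> T \<subseteq> U" by blast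
  qed
  then show "S = weak_topology M" using S_coarser unfolding topology_eq by blast
qed

end

section \<open>Quotients and total minimality\<close>

lemma topspace_quotient_group:
  assumes "topspace T = carrier G"
  shows "topspace (quotient_group_topology G T N) = carrier (G Mod N)"
  using quotient_imp_surjective_map[OF quotient_map_quotient_group_topology[OF assms, of N]] assms
  by (auto simp: carrier_FactGroup)

context
  fixes G :: "('g, 'm) monoid_scheme" and T :: "'g topology" and N :: "'g set"
  assumes TG: "topological_group G T" and N: "N \<lhd> G"
begin

interpretation normal N G by (rule N)

text \<open>The preimage of the image is the union of the translates of \<open>U\<close> by elements
  of \<open>N\<close>.\<close>

lemma openin_quotient_image:
  assumes U: "openin T U"
  shows "openin (quotient_group_topology G T N) ((\<lambda>x. N #>\<^bsub>G\<^esub> x) ` U)"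
proof -
  note D = topological_groupD[OF TG]
  have Uc: "U \<subseteq> carrier G" using openin_subset[OF U] D(2) by simp
  have "{x \<in> topspace T. N #>\<^bsub>G\<^esub> x \<in> (\<lambda>x. N #>\<^bsub>G\<^esub> x) ` U} = (\<Union>n\<in>N. {x\<in>carrier G. n \<otimes>\<^bsub>G\<^esub> x \<in> U})"
  proof (intro equalityI subsetI)
    fix x assume "x \<in> {x \<in> topspace T. N #>\<^bsub>G\<^esub> x \<in> (\<lambda>x. N #>\<^bsub>G\<^esub> x) ` U}"
    then obtain u where x: "x \<in> carrier G" and u: "u \<in> U" "N #>\<^bsub>G\<^esub> x = N #>\<^bsub>G\<^esub> u" using D(2) by auto
    have "u \<in> N #>\<^bsub>G\<^esub> x" using u Uc rcos_self[OF _ is_subgroup] by auto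
    then show "x \<in> (\<Union>n\<in>N. {x\<in>carrier G. n \<otimes>\<^bsub>G\<^esub> x \<in> U})" using x u by (auto simp: r_coset_def)
  next
    fix x assume "x \<in> (\<Union>n\<in>N. {x\<in>carrier G. n \<otimes>\<^bsub>G\<^esub> x \<in> U})"
    then obtain n where n: "n \<in> N" "x \<in> carrier G" "n \<otimes>\<^bsub>G\<^esub> x \<in> U" by blast
    then have "n \<otimes>\<^bsub>G\<^esub> x \<in> N #>\<^bsub>G\<^esub> x" by (auto simp: r_coset_def)
    then have "N #>\<^bsub>G\<^esub> x = N #>\<^bsub>G\<^esub> (n \<otimes>\<^bsub>G\<^esub> x)" using repr_independence[OF _ n(2) is_subgroup] by blast
    then show "x \<in> {x \<in> topspace T. N #>\<^bsub>G\<^esub> x \<in> (\<lambda>x. N #>\<^bsub>G\<^esub> x) ` U}" using n D(2) by auto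
  qed
  moreover have "openin T (\<Union>n\<in>N. {x\<in>carrier G. n \<otimes>\<^bsub>G\<^esub> x \<in> U})"
    using openin_translate(1)[OF TG U] subset by (intro openin_Union) auto
  ultimately show ?thesis
    using Uc by (auto simp: openin_quotient_group_topology carrier_FactGroup)
qed

lemma topological_group_quotient:
  "topological_group (G Mod N) (quotient_group_topology G T N)"
proof (rule topological_groupI)
  note D = topological_groupD[OF TG]
  show "group (G Mod N)" by (rule factorgroup_is_group)
  show "topspace (quotient_group_topology G T N) = carrier (G Mod N)"
    by (rule topspace_quotient_group[OF D(2)])
  let ?\<pi> = "\<lambda>x. N #>\<^bsub>G\<^esub> x"
  fix U X assume U: "openin (quotient_group_topology G T N) U" and X: "X \<in> carrier (G Mod N)"
  define O' where "O' = {x \<in> topspace T. ?\<pi> x \<in> U}"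
  have O': "openin T O'" using U by (simp add: openin_quotient_group_topology O'_def)
  obtain a where a: "a \<in> carrier G" "X = ?\<pi> a" using X by (auto simp: carrier_FactGroup)
  { fix Y assume Y: "Y \<in> carrier (G Mod N)" "X \<otimes>\<^bsub>G Mod N\<^esub> Y \<in> U"
    obtain b where b: "b \<in> carrier G" "Y = ?\<pi> b" using Y by (auto simp: carrier_FactGroup)
    have "a \<otimes>\<^bsub>G\<^esub> b \<in> O'" using Y a b D(2) by (simp add: O'_def rcos_sum)
    from D(3)[OF O' a(1) b(1) this] obtain V W
      where VW: "openin T V" "openin T W" "a \<in> V" "b \<in> W" "\<forall>x\<in>V. \<forall>y\<in>W. x \<otimes>\<^bsub>G\<^esub> y \<in> O'" by (elim exE conjE)
    have c: "V \<subseteq> carrier G" "W \<subseteq> carrier G" using VW openin_subset D(2) by metis+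
    have "\<forall>x\<in>?\<pi> ` V. \<forall>y\<in>?\<pi> ` W. x \<otimes>\<^bsub>G Mod N\<^esub> y \<in> U"
    proof (intro ballI)
      fix x y assume "x \<in> ?\<pi> ` V" "y \<in> ?\<pi> ` W"
      then obtain v w where vw: "v \<in> V" "w \<in> W" "x = ?\<pi> v" "y = ?\<pi> w" by blast
      then have "v \<otimes>\<^bsub>G\<^esub> w \<in> O'" "v \<in> carrier G" "w \<in> carrier G" using VW(5) c by auto
      then show "x \<otimes>\<^bsub>G Mod N\<^esub> y \<in> U" using vw by (simp add: O'_def rcos_sum)
    qed
    then show "\<exists>V W. openin (quotient_group_topology G T N) V \<and> openin (quotient_group_topology G T N) W \<and>
        X \<in> V \<and> Y \<in> W \<and> (\<forall>x\<in>V. \<forall>y\<in>W. x \<otimes>\<^bsub>G Mod N\<^esub> y \<in> U)"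
      using openin_quotient_image[OF VW(1)] openin_quotient_image[OF VW(2)] VW(3,4) a b
      by (intro exI[of _ "?\<pi> ` V"] exI[of _ "?\<pi> ` W"]) auto }
  assume inv: "inv\<^bsub>G Mod N\<^esub> X \<in> U"
  have inv_coset: "inv\<^bsub>G Mod N\<^esub> (?\<pi> x) = ?\<pi> (inv\<^bsub>G\<^esub> x)" if "x \<in> carrier G" for x
    using inv_FactGroup[of "?\<pi> x"] rcos_inv[OF that] that by (auto simp: carrier_FactGroup)
  have "inv\<^bsub>G\<^esub> a \<in> O'" using inv a D(2) inv_coset by (simp add: O'_def)
  from D(4)[OF O' a(1) this] obtain V
    where V: "openin T V" "a \<in> V" "\<forall>x\<in>V. inv\<^bsub>G\<^esub> x \<in> O'" by (elim exE conjE)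
  have c: "V \<subseteq> carrier G" using V openin_subset D(2) by metis
  have "\<forall>x\<in>?\<pi> ` V. inv\<^bsub>G Mod N\<^esub> x \<in> U"
  proof
    fix x assume "x \<in> ?\<pi> ` V"
    then obtain v where v: "v \<in> V" "x = ?\<pi> v" by blast
    then show "inv\<^bsub>G Mod N\<^esub> x \<in> U" using V(3) c inv_coset[of v] by (auto simp: O'_def)
  qed
  then show "\<exists>V. openin (quotient_group_topology G T N) V \<and> X \<in> V \<and> (\<forall>x\<in>V. inv\<^bsub>G Mod N\<^esub> x \<in> U)"
    using openin_quotient_image[OF V(1)] V(2) a by (intro exI[of _ "?\<pi> ` V"]) auto
qed

text \<open>If the cosets of \<open>a\<close> and \<open>b\<close> differ, the quotient b a^-1 lies
  in the open complement of \<open>N\<close>. Continuity keeps y x^-1 there for x near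
  \<open>a\<close> and y near \<open>b\<close>, so the images of these neighbourhoods are
  disjoint.\<close>

lemma hausdorff_group_quotient:
  assumes closed: "closedin T N"
  shows "hausdorff_group (G Mod N) (quotient_group_topology G T N)"
  unfolding hausdorff_group_def
proof
  note D = topological_groupD[OF TG]
  show "topological_group (G Mod N) (quotient_group_topology G T N)" by (rule topological_group_quotient)
  let ?\<pi> = "\<lambda>x. N #>\<^bsub>G\<^esub> x"
  show "Hausdorff_space (quotient_group_topology G T N)"
    unfolding Hausdorff_space_def topspace_quotient_group[OF D(2)]
  proof (intro allI impI)
    fix X Y assume "X \<in> carrier (G Mod N) \<and> Y \<in> carrier (G Mod N) \<and> X \<noteq> Y"
    then obtain a b where ab: "a \<in> carrier G" "b \<in> carrier G" "X = ?\<pi> a" "Y = ?\<pi> b" "?\<pi> a \<noteq> ?\<pi> b"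
      by (auto simp: carrier_FactGroup)
    have O': "openin T (carrier G - N)" using closed D(2) by (simp add: closedin_def)
    have "b \<otimes>\<^bsub>G\<^esub> inv\<^bsub>G\<^esub> a \<notin> N"
    proof
      assume n: "b \<otimes>\<^bsub>G\<^esub> inv\<^bsub>G\<^esub> a \<in> N"
      have "b = (b \<otimes>\<^bsub>G\<^esub> inv\<^bsub>G\<^esub> a) \<otimes>\<^bsub>G\<^esub> a" using ab by (simp add: m_assoc)
      then have "b \<in> ?\<pi> a" using n by (auto simp: r_coset_def)
      then show False using repr_independence[OF _ ab(1) is_subgroup] ab(5) by blast
    qed
    then have "b \<otimes>\<^bsub>G\<^esub> inv\<^bsub>G\<^esub> a \<in> carrier G - N" using ab by simp
    from D(3)[OF O' ab(2) inv_closed[OF ab(1)] this] obtain V W where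
      VW: "openin T V" "openin T W" "b \<in> V" "inv\<^bsub>G\<^esub> a \<in> W" "\<forall>x\<in>V. \<forall>y\<in>W. x \<otimes>\<^bsub>G\<^esub> y \<in> carrier G - N"
      by (elim exE conjE)
    from D(4)[OF VW(2) ab(1) VW(4)] obtain V' where
      V': "openin T V'" "a \<in> V'" "\<forall>x\<in>V'. inv\<^bsub>G\<^esub> x \<in> W" by (elim exE conjE)
    have c: "V \<subseteq> carrier G" "V' \<subseteq> carrier G" using VW V' openin_subset D(2) by metis+
    have "disjnt (?\<pi> ` V') (?\<pi> ` V)"
      unfolding disjnt_def
    proof (rule ccontr)
      assume "?\<pi> ` V' \<inter> ?\<pi> ` V \<noteq> {}"
      then obtain x y where xy: "x \<in> V'" "y \<in> V" "?\<pi> x = ?\<pi> y" by blast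
      then have xyc: "x \<in> carrier G" "y \<in> carrier G" using c by auto
      have "y \<in> ?\<pi> x" using xy xyc rcos_self[OF _ is_subgroup] by auto
      then obtain n where n: "n \<in> N" "y = n \<otimes>\<^bsub>G\<^esub> x" by (auto simp: r_coset_def)
      then have "y \<otimes>\<^bsub>G\<^esub> inv\<^bsub>G\<^esub> x = n" using xyc subset by (auto simp: m_assoc)
      moreover have "y \<otimes>\<^bsub>G\<^esub> inv\<^bsub>G\<^esub> x \<in> carrier G - N" using VW(5) V'(3) xy by blast
      ultimately show False using n by simp
    qed
    then show "\<exists>U V. openin (quotient_group_topology G T N) U \<and> openin (quotient_group_topology G T N) V \<and>
        X \<in> U \<and> Y \<in> V \<and> disjnt U V"
      using openin_quotient_image[OF V'(1)] openin_quotient_image[OF VW(1)] V'(2) VW(3) ab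
      by (intro exI[of _ "?\<pi> ` V'"] exI[of _ "?\<pi> ` V"]) auto
  qed
qed

text \<open>The projection is a homomorphism, so continuity lifts to preimages. Separation does not
  lift, because points of one coset have the same neighbourhoods.\<close>

lemma topological_group_pullback:
  assumes S: "topological_group (G Mod N) S"
  shows "topological_group G (pullback_topology (carrier G) (\<lambda>x. N #>\<^bsub>G\<^esub> x) S)"
proof (rule topological_groupI)
  let ?\<pi> = "\<lambda>x. N #>\<^bsub>G\<^esub> x"
  note D = topological_groupD[OF S]
  show "group G" by (rule is_group)
  have \<pi>c: "?\<pi> x \<in> carrier (G Mod N)" if "x \<in> carrier G" for x using that by (auto simp: carrier_FactGroup)
  then show top: "topspace (pullback_topology (carrier G) ?\<pi> S) = carrier G"
    by (auto simp: topspace_pullback_topology D(2))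
  fix U g assume U: "openin (pullback_topology (carrier G) ?\<pi> S) U" and g: "g \<in> carrier G"
  obtain U' where U': "openin S U'" "U = ?\<pi> -` U' \<inter> carrier G"
    using U unfolding openin_pullback_topology by blast
  have pull: "openin (pullback_topology (carrier G) ?\<pi> S) (?\<pi> -` V \<inter> carrier G)" if "openin S V" for V
    using that unfolding openin_pullback_topology by blast
  { fix h assume h: "h \<in> carrier G" "g \<otimes>\<^bsub>G\<^esub> h \<in> U"
    then have "?\<pi> g \<otimes>\<^bsub>G Mod N\<^esub> ?\<pi> h \<in> U'" using g by (simp add: U'(2) rcos_sum)
    from D(3)[OF U'(1) \<pi>c[OF g] \<pi>c[OF h(1)] this] obtain V W where
      VW: "openin S V" "openin S W" "?\<pi> g \<in> V" "?\<pi> h \<in> W" "\<forall>x\<in>V. \<forall>y\<in>W. x \<otimes>\<^bsub>G Mod N\<^esub> y \<in> U'"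
      by (elim exE conjE)
    have "\<forall>x\<in>?\<pi> -` V \<inter> carrier G. \<forall>y\<in>?\<pi> -` W \<inter> carrier G. x \<otimes>\<^bsub>G\<^esub> y \<in> U"
    proof (intro ballI)
      fix x y assume xy: "x \<in> ?\<pi> -` V \<inter> carrier G" "y \<in> ?\<pi> -` W \<inter> carrier G"
      then have "?\<pi> x \<otimes>\<^bsub>G Mod N\<^esub> ?\<pi> y \<in> U'" using VW(5) by blast
      then show "x \<otimes>\<^bsub>G\<^esub> y \<in> U" using xy by (simp add: U'(2) rcos_sum)
    qed
    then show "\<exists>V W. openin (pullback_topology (carrier G) ?\<pi> S) V \<and> openin (pullback_topology (carrier G) ?\<pi> S) W \<and>
        g \<in> V \<and> h \<in> W \<and> (\<forall>x\<in>V. \<forall>y\<in>W. x \<otimes>\<^bsub>G\<^esub> y \<in> U)"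
      using pull[OF VW(1)] pull[OF VW(2)] VW(3,4) g h(1)
      by (intro exI[of _ "?\<pi> -` V \<inter> carrier G"] exI[of _ "?\<pi> -` W \<inter> carrier G"]) auto }
  have inv_coset: "inv\<^bsub>G Mod N\<^esub> (?\<pi> x) = ?\<pi> (inv\<^bsub>G\<^esub> x)" if "x \<in> carrier G" for x
    using inv_FactGroup[OF \<pi>c[OF that]] rcos_inv[OF that] by simp
  assume "inv\<^bsub>G\<^esub> g \<in> U"
  then have "inv\<^bsub>G Mod N\<^esub> (?\<pi> g) \<in> U'" using g inv_coset by (simp add: U'(2))
  from D(4)[OF U'(1) \<pi>c[OF g] this] obtain V where
    V: "openin S V" "?\<pi> g \<in> V" "\<forall>x\<in>V. inv\<^bsub>G Mod N\<^esub> x \<in> U'" by (elim exE conjE)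
  have "\<forall>x\<in>?\<pi> -` V \<inter> carrier G. inv\<^bsub>G\<^esub> x \<in> U"
  proof
    fix x assume x: "x \<in> ?\<pi> -` V \<inter> carrier G"
    then have "inv\<^bsub>G Mod N\<^esub> (?\<pi> x) \<in> U'" using V(3) by blast
    then show "inv\<^bsub>G\<^esub> x \<in> U" using x inv_coset[of x] by (simp add: U'(2))
  qed
  then show "\<exists>V. openin (pullback_topology (carrier G) ?\<pi> S) V \<and> g \<in> V \<and> (\<forall>x\<in>V. inv\<^bsub>G\<^esub> x \<in> U)"
    using pull[OF V(1)] V(2) g by (intro exI[of _ "?\<pi> -` V \<inter> carrier G"]) auto
qed

end

text \<open>A coarser topology \<open>S\<close> on the quotient is pulled back to \<open>G\<close>.
  If the result is \<open>T\<close>, then \<open>S\<close> is the quotient topology, since a set of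
  cosets is determined by its preimage. If the result is indiscrete, then so is \<open>S\<close>,
  and the Hausdorff property leaves a one-point quotient, on which there is only one
  topology.\<close>

theorem totally_minimal_of_dichotomy:
  assumes TG: "hausdorff_group G T"
    and dichotomy: "\<And>S. topological_group G S \<Longrightarrow> (\<And>U. openin S U \<Longrightarrow> openin T U) \<Longrightarrow>
       S = T \<or> (\<forall>U. openin S U \<longrightarrow> \<one>\<^bsub>G\<^esub> \<in> U \<longrightarrow> U = carrier G)"
  shows "totally_minimal_group G T"
  unfolding totally_minimal_group_def
proof (intro conjI allI impI TG)
  fix N assume N: "N \<lhd> G \<and> closedin T N"
  interpret normal N G using N by simp
  have T: "topological_group G T" using TG by (simp add: hausdorff_group_def)
  note D = topological_groupD[OF T]
  let ?\<pi> = "\<lambda>x. N #>\<^bsub>G\<^esub> x" and ?Q = "quotient_group_topology G T N"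
  have \<pi>: "?\<pi> ` carrier G = carrier (G Mod N)" by (auto simp: carrier_FactGroup)
  have Q: "hausdorff_group (G Mod N) ?Q" using hausdorff_group_quotient[OF T] N by simp
  have topQ: "topspace ?Q = carrier (G Mod N)" by (rule topspace_quotient_group[OF D(2)])
  have "\<not> (\<exists>S. strictly_coarser S ?Q \<and> hausdorff_group (G Mod N) S)"
  proof
    assume "\<exists>S. strictly_coarser S ?Q \<and> hausdorff_group (G Mod N) S"
    then obtain S where S: "strictly_coarser S ?Q" "topological_group (G Mod N) S" "Hausdorff_space S"
      by (auto simp: hausdorff_group_def)
    have coarser: "\<And>U. openin S U \<Longrightarrow> openin ?Q U" and neq: "S \<noteq> ?Q" and topS: "topspace S = carrier (G Mod N)"
      using S(1) topQ by (auto simp: strictly_coarser_def)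
    define S' where "S' = pullback_topology (carrier G) ?\<pi> S"
    have S': "topological_group G S'"
      unfolding S'_def by (rule topological_group_pullback[OF T _ S(2)]) (use N in simp)
    have pre: "?\<pi> -` V \<inter> carrier G = {x \<in> topspace T. ?\<pi> x \<in> V}" for V using D(2) by auto
    have "openin T U" if U: "openin S' U" for U
    proof -
      obtain V where V: "openin S V" "U = ?\<pi> -` V \<inter> carrier G"
        using U unfolding S'_def openin_pullback_topology by blast
      then show ?thesis using coarser[OF V(1)] unfolding V(2) pre by (simp add: openin_quotient_group_topology)
    qed
    from dichotomy[OF S' this] show False
    proof
      assume eq: "S' = T"
      have "openin S V" if V: "openin ?Q V" for V
      proof -
        have "openin S' (?\<pi> -` V \<inter> carrier G)"
          using V unfolding eq pre by (simp add: openin_quotient_group_topology)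
        then obtain V' where V': "openin S V'" "?\<pi> -` V \<inter> carrier G = ?\<pi> -` V' \<inter> carrier G"
          unfolding S'_def openin_pullback_topology by blast
        have "V \<subseteq> ?\<pi> ` carrier G" "V' \<subseteq> ?\<pi> ` carrier G"
          using openin_subset[OF V] openin_subset[OF V'(1)] topQ topS \<pi> by auto
        then have "V = V'" using V'(2) by blast
        then show ?thesis using V'(1) by simp
      qed
      then show False using coarser neq unfolding topology_eq by blast
    next
      assume full: "\<forall>U. openin S' U \<longrightarrow> \<one>\<^bsub>G\<^esub> \<in> U \<longrightarrow> U = carrier G"
      have S_full: "V = carrier (G Mod N)" if V: "openin S V" "?\<pi> \<one>\<^bsub>G\<^esub> \<in> V" for V
      proof -
        have "openin S' (?\<pi> -` V \<inter> carrier G)" using V(1) unfolding S'_def openin_pullback_topology by blast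
        then have "?\<pi> -` V \<inter> carrier G = carrier G" using full V(2) by blast
        then have "?\<pi> ` carrier G \<subseteq> V" by blast
        then show ?thesis using openin_subset[OF V(1)] topS \<pi> by auto
      qed
      have pi1: "?\<pi> \<one>\<^bsub>G\<^esub> \<in> carrier (G Mod N)" using \<pi> by blast
      have trivial: "X = ?\<pi> \<one>\<^bsub>G\<^esub>" if X: "X \<in> carrier (G Mod N)" for X
      proof (rule ccontr)
        assume "X \<noteq> ?\<pi> \<one>\<^bsub>G\<^esub>"
        then obtain V W where "openin S V" "openin S W" "?\<pi> \<one>\<^bsub>G\<^esub> \<in> V" "X \<in> W" "disjnt V W"
          using S(3) X pi1 unfolding Hausdorff_space_def topS by metis
        then show False using S_full X unfolding disjnt_def by blast
      qed
      have "openin S V" if V: "openin ?Q V" for V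
      proof -
        have "V \<subseteq> {?\<pi> \<one>\<^bsub>G\<^esub>}" using openin_subset[OF V] topQ trivial by auto
        moreover have "carrier (G Mod N) = {?\<pi> \<one>\<^bsub>G\<^esub>}" using trivial pi1 by blast
        ultimately have "V = {} \<or> V = topspace S" using topS by auto
        then show ?thesis by auto
      qed
      then show False using coarser neq unfolding topology_eq by blast
    qed
  qed
  then show "minimal_group (G Mod N) ?Q" using Q by (simp add: minimal_group_def)
qed

theorem theorem2p1:
  fixes M :: "'a measure"
  assumes "prob_space M" and "standard_borel M" and "atomless M"
  shows "totally_minimal_group (Aut M) (weak_topology M)"
proof -
  interpret atomless_standard_space M
    using assms by (simp add: atomless_standard_space_def atomless_standard_space_axioms_def)
  show ?thesis
  proof (rule totally_minimal_of_dichotomy[OF hausdorff_group_weak])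
    fix S assume "topological_group (Aut M) S" "\<And>U. openin S U \<Longrightarrow> openin (weak_topology M) U"
    then interpret coarser_group_topology M S by unfold_locales
    show "S = weak_topology M \<or> (\<forall>U. openin S U \<longrightarrow> \<one>\<^bsub>Aut M\<^esub> \<in> U \<longrightarrow> U = carrier (Aut M))"
      by (rule coarser_dichotomy)
  qed
qed

end
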